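(* Let $\mathcal{C}$ be a non-zero $A$-coring with ${}_A\mathcal{C}$ locally projective and let $M$ be a non-zero right $\mathcal{C}$-comodule that is self-injective and self-cogenerator and such that $\mathrm{End}^{\mathcal{C}}(M)$ is commutative. If $M$ is $\mathrm{E}$-prime, then $M$ is irreducible.
   Context: $R$ is a commutative ring with $1\neq 0$, $A$ is a unital $R$-algebra, $\mathcal{C}$ is an $A$-coring (a coalgebra in the monoidal category of $(A,A)$-bimodules), and comodules are right $\mathcal{C}$-comodules with $\mathcal{C}$-colinear maps. A left $A$-module $W$ is locally projective (in the sense of Zimmermann-Huisgen) if for every finitely generated submodule $F\subseteq W$, every surjective $A$-linear map $\pi:L\to N$ and every $A$-linear $g:W\to N$ there is an $A$-linear $g':W\to L$ with $\pi g'|_F=g|_F$. Locally projective modules are flat, so $\mathbb{M}^{\mathcal{C}}$ is a Grothendieck category with kernels formed in right $A$-modules. $M$ is self-injective if for every $\mathcal{C}$-subcomodule $K\subseteq M$ every $\mathcal{C}$-colinear map $K\to M$ extends to a $\mathcal{C}$-colinear endomorphism of $M$. $M$ is self-cogenerator if it cogenerates all its factor comodules, i.e. for every $\mathcal{C}$-subcomodule $K\subseteq M$ the intersection of the kernels of all $h\in\mathrm{Hom}^{\mathcal{C}}(M/K,M)$ is $0$. $M$ is $\mathrm{E}$-prime if the ring $\mathrm{E}_M^{\mathcal{C}}:=\mathrm{End}^{\mathcal{C}}(M)^{op}$ is a prime ring. $M$ is irreducible if it has a unique simple $\mathcal{C}$-subcomodule that is contained in every non-zero $\mathcal{C}$-subcomodule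 of $M$ (equivalently, the intersection of all non-zero $\mathcal{C}$-subcomodules of $M$ is non-zero). *)

theory Defs
  imports "HOL-Algebra.Algebra"
begin

section \<open>Algebras, one-sided modules and bimodules over a non-commutative ring\<close>

text \<open>
  The library locale \<^locale>\<open>algebra\<close> is about commutative algebras and \<^locale>\<open>module\<close> is about
  modules over commutative rings, so both are generalised here.
\<close>

locale unital_algebra = module R A + ring A for R (structure) and A (structure) +
  assumes smult_mult_left:
      "\<lbrakk>r \<in> carrier R; a \<in> carrier A; b \<in> carrier A\<rbrakk> \<Longrightarrow>
       (r \<odot>\<^bsub>A\<^esub> a) \<otimes>\<^bsub>A\<^esub> b = r \<odot>\<^bsub>A\<^esub> (a \<otimes>\<^bsub>A\<^esub> b)"
    and smult_mult_right:
      "\<lbrakk>r \<in> carrier R; a \<in> carrier A; b \<in> carrier A\<rbrakk> \<Longrightarrow>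
       a \<otimes>\<^bsub>A\<^esub> (r \<odot>\<^bsub>A\<^esub> b) = r \<odot>\<^bsub>A\<^esub> (a \<otimes>\<^bsub>A\<^esub> b)"

text \<open>
  As in the library record \<^type>\<open>module\<close>, the fields \<^const>\<open>monoid.mult\<close> and \<^const>\<open>one\<close> are inherited but
  meaningless for a module.  The record below serves right modules as well as bimodules; for a
  right module the field \<^const>\<open>smult\<close> is meaningless and never constrained.
\<close>

record ('a, 'm) bimodule = "('a, 'm) module" +
  rsmult :: "['m, 'a] \<Rightarrow> 'm"  (infixl "\<odot>r\<index>" 70)

locale left_module = A?: ring A + M?: abelian_group M
  for A :: "('a, 'x) ring_scheme" (structure) and M :: "('a, 'm, 'y) module_scheme" (structure) +
  assumes lsmult_closed:
      "\<lbrakk>a \<in> carrier A; x \<in> carrier M\<rbrakk> \<Longrightarrow> a \<odot>\<^bsub>M\<^esub> x \<in> carrier M"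
    and lsmult_distr_scalar:
      "\<lbrakk>a \<in> carrier A; b \<in> carrier A; x \<in> carrier M\<rbrakk> \<Longrightarrow>
       (a \<oplus> b) \<odot>\<^bsub>M\<^esub> x = a \<odot>\<^bsub>M\<^esub> x \<oplus>\<^bsub>M\<^esub> b \<odot>\<^bsub>M\<^esub> x"
    and lsmult_distr_vector:
      "\<lbrakk>a \<in> carrier A; x \<in> carrier M; y \<in> carrier M\<rbrakk> \<Longrightarrow>
       a \<odot>\<^bsub>M\<^esub> (x \<oplus>\<^bsub>M\<^esub> y) = a \<odot>\<^bsub>M\<^esub> x \<oplus>\<^bsub>M\<^esub> a \<odot>\<^bsub>M\<^esub> y"
    and lsmult_assoc:
      "\<lbrakk>a \<in> carrier A; b \<in> carrier A; x \<in> carrier M\<rbrakk> \<Longrightarrow>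
       (a \<otimes> b) \<odot>\<^bsub>M\<^esub> x = a \<odot>\<^bsub>M\<^esub> (b \<odot>\<^bsub>M\<^esub> x)"
    and lsmult_one:
      "x \<in> carrier M \<Longrightarrow> \<one> \<odot>\<^bsub>M\<^esub> x = x"

locale right_module = A?: ring A + M?: abelian_group M
  for A :: "('a, 'x) ring_scheme" (structure) and M :: "('a, 'm, 'y) bimodule_scheme" (structure) +
  assumes rsmult_closed:
      "\<lbrakk>a \<in> carrier A; x \<in> carrier M\<rbrakk> \<Longrightarrow> x \<odot>r\<^bsub>M\<^esub> a \<in> carrier M"
    and rsmult_distr_scalar:
      "\<lbrakk>a \<in> carrier A; b \<in> carrier A; x \<in> carrier M\<rbrakk> \<Longrightarrow>
       x \<odot>r\<^bsub>M\<^esub> (a \<oplus> b) = x \<odot>r\<^bsub>M\<^esub> a \<oplus>\<^bsub>M\<^esub> x \<odot>r\<^bsub>M\<^esub> b"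
    and rsmult_distr_vector:
      "\<lbrakk>a \<in> carrier A; x \<in> carrier M; y \<in> carrier M\<rbrakk> \<Longrightarrow>
       (x \<oplus>\<^bsub>M\<^esub> y) \<odot>r\<^bsub>M\<^esub> a = x \<odot>r\<^bsub>M\<^esub> a \<oplus>\<^bsub>M\<^esub> y \<odot>r\<^bsub>M\<^esub> a"
    and rsmult_assoc:
      "\<lbrakk>a \<in> carrier A; b \<in> carrier A; x \<in> carrier M\<rbrakk> \<Longrightarrow>
       x \<odot>r\<^bsub>M\<^esub> (a \<otimes> b) = (x \<odot>r\<^bsub>M\<^esub> a) \<odot>r\<^bsub>M\<^esub> b"
    and rsmult_one:
      "x \<in> carrier M \<Longrightarrow> x \<odot>r\<^bsub>M\<^esub> \<one> = x"

locale bimodule = left_module A M + right_module A M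
  for A :: "('a, 'x) ring_scheme" (structure) and M :: "('a, 'm, 'y) bimodule_scheme" (structure) +
  assumes lsmult_rsmult:
      "\<lbrakk>a \<in> carrier A; b \<in> carrier A; x \<in> carrier M\<rbrakk> \<Longrightarrow>
       (a \<odot>\<^bsub>M\<^esub> x) \<odot>r\<^bsub>M\<^esub> b = a \<odot>\<^bsub>M\<^esub> (x \<odot>r\<^bsub>M\<^esub> b)"

definition regular_bimodule :: "('a, 'x) ring_scheme \<Rightarrow> ('a, 'a) bimodule" where
  "regular_bimodule A =
     \<lparr>carrier = carrier A, monoid.mult = monoid.mult A, one = one A, ring.zero = ring.zero A, add = add A,
      smult = monoid.mult A, rsmult = monoid.mult A\<rparr>"

definition left_hom ::
  "('a, 'x) ring_scheme \<Rightarrow> ('a, 'm, 'y) module_scheme \<Rightarrow> ('a, 'n, 'z) module_scheme \<Rightarrow> ('m \<Rightarrow> 'n) set"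
  where "left_hom A M N =
     {f \<in> hom (add_monoid M) (add_monoid N).
        \<forall>a \<in> carrier A. \<forall>x \<in> carrier M. f (a \<odot>\<^bsub>M\<^esub> x) = a \<odot>\<^bsub>N\<^esub> f x}"

definition right_hom ::
  "('a, 'x) ring_scheme \<Rightarrow> ('a, 'm, 'y) bimodule_scheme \<Rightarrow> ('a, 'n, 'z) bimodule_scheme \<Rightarrow> ('m \<Rightarrow> 'n) set"
  where "right_hom A M N =
     {f \<in> hom (add_monoid M) (add_monoid N).
        \<forall>a \<in> carrier A. \<forall>x \<in> carrier M. f (x \<odot>r\<^bsub>M\<^esub> a) = f x \<odot>r\<^bsub>N\<^esub> a}"

definition left_submodule ::
  "('a, 'x) ring_scheme \<Rightarrow> ('a, 'm, 'y) module_scheme \<Rightarrow> 'm set \<Rightarrow> bool"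
  where "left_submodule A W F \<longleftrightarrow>
     subgroup F (add_monoid W) \<and> (\<forall>a \<in> carrier A. \<forall>x \<in> F. a \<odot>\<^bsub>W\<^esub> x \<in> F)"

definition fg_left_submodule ::
  "('a, 'x) ring_scheme \<Rightarrow> ('a, 'm, 'y) module_scheme \<Rightarrow> 'm set \<Rightarrow> bool"
  where "fg_left_submodule A W F \<longleftrightarrow>
     (\<exists>S. finite S \<and> S \<subseteq> carrier W \<and> F = \<Inter>{F'. left_submodule A W F' \<and> S \<subseteq> F'})"

text \<open>
  A HOL formula cannot quantify over the types on which the test modules live, so \<open>L\<close> and \<open>N\<close>
  range over modules with carriers in \<^typ>\<open>'w \<Rightarrow> 'a\<close> and \<^typ>\<open>'w\<close>.  This is no restriction: the
  free module on the carrier of \<open>W\<close> lives on \<^typ>\<open>'w \<Rightarrow> 'a\<close>, and testing with its canonical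
  surjection onto \<open>W\<close> already yields the lifting property for modules on arbitrary types; see
  \<open>locally_projective_lift\<close> below.
\<close>

definition locally_projective ::
  "('a, 'x) ring_scheme \<Rightarrow> ('a, 'w, 'y) module_scheme \<Rightarrow> bool"
  where "locally_projective A W \<longleftrightarrow> left_module A W \<and>
     (\<forall>F (L :: ('a, 'w \<Rightarrow> 'a) module) (N :: ('a, 'w) module). \<forall>\<pi> \<in> left_hom A L N. \<forall>g \<in> left_hom A W N.
        fg_left_submodule A W F \<and> left_module A L \<and> left_module A N \<and>
        \<pi> ` carrier L = carrier N \<longrightarrow>
        (\<exists>g' \<in> left_hom A W L. \<forall>x \<in> F. \<pi> (g' x) = g x))"


section \<open>Tensor products over a non-commutative ring\<close>

definition tensor_relators ::
  "('a, 'x) ring_scheme \<Rightarrow> ('a, 'm, 'y) bimodule_scheme \<Rightarrow> ('a, 'n, 'z) module_scheme \<Rightarrow>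
   (('m \<times> 'n) \<Rightarrow>\<^sub>0 int) set"
  where "tensor_relators A M N =
     {frag_of (x \<oplus>\<^bsub>M\<^esub> x', y) - frag_of (x, y) - frag_of (x', y) | x x' y.
        x \<in> carrier M \<and> x' \<in> carrier M \<and> y \<in> carrier N} \<union>
     {frag_of (x, y \<oplus>\<^bsub>N\<^esub> y') - frag_of (x, y) - frag_of (x, y') | x y y'.
        x \<in> carrier M \<and> y \<in> carrier N \<and> y' \<in> carrier N} \<union>
     {frag_of (x \<odot>r\<^bsub>M\<^esub> a, y) - frag_of (x, a \<odot>\<^bsub>N\<^esub> y) | x a y.
        x \<in> carrier M \<and> a \<in> carrier A \<and> y \<in> carrier N}"

definition tensor_kernel ::
  "('a, 'x) ring_scheme \<Rightarrow> ('a, 'm, 'y) bimodule_scheme \<Rightarrow> ('a, 'n, 'z) module_scheme \<Rightarrow>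
   (('m \<times> 'n) \<Rightarrow>\<^sub>0 int) set"
  where "tensor_kernel A M N =
     generate (free_Abelian_group (carrier M \<times> carrier N)) (tensor_relators A M N)"

definition tensor_group ::
  "('a, 'x) ring_scheme \<Rightarrow> ('a, 'm, 'y) bimodule_scheme \<Rightarrow> ('a, 'n, 'z) module_scheme \<Rightarrow>
   (('m \<times> 'n) \<Rightarrow>\<^sub>0 int) set monoid"
  where "tensor_group A M N =
     free_Abelian_group (carrier M \<times> carrier N) Mod tensor_kernel A M N"

definition pure_tensor ::
  "('a, 'x) ring_scheme \<Rightarrow> ('a, 'm, 'y) bimodule_scheme \<Rightarrow> ('a, 'n, 'z) module_scheme \<Rightarrow>
   'm \<Rightarrow> 'n \<Rightarrow> (('m \<times> 'n) \<Rightarrow>\<^sub>0 int) set"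
  where "pure_tensor A M N x y =
     tensor_kernel A M N #>\<^bsub>free_Abelian_group (carrier M \<times> carrier N)\<^esub> frag_of (x, y)"

text \<open>
  The homomorphism out of the tensor product induced by a biadditive \<open>A\<close>-balanced map \<open>b\<close>;
  its unique existence for such \<open>b\<close> is \<open>tensor_lift_unique_existence\<close> below.
\<close>

definition tensor_lift ::
  "('a, 'x) ring_scheme \<Rightarrow> ('a, 'm, 'y) bimodule_scheme \<Rightarrow> ('a, 'n, 'z) module_scheme \<Rightarrow>
   ('g, 'u) monoid_scheme \<Rightarrow> ('m \<Rightarrow> 'n \<Rightarrow> 'g) \<Rightarrow> (('m \<times> 'n) \<Rightarrow>\<^sub>0 int) set \<Rightarrow> 'g"
  where "tensor_lift A M N G b =
     (THE h. h \<in> hom (tensor_group A M N) G \<and> h \<in> extensional (carrier (tensor_group A M N)) \<and>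
        (\<forall>x \<in> carrier M. \<forall>y \<in> carrier N. h (pure_tensor A M N x y) = b x y))"

definition tensor_map ::
  "('a, 'x) ring_scheme \<Rightarrow>
   ('a, 'm, 'y) bimodule_scheme \<Rightarrow> ('a, 'n, 'z) module_scheme \<Rightarrow>
   ('a, 'p, 'u) bimodule_scheme \<Rightarrow> ('a, 'q, 'v) module_scheme \<Rightarrow>
   ('m \<Rightarrow> 'p) \<Rightarrow> ('n \<Rightarrow> 'q) \<Rightarrow> (('m \<times> 'n) \<Rightarrow>\<^sub>0 int) set \<Rightarrow> (('p \<times> 'q) \<Rightarrow>\<^sub>0 int) set"
  where "tensor_map A M N P Q f g =
     tensor_lift A M N (tensor_group A P Q) (\<lambda>x y. pure_tensor A P Q (f x) (g y))"

text \<open>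
  Left action from \<open>M\<close>, right action from \<open>N\<close>; if \<open>M\<close> is only a right module, only the right
  action is meaningful.
\<close>

definition tensor ::
  "('a, 'x) ring_scheme \<Rightarrow> ('a, 'm, 'y) bimodule_scheme \<Rightarrow> ('a, 'n, 'z) bimodule_scheme \<Rightarrow>
   ('a, (('m \<times> 'n) \<Rightarrow>\<^sub>0 int) set) bimodule"
  where "tensor A M N =
     \<lparr>carrier = carrier (tensor_group A M N), monoid.mult = undefined, one = undefined,
      ring.zero = one (tensor_group A M N), add = monoid.mult (tensor_group A M N),
      smult = (\<lambda>a. tensor_map A M N M N (\<lambda>x. a \<odot>\<^bsub>M\<^esub> x) (\<lambda>y. y)),
      rsmult = (\<lambda>t a. tensor_map A M N M N (\<lambda>x. x) (\<lambda>y. y \<odot>r\<^bsub>N\<^esub> a) t)\<rparr>"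

definition tensor_assoc ::
  "('a, 'x) ring_scheme \<Rightarrow> ('a, 'm, 'y) bimodule_scheme \<Rightarrow> ('a, 'n, 'z) bimodule_scheme \<Rightarrow>
   ('a, 'p, 'u) bimodule_scheme \<Rightarrow>
   (((('m \<times> 'n) \<Rightarrow>\<^sub>0 int) set \<times> 'p) \<Rightarrow>\<^sub>0 int) set \<Rightarrow> (('m \<times> (('n \<times> 'p) \<Rightarrow>\<^sub>0 int) set) \<Rightarrow>\<^sub>0 int) set"
  where "tensor_assoc A M N P =
     tensor_lift A (tensor A M N) P (tensor_group A M (tensor A N P))
       (\<lambda>t z. tensor_lift A M N (tensor_group A M (tensor A N P))
                (\<lambda>x y. pure_tensor A M (tensor A N P) x (pure_tensor A N P y z)) t)"

definition left_unitor ::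
  "('a, 'x) ring_scheme \<Rightarrow> ('a, 'm, 'y) module_scheme \<Rightarrow> (('a \<times> 'm) \<Rightarrow>\<^sub>0 int) set \<Rightarrow> 'm"
  where "left_unitor A M =
     tensor_lift A (regular_bimodule A) M (add_monoid M) (\<lambda>a x. a \<odot>\<^bsub>M\<^esub> x)"

definition right_unitor ::
  "('a, 'x) ring_scheme \<Rightarrow> ('a, 'm, 'y) bimodule_scheme \<Rightarrow> (('m \<times> 'a) \<Rightarrow>\<^sub>0 int) set \<Rightarrow> 'm"
  where "right_unitor A M =
     tensor_lift A M (regular_bimodule A) (add_monoid M) (\<lambda>x a. x \<odot>r\<^bsub>M\<^esub> a)"


section \<open>Corings and comodules\<close>

record ('a, 'c) coring = "('a, 'c) bimodule" +
  comult :: "'c \<Rightarrow> (('c \<times> 'c) \<Rightarrow>\<^sub>0 int) set"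
  counit :: "'c \<Rightarrow> 'a"

locale coring = bimodule A C for A :: "('a, 'x) ring_scheme" (structure) and C :: "('a, 'c) coring" (structure) +
  assumes comult_bilinear: "comult C \<in> left_hom A C (tensor A C C) \<inter> right_hom A C (tensor A C C)"
    and counit_bilinear:
      "counit C \<in> left_hom A C (regular_bimodule A) \<inter> right_hom A C (regular_bimodule A)"
    and coassoc: "c \<in> carrier C \<Longrightarrow>
      tensor_assoc A C C C (tensor_map A C C (tensor A C C) C (comult C) (\<lambda>d. d) (comult C c)) =
      tensor_map A C C C (tensor A C C) (\<lambda>d. d) (comult C) (comult C c)"
    and left_counit: "c \<in> carrier C \<Longrightarrow>
      left_unitor A C (tensor_map A C C (regular_bimodule A) C (counit C) (\<lambda>d. d) (comult C c)) = c"
    and right_counit: "c \<in> carrier C \<Longrightarrow>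
      right_unitor A C (tensor_map A C C C (regular_bimodule A) (\<lambda>d. d) (counit C) (comult C c)) = c"

record ('a, 'm, 'c) comodule = "('a, 'm) bimodule" +
  coact :: "'m \<Rightarrow> (('m \<times> 'c) \<Rightarrow>\<^sub>0 int) set"

locale comodule = C?: coring A C + M?: right_module A M
  for A :: "('a, 'x) ring_scheme" (structure) and C :: "('a, 'c) coring" (structure)
    and M :: "('a, 'm, 'c) comodule" (structure) +
  assumes coact_linear: "coact M \<in> right_hom A M (tensor A M C)"
    and coact_coassoc: "x \<in> carrier M \<Longrightarrow>
      tensor_assoc A M C C (tensor_map A M C (tensor A M C) C (coact M) (\<lambda>d. d) (coact M x)) =
      tensor_map A M C M (tensor A C C) (\<lambda>y. y) (comult C) (coact M x)"
    and coact_counit: "x \<in> carrier M \<Longrightarrow>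
      right_unitor A M (tensor_map A M C M (regular_bimodule A) (\<lambda>y. y) (counit C) (coact M x)) = x"

definition comod_hom ::
  "('a, 'x) ring_scheme \<Rightarrow> ('a, 'c) coring \<Rightarrow> ('a, 'm, 'c) comodule \<Rightarrow> ('a, 'n, 'c) comodule \<Rightarrow>
   ('m \<Rightarrow> 'n) set"
  where "comod_hom A C M N =
     {f \<in> right_hom A M N \<inter> extensional (carrier M).
        \<forall>x \<in> carrier M. tensor_map A M C N C f (\<lambda>c. c) (coact M x) = coact N (f x)}"

text \<open>
  A subcomodule is a subset \<open>H\<close> together with a coaction \<open>\<rho>\<close> of its own.  For an arbitrary coring
  \<open>\<rho>\<close> need not be determined by \<open>H\<close>, since \<open>H \<otimes> C \<rightarrow> M \<otimes> C\<close> need not be injective.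
\<close>

definition sub_structure ::
  "('a, 'm, 'c) comodule \<Rightarrow> 'm set \<Rightarrow> ('m \<Rightarrow> (('m \<times> 'c) \<Rightarrow>\<^sub>0 int) set) \<Rightarrow> ('a, 'm, 'c) comodule"
  where "sub_structure M H \<rho> = M\<lparr>carrier := H, coact := \<rho>\<rparr>"

definition subcomodule_with ::
  "('a, 'x) ring_scheme \<Rightarrow> ('a, 'c) coring \<Rightarrow> ('a, 'm, 'c) comodule \<Rightarrow> 'm set \<Rightarrow>
   ('m \<Rightarrow> (('m \<times> 'c) \<Rightarrow>\<^sub>0 int) set) \<Rightarrow> bool"
  where "subcomodule_with A C M H \<rho> \<longleftrightarrow>
     H \<subseteq> carrier M \<and> comodule A C (sub_structure M H \<rho>) \<and>
     (\<lambda>x\<in>H. x) \<in> comod_hom A C (sub_structure M H \<rho>) M"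

definition subcomodule ::
  "('a, 'x) ring_scheme \<Rightarrow> ('a, 'c) coring \<Rightarrow> ('a, 'm, 'c) comodule \<Rightarrow> 'm set \<Rightarrow> bool"
  where "subcomodule A C M H \<longleftrightarrow> (\<exists>\<rho>. subcomodule_with A C M H \<rho>)"

definition quotient_module ::
  "('a, 'm, 'y) bimodule_scheme \<Rightarrow> 'm set \<Rightarrow> ('a, 'm set) bimodule"
  where "quotient_module M H =
     \<lparr>carrier = a_rcosets\<^bsub>M\<^esub> H, monoid.mult = undefined, one = undefined,
      ring.zero = H, add = set_add M, smult = undefined,
      rsmult = (\<lambda>D a. (THE E. \<exists>x \<in> D. E = H +>\<^bsub>M\<^esub> (x \<odot>r\<^bsub>M\<^esub> a)))\<rparr>"

text \<open>
  The coaction of \<open>M/H\<close> is the one making the projection colinear; the choice of representative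
  \<open>x\<close> is immaterial when \<open>H\<close> is a subcomodule.
\<close>

definition quotient_comodule ::
  "('a, 'x) ring_scheme \<Rightarrow> ('a, 'c) coring \<Rightarrow> ('a, 'm, 'c) comodule \<Rightarrow> 'm set \<Rightarrow>
   ('a, 'm set, 'c) comodule"
  where "quotient_comodule A C M H =
     bimodule.extend (quotient_module M H)
       \<lparr>coact = (\<lambda>D. (THE E. \<exists>x \<in> D.
          E = tensor_map A M C (quotient_module M H) C (\<lambda>y. H +>\<^bsub>M\<^esub> y) (\<lambda>c. c) (coact M x)))\<rparr>"

definition comod_End ::
  "('a, 'x) ring_scheme \<Rightarrow> ('a, 'c) coring \<Rightarrow> ('a, 'm, 'c) comodule \<Rightarrow> ('m \<Rightarrow> 'm) ring"
  where "comod_End A C M =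
     \<lparr>carrier = comod_hom A C M M, monoid.mult = (\<lambda>f g. compose (carrier M) f g),
      one = (\<lambda>x\<in>carrier M. x), ring.zero = (\<lambda>x\<in>carrier M. \<zero>\<^bsub>M\<^esub>),
      add = (\<lambda>f g. \<lambda>x\<in>carrier M. f x \<oplus>\<^bsub>M\<^esub> g x)\<rparr>"

definition opposite_ring :: "('a, 'x) ring_scheme \<Rightarrow> ('a, 'x) ring_scheme" where
  "opposite_ring R = R\<lparr>monoid.mult := (\<lambda>x y. y \<otimes>\<^bsub>R\<^esub> x)\<rparr>"

definition prime_ring :: "('a, 'x) ring_scheme \<Rightarrow> bool" where
  "prime_ring R \<longleftrightarrow> ring R \<and> carrier R \<noteq> {\<zero>\<^bsub>R\<^esub>} \<and>
     (\<forall>I J. ideal I R \<and> ideal J R \<and> I \<cdot>\<^bsub>R\<^esub> J = {\<zero>\<^bsub>R\<^esub>} \<longrightarrow> I = {\<zero>\<^bsub>R\<^esub>} \<or> J = {\<zero>\<^bsub>R\<^esub>})"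

definition E_prime ::
  "('a, 'x) ring_scheme \<Rightarrow> ('a, 'c) coring \<Rightarrow> ('a, 'm, 'c) comodule \<Rightarrow> bool"
  where "E_prime A C M \<longleftrightarrow> prime_ring (opposite_ring (comod_End A C M))"

definition self_injective ::
  "('a, 'x) ring_scheme \<Rightarrow> ('a, 'c) coring \<Rightarrow> ('a, 'm, 'c) comodule \<Rightarrow> bool"
  where "self_injective A C M \<longleftrightarrow>
     (\<forall>H \<rho>. subcomodule_with A C M H \<rho> \<longrightarrow>
        (\<forall>f \<in> comod_hom A C (sub_structure M H \<rho>) M.
           \<exists>g \<in> comod_hom A C M M. \<forall>x \<in> H. g x = f x))"

definition self_cogenerator ::
  "('a, 'x) ring_scheme \<Rightarrow> ('a, 'c) coring \<Rightarrow> ('a, 'm, 'c) comodule \<Rightarrow> bool"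
  where "self_cogenerator A C M \<longleftrightarrow>
     (\<forall>H. subcomodule A C M H \<longrightarrow>
        (\<Inter>h \<in> comod_hom A C (quotient_comodule A C M H) M.
           a_kernel (quotient_comodule A C M H) M h) = {\<zero>\<^bsub>quotient_comodule A C M H\<^esub>})"

definition simple_comodule ::
  "('a, 'x) ring_scheme \<Rightarrow> ('a, 'c) coring \<Rightarrow> ('a, 'm, 'c) comodule \<Rightarrow> bool"
  where "simple_comodule A C S \<longleftrightarrow>
     comodule A C S \<and> carrier S \<noteq> {\<zero>\<^bsub>S\<^esub>} \<and>
     (\<forall>H. subcomodule A C S H \<longrightarrow> H = {\<zero>\<^bsub>S\<^esub>} \<or> H = carrier S)"

definition simple_subcomodule ::
  "('a, 'x) ring_scheme \<Rightarrow> ('a, 'c) coring \<Rightarrow> ('a, 'm, 'c) comodule \<Rightarrow> 'm set \<Rightarrow> bool"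
  where "simple_subcomodule A C M S \<longleftrightarrow>
     (\<exists>\<rho>. subcomodule_with A C M S \<rho> \<and> simple_comodule A C (sub_structure M S \<rho>))"

definition irreducible_comodule ::
  "('a, 'x) ring_scheme \<Rightarrow> ('a, 'c) coring \<Rightarrow> ('a, 'm, 'c) comodule \<Rightarrow> bool"
  where "irreducible_comodule A C M \<longleftrightarrow>
     (\<exists>!S. simple_subcomodule A C M S \<and>
        (\<forall>K. subcomodule A C M K \<and> K \<noteq> {\<zero>\<^bsub>M\<^esub>} \<longrightarrow> S \<subseteq> K))"


section \<open>The universal property of the tensor product\<close>

lemma tensor_lift_unique_existence:
  assumes "right_module A M" "left_module A N" "comm_group G"
    and closed: "\<And>x y. \<lbrakk>x \<in> carrier M; y \<in> carrier N\<rbrakk> \<Longrightarrow> b x y \<in> carrier G"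
    and add_left: "\<And>x x' y. \<lbrakk>x \<in> carrier M; x' \<in> carrier M; y \<in> carrier N\<rbrakk> \<Longrightarrow>
      b (x \<oplus>\<^bsub>M\<^esub> x') y = b x y \<otimes>\<^bsub>G\<^esub> b x' y"
    and add_right: "\<And>x y y'. \<lbrakk>x \<in> carrier M; y \<in> carrier N; y' \<in> carrier N\<rbrakk> \<Longrightarrow>
      b x (y \<oplus>\<^bsub>N\<^esub> y') = b x y \<otimes>\<^bsub>G\<^esub> b x y'"
    and balanced: "\<And>x a y. \<lbrakk>x \<in> carrier M; a \<in> carrier A; y \<in> carrier N\<rbrakk> \<Longrightarrow>
      b (x \<odot>r\<^bsub>M\<^esub> a) y = b x (a \<odot>\<^bsub>N\<^esub> y)"
  shows "\<exists>!h. h \<in> hom (tensor_group A M N) G \<and> h \<in> extensional (carrier (tensor_group A M N)) \<and>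
           (\<forall>x \<in> carrier M. \<forall>y \<in> carrier N. h (pure_tensor A M N x y) = b x y)"
proof -
  interpret M: right_module A M by fact
  interpret N: left_module A N by fact
  interpret G: comm_group G by fact
  let ?S = "carrier M \<times> carrier N"
  let ?F = "free_Abelian_group ?S"
  let ?K = "tensor_kernel A M N"
  let ?T = "tensor_group A M N"
  interpret F: comm_group ?F by (rule abelian_free_Abelian_group)
  have rel: "tensor_relators A M N \<subseteq> carrier ?F"
    unfolding tensor_relators_def
    by (auto simp: M.rsmult_closed N.lsmult_closed dest!: subsetD[OF keys_diff])
  have sub: "subgroup ?K ?F"
    unfolding tensor_kernel_def using rel by (rule F.generate_is_subgroup)
  interpret K: normal ?K ?F by (rule F.subgroup_imp_normal[OF sub])
  have T: "?T = ?F Mod ?K" by (simp add: tensor_group_def)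
  interpret T: group ?T unfolding T by (rule K.factorgroup_is_group)
  have coset_hom: "(\<lambda>u. ?K #>\<^bsub>?F\<^esub> u) \<in> hom ?F ?T" unfolding T by (rule K.r_coset_hom_Mod)
  have im: "(\<lambda>(x, y). b x y) ` ?S \<subseteq> carrier G" using closed by auto
  obtain h0 where h0: "h0 \<in> hom ?F G" and h0_gen: "\<And>p. p \<in> ?S \<Longrightarrow> h0 (frag_of p) = (case p of (x, y) \<Rightarrow> b x y)"
    using G.free_Abelian_group_universal[OF im] by metis
  interpret h0: group_hom ?F G h0
    using h0 by unfold_locales
  have h0_diff: "h0 (u - v) = h0 u \<otimes>\<^bsub>G\<^esub> inv\<^bsub>G\<^esub> h0 v" if "u \<in> carrier ?F" "v \<in> carrier ?F" for u v
    using h0.hom_mult[of u "- v"] h0.hom_inv[of v] that by simp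
  have diff_closed: "u - v \<in> carrier ?F" if "u \<in> carrier ?F" "v \<in> carrier ?F" for u v
    using that by (auto dest!: subsetD[OF keys_diff])
  have "tensor_relators A M N \<subseteq> kernel ?F G h0"
  proof
    fix r assume r: "r \<in> tensor_relators A M N"
    have "h0 r = \<one>\<^bsub>G\<^esub>"
    proof -
      have cancel: "p \<otimes>\<^bsub>G\<^esub> q \<otimes>\<^bsub>G\<^esub> inv\<^bsub>G\<^esub> p \<otimes>\<^bsub>G\<^esub> inv\<^bsub>G\<^esub> q = \<one>\<^bsub>G\<^esub>"
        if "p \<in> carrier G" "q \<in> carrier G" for p q
      proof -
        have "p \<otimes>\<^bsub>G\<^esub> q \<otimes>\<^bsub>G\<^esub> inv\<^bsub>G\<^esub> p = q"
          using that by (simp add: G.m_comm[of p q] G.m_assoc)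
        then show ?thesis using that by simp
      qed
      have three: "h0 (frag_of p - frag_of q - frag_of s) =
          h0 (frag_of p) \<otimes>\<^bsub>G\<^esub> inv\<^bsub>G\<^esub> h0 (frag_of q) \<otimes>\<^bsub>G\<^esub> inv\<^bsub>G\<^esub> h0 (frag_of s)"
        if "p \<in> ?S" "q \<in> ?S" "s \<in> ?S" for p q s
      proof -
        have F: "frag_of p \<in> carrier ?F" "frag_of q \<in> carrier ?F" "frag_of s \<in> carrier ?F"
          using that by simp_all
        show ?thesis
          by (simp only: h0_diff[OF diff_closed[OF F(1,2)] F(3)] h0_diff[OF F(1,2)])
      qed
      have 1: "h0 (frag_of (x \<oplus>\<^bsub>M\<^esub> x', y) - frag_of (x, y) - frag_of (x', y)) = \<one>\<^bsub>G\<^esub>"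
        if "x \<in> carrier M" "x' \<in> carrier M" "y \<in> carrier N" for x x' y
        using that by (subst three) (simp_all add: h0_gen add_left cancel closed)
      have 2: "h0 (frag_of (x, y \<oplus>\<^bsub>N\<^esub> y') - frag_of (x, y) - frag_of (x, y')) = \<one>\<^bsub>G\<^esub>"
        if "x \<in> carrier M" "y \<in> carrier N" "y' \<in> carrier N" for x y y'
        using that by (subst three) (simp_all add: h0_gen add_right cancel closed)
      have 3: "h0 (frag_of (x \<odot>r\<^bsub>M\<^esub> a, y) - frag_of (x, a \<odot>\<^bsub>N\<^esub> y)) = \<one>\<^bsub>G\<^esub>"
        if "x \<in> carrier M" "a \<in> carrier A" "y \<in> carrier N" for x a y
        using that by (subst h0_diff) (simp_all add: h0_gen balanced closed M.rsmult_closed N.lsmult_closed)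
      show ?thesis
        using r unfolding tensor_relators_def
        by (elim UnE CollectE exE conjE) (simp_all only: 1 2 3)
    qed
    then show "r \<in> kernel ?F G h0" unfolding kernel_def using subsetD[OF rel r] by blast
  qed
  then have "?K \<subseteq> kernel ?F G h0"
    unfolding tensor_kernel_def by (intro F.generate_subgroup_incl h0.subgroup_kernel)
  then obtain g where g: "g \<in> hom ?T G" and gu: "\<And>u. u \<in> carrier ?F \<Longrightarrow> g (?K #>\<^bsub>?F\<^esub> u) = h0 u"
    using h0.FactGroup_universal_kernel[OF K.normal_axioms] unfolding T by metis
  have pure: "pure_tensor A M N x y \<in> carrier ?T" if "x \<in> carrier M" "y \<in> carrier N" for x y
    using hom_in_carrier[OF coset_hom] that by (simp add: pure_tensor_def)
  show ?thesis
  proof (rule ex1I[of _ "restrict g (carrier ?T)"])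
    have "restrict g (carrier ?T) \<in> hom ?T G"
      using g by (auto simp: hom_def)
    then show "restrict g (carrier ?T) \<in> hom ?T G \<and> restrict g (carrier ?T) \<in> extensional (carrier ?T) \<and>
      (\<forall>x \<in> carrier M. \<forall>y \<in> carrier N. restrict g (carrier ?T) (pure_tensor A M N x y) = b x y)"
      using pure by (auto simp: gu h0_gen pure_tensor_def)
  next
    fix h assume h: "h \<in> hom ?T G \<and> h \<in> extensional (carrier ?T) \<and>
           (\<forall>x \<in> carrier M. \<forall>y \<in> carrier N. h (pure_tensor A M N x y) = b x y)"
    define k where "k = (\<lambda>u. h (?K #>\<^bsub>?F\<^esub> u))"
    have k: "k \<in> hom ?F G"
      using h coset_hom hom_compose[of "\<lambda>u. ?K #>\<^bsub>?F\<^esub> u" ?F ?T h G] by (simp add: k_def comp_def)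
    interpret k: group_hom ?F G k
      using k by unfold_locales
    have k_diff: "k (u - v) = k u \<otimes>\<^bsub>G\<^esub> inv\<^bsub>G\<^esub> k v" if "u \<in> carrier ?F" "v \<in> carrier ?F" for u v
      using k.hom_mult[of u "- v"] k.hom_inv[of v] that by simp
    have k_gen: "k (frag_of p) = h0 (frag_of p)" if "p \<in> ?S" for p
      using that h h0_gen by (auto simp: k_def pure_tensor_def)
    have "k u = h0 u" if "Poly_Mapping.keys u \<subseteq> ?S" for u
    proof (rule free_Abelian_group_induct[OF that])
      show "k 0 = h0 0" using k.hom_one h0.hom_one by simp
    next
      fix u v assume "Poly_Mapping.keys u \<subseteq> ?S" "Poly_Mapping.keys v \<subseteq> ?S" "k u = h0 u" "k v = h0 v"
      then show "k (u - v) = h0 (u - v)" by (simp add: k_diff h0_diff)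
    qed (rule k_gen)
    then have "h t = g t" if "t \<in> carrier ?T" for t
      using that gu by (auto simp: T carrier_FactGroup k_def)
    then show "h = restrict g (carrier ?T)"
      using h by (auto simp: fun_eq_iff extensional_def)
  qed
qed


section \<open>Independence of local projectivity of the types of the test modules\<close>

definition free_left_module :: "('a, 'x) ring_scheme \<Rightarrow> 'w set \<Rightarrow> ('a, 'w \<Rightarrow> 'a) module" where
  "free_left_module A S =
     \<lparr>carrier = {u \<in> S \<rightarrow>\<^sub>E carrier A. finite {w \<in> S. u w \<noteq> \<zero>\<^bsub>A\<^esub>}},
      monoid.mult = undefined, one = undefined,
      ring.zero = (\<lambda>w\<in>S. \<zero>\<^bsub>A\<^esub>), add = (\<lambda>u v. \<lambda>w\<in>S. u w \<oplus>\<^bsub>A\<^esub> v w),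
      smult = (\<lambda>a u. \<lambda>w\<in>S. a \<otimes>\<^bsub>A\<^esub> u w)\<rparr>"

lemma restrict_in_free_left_module:
  "(\<lambda>w\<in>S. f w) \<in> carrier (free_left_module A S) \<longleftrightarrow>
     (\<forall>w \<in> S. f w \<in> carrier A) \<and> finite {w \<in> S. f w \<noteq> \<zero>\<^bsub>A\<^esub>}"
proof -
  have "{w \<in> S. (\<lambda>w\<in>S. f w) w \<noteq> \<zero>\<^bsub>A\<^esub>} = {w \<in> S. f w \<noteq> \<zero>\<^bsub>A\<^esub>}" by auto
  then show ?thesis by (auto simp: free_left_module_def PiE_iff)
qed

lemma left_module_free:
  assumes "ring A" shows "left_module A (free_left_module A S)"
proof -
  interpret A: ring A by fact
  let ?L = "free_left_module A S"
  have carr: "u \<in> carrier ?L \<longleftrightarrow> u \<in> extensional S \<and> (\<forall>w \<in> S. u w \<in> carrier A) \<and> finite {w \<in> S. u w \<noteq> \<zero>\<^bsub>A\<^esub>}" for u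
    by (auto simp: free_left_module_def PiE_iff)
  have ops: "u \<oplus>\<^bsub>?L\<^esub> v = (\<lambda>w\<in>S. u w \<oplus>\<^bsub>A\<^esub> v w)" "\<zero>\<^bsub>?L\<^esub> = (\<lambda>w\<in>S. \<zero>\<^bsub>A\<^esub>)"
     "a \<odot>\<^bsub>?L\<^esub> u = (\<lambda>w\<in>S. a \<otimes>\<^bsub>A\<^esub> u w)" for u v a
    by (simp_all add: free_left_module_def)
  have add: "u \<oplus>\<^bsub>?L\<^esub> v \<in> carrier ?L" if "u \<in> carrier ?L" "v \<in> carrier ?L" for u v
  proof -
    have "finite {w \<in> S. u w \<oplus>\<^bsub>A\<^esub> v w \<noteq> \<zero>\<^bsub>A\<^esub>}"
      by (rule finite_subset[of _ "{w \<in> S. u w \<noteq> \<zero>\<^bsub>A\<^esub>} \<union> {w \<in> S. v w \<noteq> \<zero>\<^bsub>A\<^esub>}"])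
        (use that in \<open>auto simp: carr\<close>)
    then show ?thesis using that unfolding ops restrict_in_free_left_module by (simp add: carr)
  qed
  have smult: "a \<odot>\<^bsub>?L\<^esub> u \<in> carrier ?L" if "a \<in> carrier A" "u \<in> carrier ?L" for a u
  proof -
    have "finite {w \<in> S. a \<otimes>\<^bsub>A\<^esub> u w \<noteq> \<zero>\<^bsub>A\<^esub>}"
      by (rule finite_subset[of _ "{w \<in> S. u w \<noteq> \<zero>\<^bsub>A\<^esub>}"]) (use that in \<open>auto simp: carr\<close>)
    then show ?thesis using that unfolding ops restrict_in_free_left_module by (simp add: carr)
  qed
  have minus: "(\<lambda>w\<in>S. \<ominus>\<^bsub>A\<^esub> u w) \<in> carrier ?L" if "u \<in> carrier ?L" for u
  proof -
    have "finite {w \<in> S. \<ominus>\<^bsub>A\<^esub> u w \<noteq> \<zero>\<^bsub>A\<^esub>}"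
      by (rule finite_subset[of _ "{w \<in> S. u w \<noteq> \<zero>\<^bsub>A\<^esub>}"]) (use that in \<open>auto simp: carr\<close>)
    then show ?thesis using that unfolding restrict_in_free_left_module by (simp add: carr)
  qed
  have zero: "\<zero>\<^bsub>?L\<^esub> \<in> carrier ?L" by (simp add: ops restrict_in_free_left_module)
  interpret L: abelian_group ?L
  proof (rule abelian_groupI)
    fix u assume u: "u \<in> carrier ?L"
    then have "(\<lambda>w\<in>S. \<ominus>\<^bsub>A\<^esub> u w) \<oplus>\<^bsub>?L\<^esub> u = \<zero>\<^bsub>?L\<^esub>"
      unfolding ops by (intro restrict_ext) (simp add: carr A.l_neg)
    then show "\<exists>v\<in>carrier ?L. v \<oplus>\<^bsub>?L\<^esub> u = \<zero>\<^bsub>?L\<^esub>"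
      using minus[OF u] by blast
    show "\<zero>\<^bsub>?L\<^esub> \<oplus>\<^bsub>?L\<^esub> u = u"
      by (rule extensionalityI[of _ S]) (use u in \<open>auto simp: ops carr\<close>)
  next
    fix u v t assume "u \<in> carrier ?L" "v \<in> carrier ?L" "t \<in> carrier ?L"
    then show "u \<oplus>\<^bsub>?L\<^esub> v \<oplus>\<^bsub>?L\<^esub> t = u \<oplus>\<^bsub>?L\<^esub> (v \<oplus>\<^bsub>?L\<^esub> t)"
      unfolding ops by (intro restrict_ext) (simp add: carr A.a_assoc)
  next
    fix u v assume "u \<in> carrier ?L" "v \<in> carrier ?L"
    then show "u \<oplus>\<^bsub>?L\<^esub> v = v \<oplus>\<^bsub>?L\<^esub> u"
      unfolding ops by (intro restrict_ext) (simp add: carr A.a_comm)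
  qed (fact add zero)+
  show ?thesis
  proof unfold_locales
    fix u assume u: "u \<in> carrier ?L"
    show "\<one>\<^bsub>A\<^esub> \<odot>\<^bsub>?L\<^esub> u = u"
      by (rule extensionalityI[of _ S]) (use u in \<open>auto simp: ops carr\<close>)
  next
    fix a b u v assume "a \<in> carrier A" "b \<in> carrier A" "u \<in> carrier ?L"
    then show "(a \<oplus>\<^bsub>A\<^esub> b) \<odot>\<^bsub>?L\<^esub> u = a \<odot>\<^bsub>?L\<^esub> u \<oplus>\<^bsub>?L\<^esub> b \<odot>\<^bsub>?L\<^esub> u"
      and "(a \<otimes>\<^bsub>A\<^esub> b) \<odot>\<^bsub>?L\<^esub> u = a \<odot>\<^bsub>?L\<^esub> (b \<odot>\<^bsub>?L\<^esub> u)"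
      unfolding ops by (auto intro!: restrict_ext simp: carr A.l_distr A.m_assoc)
  next
    fix a u v assume "a \<in> carrier A" "u \<in> carrier ?L" "v \<in> carrier ?L"
    then show "a \<odot>\<^bsub>?L\<^esub> (u \<oplus>\<^bsub>?L\<^esub> v) = a \<odot>\<^bsub>?L\<^esub> u \<oplus>\<^bsub>?L\<^esub> a \<odot>\<^bsub>?L\<^esub> v"
      unfolding ops by (auto intro!: restrict_ext simp: carr A.r_distr)
  qed (fact smult)
qed

definition free_extension ::
  "('a, 'v, 'y) module_scheme \<Rightarrow> 'w set \<Rightarrow> ('w \<Rightarrow> 'v) \<Rightarrow> ('w \<Rightarrow> 'a) \<Rightarrow> 'v" where
  "free_extension V S f u = gfinprod (add_monoid V) (\<lambda>w. u w \<odot>\<^bsub>V\<^esub> f w) S"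

context left_module
begin

lemma lsmult_zero_left: "x \<in> carrier M \<Longrightarrow> \<zero> \<odot>\<^bsub>M\<^esub> x = \<zero>\<^bsub>M\<^esub>"
  by (metis A.zero_closed A.r_zero M.add.r_cancel_one' lsmult_closed lsmult_distr_scalar)

lemma lsmult_zero_right: "a \<in> carrier A \<Longrightarrow> a \<odot>\<^bsub>M\<^esub> \<zero>\<^bsub>M\<^esub> = \<zero>\<^bsub>M\<^esub>"
  by (metis M.zero_closed M.r_zero M.add.r_cancel_one' lsmult_closed lsmult_distr_vector)

lemma free_extension_eq_finsum:
  assumes "u \<in> carrier (free_left_module A S)" "f \<in> S \<rightarrow> carrier M"
    and "finite T" "T \<subseteq> S" "{w \<in> S. u w \<noteq> \<zero>} \<subseteq> T"
  shows "free_extension M S f u = (\<Oplus>\<^bsub>M\<^esub>w \<in> T. u w \<odot>\<^bsub>M\<^esub> f w)"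
proof -
  have cl: "u w \<odot>\<^bsub>M\<^esub> f w \<in> carrier M" if "w \<in> S" for w
    using assms(1,2) that by (auto simp: free_left_module_def intro!: lsmult_closed)
  have z: "u w \<odot>\<^bsub>M\<^esub> f w = \<zero>\<^bsub>M\<^esub>" if "w \<in> S - T" for w
  proof -
    have "u w = \<zero>" "f w \<in> carrier M" using assms(2,5) that by blast+
    then show ?thesis by (simp add: lsmult_zero_left)
  qed
  have "gfinprod (add_monoid M) (\<lambda>w. u w \<odot>\<^bsub>M\<^esub> f w) T = gfinprod (add_monoid M) (\<lambda>w. u w \<odot>\<^bsub>M\<^esub> f w) S"
    by (rule M.add.gfinprod_mono_neutral_cong_left) (use assms(4) cl z in auto)
  moreover have "gfinprod (add_monoid M) (\<lambda>w. u w \<odot>\<^bsub>M\<^esub> f w) T = (\<Oplus>\<^bsub>M\<^esub>w \<in> T. u w \<odot>\<^bsub>M\<^esub> f w)"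
    by (rule M.add.gfinprod_eq_finprod) (use assms(3,4) cl in auto)
  ultimately show ?thesis by (simp add: free_extension_def)
qed

lemma free_extension_hom:
  assumes f: "f \<in> S \<rightarrow> carrier M"
  shows "free_extension M S f \<in> left_hom A (free_left_module A S) M"
proof -
  let ?L = "free_left_module A S"
  interpret L: left_module A ?L by (rule left_module_free) unfold_locales
  let ?s = "\<lambda>u. {w \<in> S. u w \<noteq> \<zero>}"
  have fin: "finite (?s u)" and uA: "w \<in> S \<Longrightarrow> u w \<in> carrier A" if "u \<in> carrier ?L" for u w
    using that by (auto simp: free_left_module_def)
  have fM: "w \<in> S \<Longrightarrow> f w \<in> carrier M" for w using f by auto
  note eq = free_extension_eq_finsum[OF _ f]
  have closed: "free_extension M S f u \<in> carrier M" if "u \<in> carrier ?L" for u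
    using that by (subst eq[OF that fin[OF that]]) (auto intro!: M.finsum_closed lsmult_closed uA fM)
  have add: "free_extension M S f (u \<oplus>\<^bsub>?L\<^esub> v) = free_extension M S f u \<oplus>\<^bsub>M\<^esub> free_extension M S f v"
    if u: "u \<in> carrier ?L" and v: "v \<in> carrier ?L" for u v
  proof -
    let ?T = "?s u \<union> ?s v"
    have T: "finite ?T" "?T \<subseteq> S" using fin u v by auto
    have uv: "(u \<oplus>\<^bsub>?L\<^esub> v) w = u w \<oplus> v w" if "w \<in> S" for w
      using that by (simp add: free_left_module_def)
    have "free_extension M S f (u \<oplus>\<^bsub>?L\<^esub> v) = (\<Oplus>\<^bsub>M\<^esub>w \<in> ?T. (u \<oplus>\<^bsub>?L\<^esub> v) w \<odot>\<^bsub>M\<^esub> f w)"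
      using u v T by (intro eq L.a_closed) (auto simp: uv)
    also have "\<dots> = (\<Oplus>\<^bsub>M\<^esub>w \<in> ?T. u w \<odot>\<^bsub>M\<^esub> f w \<oplus>\<^bsub>M\<^esub> v w \<odot>\<^bsub>M\<^esub> f w)"
      using u v by (intro M.finsum_cong') (auto simp: uv uA fM lsmult_closed lsmult_distr_scalar)
    also have "\<dots> = (\<Oplus>\<^bsub>M\<^esub>w \<in> ?T. u w \<odot>\<^bsub>M\<^esub> f w) \<oplus>\<^bsub>M\<^esub> (\<Oplus>\<^bsub>M\<^esub>w \<in> ?T. v w \<odot>\<^bsub>M\<^esub> f w)"
      using u v by (intro M.finsum_addf) (auto simp: uA fM lsmult_closed)
    also have "\<dots> = free_extension M S f u \<oplus>\<^bsub>M\<^esub> free_extension M S f v"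
      using u v T by (simp add: eq[of u ?T] eq[of v ?T])
    finally show ?thesis .
  qed
  have smult: "free_extension M S f (a \<odot>\<^bsub>?L\<^esub> u) = a \<odot>\<^bsub>M\<^esub> free_extension M S f u"
    if a: "a \<in> carrier A" and u: "u \<in> carrier ?L" for a u
  proof -
    have au: "(a \<odot>\<^bsub>?L\<^esub> u) w = a \<otimes> u w" if "w \<in> S" for w
      using that by (simp add: free_left_module_def)
    have "free_extension M S f (a \<odot>\<^bsub>?L\<^esub> u) = (\<Oplus>\<^bsub>M\<^esub>w \<in> ?s u. (a \<odot>\<^bsub>?L\<^esub> u) w \<odot>\<^bsub>M\<^esub> f w)"
      using a u fin[OF u] by (intro eq L.lsmult_closed) (auto simp: au)
    also have "\<dots> = (\<Oplus>\<^bsub>M\<^esub>w \<in> ?s u. a \<odot>\<^bsub>M\<^esub> (u w \<odot>\<^bsub>M\<^esub> f w))"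
      using a u by (intro M.finsum_cong') (auto simp: au uA fM lsmult_closed lsmult_assoc)
    also have "\<dots> = a \<odot>\<^bsub>M\<^esub> (\<Oplus>\<^bsub>M\<^esub>w \<in> ?s u. u w \<odot>\<^bsub>M\<^esub> f w)"
    proof -
      have "(\<Oplus>\<^bsub>M\<^esub>w \<in> T. a \<odot>\<^bsub>M\<^esub> (u w \<odot>\<^bsub>M\<^esub> f w)) = a \<odot>\<^bsub>M\<^esub> (\<Oplus>\<^bsub>M\<^esub>w \<in> T. u w \<odot>\<^bsub>M\<^esub> f w)"
        if "finite T" "T \<subseteq> S" for T
        using that
      proof (induction T)
        case (insert w T)
        have "(\<Oplus>\<^bsub>M\<^esub>w \<in> T. u w \<odot>\<^bsub>M\<^esub> f w) \<in> carrier M"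
          using insert by (auto intro!: M.finsum_closed lsmult_closed uA[OF u] fM)
        with insert a show ?case
          by (subst (1 2) M.finsum_insert) (auto simp: uA[OF u] fM lsmult_closed lsmult_distr_vector subset_iff)
      qed (simp add: a lsmult_zero_right)
      then show ?thesis using fin[OF u] by auto
    qed
    also have "\<dots> = a \<odot>\<^bsub>M\<^esub> free_extension M S f u"
      using u fin[OF u] by (simp add: eq[of u "?s u"])
    finally show ?thesis .
  qed
  show ?thesis
    using closed add smult by (auto simp: left_hom_def hom_def)
qed

lemma free_extension_unit:
  assumes f: "f \<in> S \<rightarrow> carrier M" and w: "w \<in> S"
  shows "(\<lambda>v\<in>S. if v = w then \<one> else \<zero>) \<in> carrier (free_left_module A S)"
    and "free_extension M S f (\<lambda>v\<in>S. if v = w then \<one> else \<zero>) = f w"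
proof -
  show *: "(\<lambda>v\<in>S. if v = w then \<one> else \<zero>) \<in> carrier (free_left_module A S)"
    by (auto simp: restrict_in_free_left_module)
  have "f w \<in> carrier M" using assms by auto
  then show "free_extension M S f (\<lambda>v\<in>S. if v = w then \<one> else \<zero>) = f w"
    using w by (subst free_extension_eq_finsum[OF * f, of "{w}"]) (auto simp: lsmult_one)
qed

end

lemma left_hom_free_extension:
  assumes "left_module A V" "left_module A V'" and p: "p \<in> left_hom A V V'"
    and f: "f \<in> S \<rightarrow> carrier V" and u: "u \<in> carrier (free_left_module A S)"
  shows "p (free_extension V S f u) = free_extension V' S (\<lambda>w. p (f w)) u"
proof -
  interpret V: left_module A V by fact
  interpret V': left_module A V' by fact
  let ?T = "{w \<in> S. u w \<noteq> \<zero>\<^bsub>A\<^esub>}"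
  have fin: "finite ?T" and uA: "w \<in> S \<Longrightarrow> u w \<in> carrier A" for w
    using u by (auto simp: free_left_module_def)
  have p_closed: "x \<in> carrier V \<Longrightarrow> p x \<in> carrier V'"
    and p_add: "x \<in> carrier V \<Longrightarrow> y \<in> carrier V \<Longrightarrow> p (x \<oplus>\<^bsub>V\<^esub> y) = p x \<oplus>\<^bsub>V'\<^esub> p y"
    and p_smult: "a \<in> carrier A \<Longrightarrow> x \<in> carrier V \<Longrightarrow> p (a \<odot>\<^bsub>V\<^esub> x) = a \<odot>\<^bsub>V'\<^esub> p x" for x y a
    using p by (auto simp: left_hom_def hom_def)
  have p_zero: "p \<zero>\<^bsub>V\<^esub> = \<zero>\<^bsub>V'\<^esub>"
    by (metis V.M.zero_closed V.M.r_zero V'.M.add.r_cancel_one' p_add p_closed)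
  have fV: "w \<in> S \<Longrightarrow> f w \<in> carrier V" for w using f by auto
  have sum: "p (\<Oplus>\<^bsub>V\<^esub>w \<in> T. u w \<odot>\<^bsub>V\<^esub> f w) = (\<Oplus>\<^bsub>V'\<^esub>w \<in> T. u w \<odot>\<^bsub>V'\<^esub> p (f w))"
    if "finite T" "T \<subseteq> S" for T
    using that
  proof (induction T)
    case (insert w T)
    have "(\<Oplus>\<^bsub>V\<^esub>w \<in> T. u w \<odot>\<^bsub>V\<^esub> f w) \<in> carrier V"
      using insert by (auto intro!: V.M.finsum_closed V.lsmult_closed uA fV)
    with insert show ?case
      by (subst V.M.finsum_insert V'.M.finsum_insert;
          (subst V.M.finsum_insert V'.M.finsum_insert)?)
        (auto simp: uA fV V.lsmult_closed V'.lsmult_closed p_closed p_add p_smult subset_iff)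
  qed (simp add: p_zero)
  have pf: "(\<lambda>w. p (f w)) \<in> S \<rightarrow> carrier V'" using f p_closed by auto
  show ?thesis
    using V.free_extension_eq_finsum[OF u f fin] V'.free_extension_eq_finsum[OF u pf fin] sum[OF fin]
    by auto
qed

lemma locally_projective_lift:
  assumes lp: "locally_projective A W" and F: "fg_left_submodule A W F"
    and L: "left_module A L" and N: "left_module A N"
    and p: "p \<in> left_hom A L N" and surj: "p ` carrier L = carrier N"
    and g: "g \<in> left_hom A W N"
  shows "\<exists>g' \<in> left_hom A W L. \<forall>x \<in> F. p (g' x) = g x"
proof -
  interpret W: left_module A W using lp by (simp add: locally_projective_def)
  interpret L: left_module A L by fact
  interpret N: left_module A N by fact
  let ?S = "carrier W"
  let ?L = "free_left_module A ?S"
  define W0 :: "('a, 'c) module" where "W0 =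
    \<lparr>carrier = carrier W, monoid.mult = monoid.mult W, one = monoid.one W, ring.zero = \<zero>\<^bsub>W\<^esub>, add = add W, smult = smult W\<rparr>"
  have W0: "carrier W0 = carrier W" "add W0 = add W" "\<zero>\<^bsub>W0\<^esub> = \<zero>\<^bsub>W\<^esub>" "smult W0 = smult W"
    by (simp_all add: W0_def)
  interpret W0: abelian_group W0
    by (rule abelian_groupI)
      (use W.M.add.inv_closed W.M.l_neg in \<open>auto simp: W0 W.M.a_ac a_inv_def\<close>)
  interpret W0: left_module A W0
    by unfold_locales (simp_all add: W0 W.lsmult_closed W.lsmult_distr_scalar W.lsmult_distr_vector
        W.lsmult_assoc W.lsmult_one)
  have id: "(\<lambda>x. x) \<in> ?S \<rightarrow> carrier W0" by (simp add: W0)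
  let ?\<pi> = "free_extension W0 ?S (\<lambda>x. x)"
  have \<pi>: "?\<pi> \<in> left_hom A ?L W0" by (rule W0.free_extension_hom[OF id])
  have \<pi>_surj: "?\<pi> ` carrier ?L = carrier W0"
  proof
    show "?\<pi> ` carrier ?L \<subseteq> carrier W0" using \<pi> by (auto simp: left_hom_def hom_def)
    show "carrier W0 \<subseteq> ?\<pi> ` carrier ?L"
    proof
      fix w assume "w \<in> carrier W0"
      then have "w \<in> ?S" by (simp add: W0)
      from W0.free_extension_unit[OF id this] show "w \<in> ?\<pi> ` carrier ?L"
        by (intro image_eqI[of _ _ "\<lambda>v\<in>?S. if v = w then \<one>\<^bsub>A\<^esub> else \<zero>\<^bsub>A\<^esub>"]) auto
    qed
  qed
  have id_hom: "(\<lambda>x. x) \<in> left_hom A W W0" by (auto simp: left_hom_def hom_def W0)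
  have FL: "left_module A ?L" by (rule left_module_free) unfold_locales
  have "\<exists>s \<in> left_hom A W ?L. \<forall>x \<in> F. ?\<pi> (s x) = x"
    using lp[unfolded locally_projective_def, THEN conjunct2, THEN spec, THEN spec, THEN spec,
        THEN bspec, OF \<pi>, THEN bspec, OF id_hom, THEN mp, OF conjI, OF F conjI, OF FL conjI,
        OF W0.left_module_axioms \<pi>_surj] .
  then obtain s where s: "s \<in> left_hom A W ?L" and s_eq: "\<And>x. x \<in> F \<Longrightarrow> ?\<pi> (s x) = x"
    by auto
  have "\<forall>w \<in> ?S. \<exists>y \<in> carrier L. p y = g w"
  proof
    fix w assume "w \<in> ?S"
    then have "g w \<in> p ` carrier L" using g unfolding surj by (simp add: left_hom_def hom_def Pi_iff)
    then show "\<exists>y \<in> carrier L. p y = g w" by (elim imageE) (simp add: bexI)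
  qed
  then have "\<exists>h. \<forall>w \<in> ?S. h w \<in> carrier L \<and> p (h w) = g w"
    unfolding Bex_def by (rule bchoice)
  then obtain h where "\<forall>w \<in> ?S. h w \<in> carrier L \<and> p (h w) = g w" ..
  then have h: "\<And>w. w \<in> ?S \<Longrightarrow> h w \<in> carrier L" "\<And>w. w \<in> ?S \<Longrightarrow> p (h w) = g w"
    by simp_all
  have hL: "h \<in> ?S \<rightarrow> carrier L" using h by auto
  have gN: "g \<in> ?S \<rightarrow> carrier N" using g by (auto simp: left_hom_def hom_def)
  have g0: "g \<in> left_hom A W0 N" using g by (auto simp: left_hom_def hom_def W0)
  have sub: "F \<subseteq> carrier W"
  proof -
    have "left_submodule A W (carrier W)"
      by (auto simp: left_submodule_def W.M.add.subgroup_self W.lsmult_closed)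
    then have "\<Inter>{F'. left_submodule A W F' \<and> S \<subseteq> F'} \<subseteq> carrier W" if "S \<subseteq> carrier W" for S
      using that by (intro Inter_lower) simp
    then show ?thesis using F unfolding fg_left_submodule_def by auto
  qed
  show ?thesis
  proof (intro bexI[of _ "\<lambda>x. free_extension L ?S h (s x)"] ballI)
    show "(\<lambda>x. free_extension L ?S h (s x)) \<in> left_hom A W L"
      using s L.free_extension_hom[OF hL] by (auto simp: left_hom_def hom_def Pi_iff)
  next
    fix x assume x: "x \<in> F"
    then have sx: "s x \<in> carrier ?L" using sub s by (auto simp: left_hom_def hom_def)
    have "p (free_extension L ?S h (s x)) = free_extension N ?S (\<lambda>w. p (h w)) (s x)"
      by (rule left_hom_free_extension[OF L N p hL sx])
    also have "\<dots> = free_extension N ?S g (s x)"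
      unfolding free_extension_def using sx h(2) gN
      by (intro N.M.add.gfinprod_cong)
        (auto simp: simp_implies_def free_left_module_def intro!: N.lsmult_closed)
    also have "\<dots> = g (?\<pi> (s x))"
      using left_hom_free_extension[OF W0.left_module_axioms N g0 id sx] by simp
    also have "\<dots> = g x" using s_eq[OF x] by simp
    finally show "p (free_extension L ?S h (s x)) = g x" .
  qed
qed

end

(*
  A functional phi : C -> A sends x in M to (id (x) phi)(rho x).  Local projectivity of C says that on
  finite sets the identity of C is a finite sum of maps phi(_)e.  Hence tensoring with C preserves
  injections, and the subcomodules of M are exactly the A-submodules stable under all functionals.

  Commutativity and E-primeness make E a domain.  Every non-zero f in E is onto: otherwise the
  self-cogenerator property yields g \<noteq> 0 in E killing the image of f, so g f = 0.  Now fix x \<noteq> 0 and a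
  subcomodule H maximal among those avoiding x.  Some f in E kills H but not x.  For a non-zero
  subcomodule L the preimage of L under f properly contains H because f is onto, so it contains x.
  Thus f x lies in every non-zero subcomodule, and their intersection is the required simple one.
*)

theory Submission
  imports Defs
begin

section \<open>Homomorphisms out of tensor products\<close>

text \<open>The coaction of a subcomodule H must be coassociative in H \<otimes> (C \<otimes> C),
  while coassociativity is given in M \<otimes> (C \<otimes> C). So injections have to survive
  tensoring with C \<otimes> C as well as with C. This is why the finite rank property is formulated
  for arbitrary left modules and shown to pass from two modules to their tensor product. Stability
  under functionals is a condition on elements: intersections, unions of chains, images and
  preimages inherit it at once, whereas coactions would have to be glued from elements of different
  tensor groups. A coaction is rebuilt from stability where a definition asks for one. Endomorphisms
  of M that kill H arise from maps M/H \<rightarrow> M by composition with the projection, so the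
  fact required about M/H is that the projection is colinear.\<close>

definition balanced_map ::
  "('a, 'x) ring_scheme \<Rightarrow> ('a, 'm, 'y) bimodule_scheme \<Rightarrow> ('a, 'n, 'z) module_scheme \<Rightarrow>
   ('g, 'u) monoid_scheme \<Rightarrow> ('m \<Rightarrow> 'n \<Rightarrow> 'g) \<Rightarrow> bool"
  where "balanced_map A M N G b \<longleftrightarrow>
    (\<forall>x \<in> carrier M. \<forall>y \<in> carrier N. b x y \<in> carrier G) \<and>
    (\<forall>x \<in> carrier M. \<forall>x' \<in> carrier M. \<forall>y \<in> carrier N. b (x \<oplus>\<^bsub>M\<^esub> x') y = b x y \<otimes>\<^bsub>G\<^esub> b x' y) \<and>
    (\<forall>x \<in> carrier M. \<forall>y \<in> carrier N. \<forall>y' \<in> carrier N. b x (y \<oplus>\<^bsub>N\<^esub> y') = b x y \<otimes>\<^bsub>G\<^esub> b x y') \<and>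
    (\<forall>x \<in> carrier M. \<forall>a \<in> carrier A. \<forall>y \<in> carrier N. b (x \<odot>r\<^bsub>M\<^esub> a) y = b x (a \<odot>\<^bsub>N\<^esub> y))"

lemma tensor_relators_subset:
  assumes "right_module A M" "left_module A N"
  shows "tensor_relators A M N \<subseteq> carrier (free_Abelian_group (carrier M \<times> carrier N))"
proof -
  interpret M: right_module A M by fact
  interpret N: left_module A N by fact
  show ?thesis
    unfolding tensor_relators_def
    by (auto simp: M.rsmult_closed N.lsmult_closed dest!: subsetD[OF keys_diff])
qed

lemma tensor_kernel_normal:
  assumes "right_module A M" "left_module A N"
  shows "normal (tensor_kernel A M N) (free_Abelian_group (carrier M \<times> carrier N))"
proof -
  let ?F = "free_Abelian_group (carrier M \<times> carrier N)"
  interpret F: comm_group ?F by (rule abelian_free_Abelian_group)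
  show ?thesis
    unfolding tensor_kernel_def
    by (rule F.subgroup_imp_normal[OF F.generate_is_subgroup[OF tensor_relators_subset[OF assms]]])
qed

lemma tensor_group_comm_group:
  assumes "right_module A M" "left_module A N"
  shows "comm_group (tensor_group A M N)"
proof -
  let ?F = "free_Abelian_group (carrier M \<times> carrier N)"
  interpret F: comm_group ?F by (rule abelian_free_Abelian_group)
  interpret K: normal "tensor_kernel A M N" ?F by (rule tensor_kernel_normal[OF assms])
  show ?thesis
    unfolding tensor_group_def
    by (rule F.abelian_FactGroup) unfold_locales
qed

lemma coset_hom_tensor:
  assumes "right_module A M" "left_module A N"
  shows "(\<lambda>u. tensor_kernel A M N #>\<^bsub>free_Abelian_group (carrier M \<times> carrier N)\<^esub> u)
    \<in> hom (free_Abelian_group (carrier M \<times> carrier N)) (tensor_group A M N)"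
proof -
  interpret K: normal "tensor_kernel A M N" "free_Abelian_group (carrier M \<times> carrier N)"
    by (rule tensor_kernel_normal[OF assms])
  show ?thesis unfolding tensor_group_def by (rule K.r_coset_hom_Mod)
qed

text \<open>Every element is the class of a formal sum, and induction on the free Abelian group
  builds formal sums from generators by differences. The case \<open>diff\<close> keeps this shape,
  so inverses need no case of their own.\<close>

lemma tensor_induct [consumes 3, case_names one pure diff]:
  assumes "right_module A M" "left_module A N" and t: "t \<in> carrier (tensor_group A M N)"
    and one: "P \<one>\<^bsub>tensor_group A M N\<^esub>"
    and pure: "\<And>x y. \<lbrakk>x \<in> carrier M; y \<in> carrier N\<rbrakk> \<Longrightarrow> P (pure_tensor A M N x y)"
    and diff: "\<And>s t. \<lbrakk>s \<in> carrier (tensor_group A M N); t \<in> carrier (tensor_group A M N); P s; P t\<rbrakk>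
      \<Longrightarrow> P (s \<otimes>\<^bsub>tensor_group A M N\<^esub> inv\<^bsub>tensor_group A M N\<^esub> t)"
  shows "P t"
proof -
  let ?S = "carrier M \<times> carrier N"
  let ?F = "free_Abelian_group ?S"
  let ?T = "tensor_group A M N"
  let ?c = "\<lambda>u. tensor_kernel A M N #>\<^bsub>?F\<^esub> u"
  interpret F: comm_group ?F by (rule abelian_free_Abelian_group)
  interpret T: comm_group ?T by (rule tensor_group_comm_group) fact+
  interpret c: group_hom ?F ?T ?c
    using coset_hom_tensor[OF assms(1,2)] by unfold_locales
  have "P (?c u)" if "Poly_Mapping.keys u \<subseteq> ?S" for u
  proof (rule free_Abelian_group_induct[OF that])
    show "P (?c 0)" using one c.hom_one by simp
  next
    fix u v assume uv: "Poly_Mapping.keys u \<subseteq> ?S" "Poly_Mapping.keys v \<subseteq> ?S" "P (?c u)" "P (?c v)"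
    have "?c (u - v) = ?c u \<otimes>\<^bsub>?T\<^esub> inv\<^bsub>?T\<^esub> ?c v"
      using c.hom_mult[of u "- v"] c.hom_inv[of v] uv by simp
    then show "P (?c (u - v))" using diff[of "?c u" "?c v"] c.hom_closed uv by simp
  next
    fix p assume "p \<in> ?S"
    then show "P (?c (frag_of p))" using pure[of "fst p" "snd p"] by (auto simp: pure_tensor_def)
  qed
  then show ?thesis
    using t by (auto simp: tensor_group_def carrier_FactGroup)
qed

text \<open>The equation is stated at a single \<open>t\<close> because homomorphisms are
  unconstrained outside the carrier. Most identities between maps on tensor products are reduced to
  pure tensors by this rule.\<close>

lemma tensor_hom_eqI:
  assumes "right_module A M" "left_module A N" "group G"
    and h: "h \<in> hom (tensor_group A M N) G" and k: "k \<in> hom (tensor_group A M N) G"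
    and eq: "\<And>x y. \<lbrakk>x \<in> carrier M; y \<in> carrier N\<rbrakk> \<Longrightarrow>
      h (pure_tensor A M N x y) = k (pure_tensor A M N x y)"
    and t: "t \<in> carrier (tensor_group A M N)"
  shows "h t = k t"
proof -
  interpret T: comm_group "tensor_group A M N" by (rule tensor_group_comm_group) fact+
  interpret G: group G by fact
  interpret h: group_hom "tensor_group A M N" G h using h by unfold_locales
  interpret k: group_hom "tensor_group A M N" G k using k by unfold_locales
  show ?thesis
    using assms(1,2) t by (induction rule: tensor_induct) (simp_all add: eq)
qed

text \<open>The relators generate the subgroup that is factored out, so their cosets are trivial.
  \<open>three\<close> turns this into the two additivity laws and \<open>two\<close> into the
  balancing law.\<close>

lemma balanced_pure_tensor:
  assumes "right_module A M" "left_module A N"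
  shows "balanced_map A M N (tensor_group A M N) (pure_tensor A M N)"
proof -
  interpret M: right_module A M by fact
  interpret N: left_module A N by fact
  let ?S = "carrier M \<times> carrier N"
  let ?F = "free_Abelian_group ?S"
  let ?T = "tensor_group A M N"
  let ?K = "tensor_kernel A M N"
  let ?c = "\<lambda>u. ?K #>\<^bsub>?F\<^esub> u"
  interpret F: comm_group ?F by (rule abelian_free_Abelian_group)
  interpret T: comm_group ?T by (rule tensor_group_comm_group) fact+
  interpret K: normal ?K ?F by (rule tensor_kernel_normal[OF assms])
  interpret c: group_hom ?F ?T ?c
    using coset_hom_tensor[OF assms] by unfold_locales
  have c_diff: "?c (u - v) = ?c u \<otimes>\<^bsub>?T\<^esub> inv\<^bsub>?T\<^esub> ?c v" if "u \<in> carrier ?F" "v \<in> carrier ?F" for u v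
    using c.hom_mult[of u "- v"] c.hom_inv[of v] that by simp
  have diff_closed: "u - v \<in> carrier ?F" if "u \<in> carrier ?F" "v \<in> carrier ?F" for u v
    using that by (auto dest!: subsetD[OF keys_diff])
  have rel: "?c r = \<one>\<^bsub>?T\<^esub>" if "r \<in> tensor_relators A M N" for r
  proof -
    have "r \<in> ?K" unfolding tensor_kernel_def using that by (rule generate.incl)
    then have "?c r = ?K" by (rule K.rcos_const[OF F.is_group])
    then show ?thesis by (simp add: tensor_group_def)
  qed
  have gen: "frag_of p \<in> carrier ?F" if "p \<in> ?S" for p using that by simp
  have pt: "pure_tensor A M N x y = ?c (frag_of (x, y))" for x y by (simp add: pure_tensor_def)
  have closed: "?c (frag_of p) \<in> carrier ?T" if "p \<in> ?S" for p
    using c.hom_closed[OF gen[OF that]] .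
  have three: "?c (frag_of p) = ?c (frag_of q) \<otimes>\<^bsub>?T\<^esub> ?c (frag_of s)"
    if "frag_of p - frag_of q - frag_of s \<in> tensor_relators A M N" "p \<in> ?S" "q \<in> ?S" "s \<in> ?S" for p q s
  proof -
    have "?c (frag_of p) \<otimes>\<^bsub>?T\<^esub> inv\<^bsub>?T\<^esub> ?c (frag_of q) \<otimes>\<^bsub>?T\<^esub> inv\<^bsub>?T\<^esub> ?c (frag_of s) = \<one>\<^bsub>?T\<^esub>"
      using rel[OF that(1)] that(2-4)
      by (simp only: c_diff[OF diff_closed[OF gen gen] gen] c_diff[OF gen gen])
    then have "?c (frag_of p) = \<one>\<^bsub>?T\<^esub> \<otimes>\<^bsub>?T\<^esub> ?c (frag_of s) \<otimes>\<^bsub>?T\<^esub> ?c (frag_of q)"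
      using closed[OF that(2)] closed[OF that(3)] closed[OF that(4)] T.inv_solve_right' T.inv_closed T.m_closed T.one_closed
      by simp
    then show ?thesis using closed[OF that(3)] closed[OF that(4)] by (simp add: T.m_comm)
  qed
  have two: "?c (frag_of p) = ?c (frag_of q)"
    if "frag_of p - frag_of q \<in> tensor_relators A M N" "p \<in> ?S" "q \<in> ?S" for p q
  proof -
    have "?c (frag_of p) \<otimes>\<^bsub>?T\<^esub> inv\<^bsub>?T\<^esub> ?c (frag_of q) = \<one>\<^bsub>?T\<^esub>"
      using rel[OF that(1)] that(2,3) by (simp only: c_diff[OF gen gen])
    then show ?thesis using closed that(2,3) by (metis T.inv_closed T.inv_equality T.inv_inv)
  qed
  show ?thesis
    unfolding balanced_map_def pt
  proof (intro conjI ballI)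
    fix x x' y assume *: "x \<in> carrier M" "x' \<in> carrier M" "y \<in> carrier N"
    show "?c (frag_of (x \<oplus>\<^bsub>M\<^esub> x', y)) = ?c (frag_of (x, y)) \<otimes>\<^bsub>?T\<^esub> ?c (frag_of (x', y))"
      by (rule three) (use * in \<open>auto simp: tensor_relators_def\<close>)
  next
    fix x y y' assume *: "x \<in> carrier M" "y \<in> carrier N" "y' \<in> carrier N"
    show "?c (frag_of (x, y \<oplus>\<^bsub>N\<^esub> y')) = ?c (frag_of (x, y)) \<otimes>\<^bsub>?T\<^esub> ?c (frag_of (x, y'))"
      by (rule three) (use * in \<open>auto simp: tensor_relators_def\<close>)
  next
    fix x a y assume *: "x \<in> carrier M" "a \<in> carrier A" "y \<in> carrier N"
    show "?c (frag_of (x \<odot>r\<^bsub>M\<^esub> a, y)) = ?c (frag_of (x, a \<odot>\<^bsub>N\<^esub> y))"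
      by (rule two) (use * M.rsmult_closed N.lsmult_closed in \<open>auto simp: tensor_relators_def\<close>)
  qed (use closed in auto)
qed

lemma
  assumes "right_module A M" "left_module A N"
  shows pure_tensor_closed: "\<lbrakk>x \<in> carrier M; y \<in> carrier N\<rbrakk> \<Longrightarrow>
      pure_tensor A M N x y \<in> carrier (tensor_group A M N)"
    and pure_tensor_add_left: "\<lbrakk>x \<in> carrier M; x' \<in> carrier M; y \<in> carrier N\<rbrakk> \<Longrightarrow>
      pure_tensor A M N (x \<oplus>\<^bsub>M\<^esub> x') y = pure_tensor A M N x y \<otimes>\<^bsub>tensor_group A M N\<^esub> pure_tensor A M N x' y"
    and pure_tensor_add_right: "\<lbrakk>x \<in> carrier M; y \<in> carrier N; y' \<in> carrier N\<rbrakk> \<Longrightarrow>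
      pure_tensor A M N x (y \<oplus>\<^bsub>N\<^esub> y') = pure_tensor A M N x y \<otimes>\<^bsub>tensor_group A M N\<^esub> pure_tensor A M N x y'"
    and pure_tensor_balanced: "\<lbrakk>x \<in> carrier M; a \<in> carrier A; y \<in> carrier N\<rbrakk> \<Longrightarrow>
      pure_tensor A M N (x \<odot>r\<^bsub>M\<^esub> a) y = pure_tensor A M N x (a \<odot>\<^bsub>N\<^esub> y)"
  using balanced_pure_tensor[OF assms] by (auto simp: balanced_map_def)

lemma
  assumes "right_module A M" "left_module A N" "comm_group G" and b: "balanced_map A M N G b"
  shows tensor_lift_hom: "tensor_lift A M N G b \<in> hom (tensor_group A M N) G"
    and tensor_lift_pure: "\<lbrakk>x \<in> carrier M; y \<in> carrier N\<rbrakk> \<Longrightarrow>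
      tensor_lift A M N G b (pure_tensor A M N x y) = b x y"
proof -
  have "\<exists>!h. h \<in> hom (tensor_group A M N) G \<and> h \<in> extensional (carrier (tensor_group A M N)) \<and>
           (\<forall>x \<in> carrier M. \<forall>y \<in> carrier N. h (pure_tensor A M N x y) = b x y)"
    by (rule tensor_lift_unique_existence) (use assms in \<open>auto simp: balanced_map_def\<close>)
  from theI'[OF this]
  show "tensor_lift A M N G b \<in> hom (tensor_group A M N) G"
    and "\<lbrakk>x \<in> carrier M; y \<in> carrier N\<rbrakk> \<Longrightarrow>
      tensor_lift A M N G b (pure_tensor A M N x y) = b x y"
    by (auto simp: tensor_lift_def)
qed

lemma
  assumes "f \<in> left_hom A M N"
  shows left_hom_closed: "x \<in> carrier M \<Longrightarrow> f x \<in> carrier N"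
    and left_hom_add: "\<lbrakk>x \<in> carrier M; y \<in> carrier M\<rbrakk> \<Longrightarrow> f (x \<oplus>\<^bsub>M\<^esub> y) = f x \<oplus>\<^bsub>N\<^esub> f y"
    and left_hom_smult: "\<lbrakk>a \<in> carrier A; x \<in> carrier M\<rbrakk> \<Longrightarrow> f (a \<odot>\<^bsub>M\<^esub> x) = a \<odot>\<^bsub>N\<^esub> f x"
  using assms by (auto simp: left_hom_def hom_def)

lemma
  assumes "f \<in> right_hom A M N"
  shows right_hom_closed: "x \<in> carrier M \<Longrightarrow> f x \<in> carrier N"
    and right_hom_add: "\<lbrakk>x \<in> carrier M; y \<in> carrier M\<rbrakk> \<Longrightarrow> f (x \<oplus>\<^bsub>M\<^esub> y) = f x \<oplus>\<^bsub>N\<^esub> f y"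
    and right_hom_smult: "\<lbrakk>a \<in> carrier A; x \<in> carrier M\<rbrakk> \<Longrightarrow> f (x \<odot>r\<^bsub>M\<^esub> a) = f x \<odot>r\<^bsub>N\<^esub> a"
    and right_hom_imp_hom: "f \<in> hom (add_monoid M) (add_monoid N)"
  using assms by (auto simp: right_hom_def hom_def)

lemma left_hom_id: "(\<lambda>x. x) \<in> left_hom A M M" by (auto simp: left_hom_def hom_def)
lemma right_hom_id: "(\<lambda>x. x) \<in> right_hom A M M" by (auto simp: right_hom_def hom_def)

lemma left_hom_comp: "\<lbrakk>f \<in> left_hom A M N; g \<in> left_hom A N P\<rbrakk> \<Longrightarrow> (\<lambda>x. g (f x)) \<in> left_hom A M P"
  by (auto simp: left_hom_def hom_def Pi_iff)

lemma right_hom_comp: "\<lbrakk>f \<in> right_hom A M N; g \<in> right_hom A N P\<rbrakk> \<Longrightarrow> (\<lambda>x. g (f x)) \<in> right_hom A M P"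
  by (auto simp: right_hom_def hom_def Pi_iff)

lemma hom_comp: "\<lbrakk>f \<in> hom G H; g \<in> hom H K\<rbrakk> \<Longrightarrow> (\<lambda>x. g (f x)) \<in> hom G K"
  by (auto simp: hom_def Pi_iff)

lemma right_hom_zero:
  assumes "right_module A M" "right_module A N" "f \<in> right_hom A M N"
  shows "f \<zero>\<^bsub>M\<^esub> = \<zero>\<^bsub>N\<^esub>"
proof -
  interpret M: right_module A M by fact
  interpret N: right_module A N by fact
  interpret f: group_hom "add_monoid M" "add_monoid N" f
    using right_hom_imp_hom[OF assms(3)] by unfold_locales
  show ?thesis using f.hom_one by simp
qed

section \<open>Functoriality of the tensor product\<close>

lemma balanced_tensor_map:
  assumes "right_module A P" "left_module A Q"
    and f: "f \<in> right_hom A M P" and g: "g \<in> left_hom A N Q"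
  shows "balanced_map A M N (tensor_group A P Q) (\<lambda>x y. pure_tensor A P Q (f x) (g y))"
  using assms
  by (auto simp: balanced_map_def right_hom_closed left_hom_closed right_hom_add left_hom_add
      right_hom_smult left_hom_smult pure_tensor_closed pure_tensor_add_left pure_tensor_add_right
      pure_tensor_balanced)

lemma
  assumes "right_module A M" "left_module A N" "right_module A P" "left_module A Q"
    and f: "f \<in> right_hom A M P" and g: "g \<in> left_hom A N Q"
  shows tensor_map_hom: "tensor_map A M N P Q f g \<in> hom (tensor_group A M N) (tensor_group A P Q)"
    and tensor_map_pure: "\<lbrakk>x \<in> carrier M; y \<in> carrier N\<rbrakk> \<Longrightarrow>
      tensor_map A M N P Q f g (pure_tensor A M N x y) = pure_tensor A P Q (f x) (g y)"
    and tensor_map_closed: "t \<in> carrier (tensor_group A M N) \<Longrightarrow>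
      tensor_map A M N P Q f g t \<in> carrier (tensor_group A P Q)"
proof -
  note b = balanced_tensor_map[OF assms(3,4) f g]
  note G = tensor_group_comm_group[OF assms(3,4)]
  show h: "tensor_map A M N P Q f g \<in> hom (tensor_group A M N) (tensor_group A P Q)"
    unfolding tensor_map_def by (rule tensor_lift_hom[OF assms(1,2) G b])
  show "\<lbrakk>x \<in> carrier M; y \<in> carrier N\<rbrakk> \<Longrightarrow>
      tensor_map A M N P Q f g (pure_tensor A M N x y) = pure_tensor A P Q (f x) (g y)"
    unfolding tensor_map_def by (rule tensor_lift_pure[OF assms(1,2) G b])
  show "t \<in> carrier (tensor_group A M N) \<Longrightarrow>
      tensor_map A M N P Q f g t \<in> carrier (tensor_group A P Q)"
    using h by (auto simp: hom_def)
qed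

lemma tensor_map_comp:
  assumes "right_module A M" "left_module A N" "right_module A P" "left_module A Q"
    "right_module A U" "left_module A V"
    and f: "f \<in> right_hom A M P" and g: "g \<in> left_hom A N Q"
    and f': "f' \<in> right_hom A P U" and g': "g' \<in> left_hom A Q V"
    and t: "t \<in> carrier (tensor_group A M N)"
  shows "tensor_map A P Q U V f' g' (tensor_map A M N P Q f g t) =
    tensor_map A M N U V (\<lambda>x. f' (f x)) (\<lambda>y. g' (g y)) t"
proof (rule tensor_hom_eqI[OF assms(1,2) _ _ _ _ t, where G = "tensor_group A U V"])
  show "group (tensor_group A U V)"
    using tensor_group_comm_group[OF assms(5,6)] by (simp add: comm_group_def)
  note F = right_hom_comp[OF f f'] and G = left_hom_comp[OF g g']
  show "(\<lambda>t. tensor_map A P Q U V f' g' (tensor_map A M N P Q f g t)) \<in> hom (tensor_group A M N) (tensor_group A U V)"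
    by (rule hom_comp[OF tensor_map_hom tensor_map_hom]) fact+
  show "tensor_map A M N U V (\<lambda>x. f' (f x)) (\<lambda>y. g' (g y)) \<in> hom (tensor_group A M N) (tensor_group A U V)"
    by (rule tensor_map_hom) fact+
  fix x y assume "x \<in> carrier M" "y \<in> carrier N"
  then show "tensor_map A P Q U V f' g' (tensor_map A M N P Q f g (pure_tensor A M N x y)) =
    tensor_map A M N U V (\<lambda>x. f' (f x)) (\<lambda>y. g' (g y)) (pure_tensor A M N x y)"
    using assms(1-10) F G by (simp add: tensor_map_pure right_hom_closed left_hom_closed)
qed

lemma tensor_map_id:
  assumes "right_module A M" "left_module A N" and t: "t \<in> carrier (tensor_group A M N)"
  shows "tensor_map A M N M N (\<lambda>x. x) (\<lambda>y. y) t = t"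
proof (rule tensor_hom_eqI[OF assms(1,2) _ _ _ _ t, where G = "tensor_group A M N"])
  show "group (tensor_group A M N)"
    using tensor_group_comm_group[OF assms(1,2)] by (simp add: comm_group_def)
qed (use assms in \<open>auto simp: tensor_map_hom tensor_map_pure right_hom_id left_hom_id, auto simp: hom_def\<close>)

text \<open>This is an equality of functions on the whole type: the description behind
  \<open>tensor_lift\<close> mentions the values of \<open>f\<close> and \<open>g\<close> on the two
  carriers only, so both sides are the same description.\<close>

lemma tensor_map_cong:
  assumes "\<And>x. x \<in> carrier M \<Longrightarrow> f x = f' x" "\<And>y. y \<in> carrier N \<Longrightarrow> g y = g' y"
  shows "tensor_map A M N P Q f g = tensor_map A M N P Q f' g'"
  unfolding tensor_map_def tensor_lift_def using assms by (simp cong: ball_cong)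

lemma tensor_sel:
  "carrier (tensor A M N) = carrier (tensor_group A M N)"
  "\<zero>\<^bsub>tensor A M N\<^esub> = \<one>\<^bsub>tensor_group A M N\<^esub>"
  "s \<oplus>\<^bsub>tensor A M N\<^esub> t = s \<otimes>\<^bsub>tensor_group A M N\<^esub> t"
  "a \<odot>\<^bsub>tensor A M N\<^esub> t = tensor_map A M N M N (\<lambda>x. a \<odot>\<^bsub>M\<^esub> x) (\<lambda>y. y) t"
  "t \<odot>r\<^bsub>tensor A M N\<^esub> a = tensor_map A M N M N (\<lambda>x. x) (\<lambda>y. y \<odot>r\<^bsub>N\<^esub> a) t"
  by (simp_all add: tensor_def)

lemma hom_tensor:
  "hom (add_monoid (tensor A M N)) G = hom (tensor_group A M N) G"
  "hom G (add_monoid (tensor A M N)) = hom G (tensor_group A M N)"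
  by (simp_all add: hom_def tensor_def)

lemma abelian_group_tensor:
  assumes "right_module A M" "left_module A N"
  shows "abelian_group (tensor A M N)"
proof -
  interpret T: comm_group "tensor_group A M N" by (rule tensor_group_comm_group) fact+
  show ?thesis
  proof (rule abelian_groupI)
    fix t assume "t \<in> carrier (tensor A M N)"
    then show "\<exists>s\<in>carrier (tensor A M N). s \<oplus>\<^bsub>tensor A M N\<^esub> t = \<zero>\<^bsub>tensor A M N\<^esub>"
      by (intro bexI[of _ "inv\<^bsub>tensor_group A M N\<^esub> t"]) (simp_all add: tensor_sel)
  qed (simp_all add: tensor_sel T.m_ac)
qed

lemma (in bimodule) lsmult_right_hom: "a \<in> carrier A \<Longrightarrow> (\<lambda>x. a \<odot>\<^bsub>M\<^esub> x) \<in> right_hom A M M"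
  by (auto simp: right_hom_def hom_def lsmult_closed lsmult_distr_vector lsmult_rsmult)

lemma (in bimodule) rsmult_left_hom: "a \<in> carrier A \<Longrightarrow> (\<lambda>x. x \<odot>r\<^bsub>M\<^esub> a) \<in> left_hom A M M"
  by (auto simp: left_hom_def hom_def rsmult_closed rsmult_distr_vector lsmult_rsmult)

section \<open>Iterated tensor products\<close>

text \<open>Commutativity of \<open>G\<close> lets the middle factors trade places. With it, the
  right-hand side of a distributive law is a homomorphism in \<open>t\<close>, and the law can be
  tested on pure tensors.\<close>

lemma hom_pointwise_mult:
  assumes "comm_group G" "f \<in> hom T G" "g \<in> hom T G"
  shows "(\<lambda>t. f t \<otimes>\<^bsub>G\<^esub> g t) \<in> hom T G"
proof -
  interpret G: comm_group G by fact
  have "f s \<otimes>\<^bsub>G\<^esub> f t \<otimes>\<^bsub>G\<^esub> (g s \<otimes>\<^bsub>G\<^esub> g t) = f s \<otimes>\<^bsub>G\<^esub> g s \<otimes>\<^bsub>G\<^esub> (f t \<otimes>\<^bsub>G\<^esub> g t)"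
    if "f s \<in> carrier G" "f t \<in> carrier G" "g s \<in> carrier G" "g t \<in> carrier G" for s t
    using that by (simp add: G.m_ac)
  then show ?thesis using assms(2,3) by (auto simp: hom_def Pi_iff)
qed

lemma pure_tensor_hom_left:
  assumes "right_module A M" "left_module A N" "y \<in> carrier N"
  shows "(\<lambda>x. pure_tensor A M N x y) \<in> hom (add_monoid M) (tensor_group A M N)"
  using assms by (auto simp: hom_def pure_tensor_closed pure_tensor_add_left)

lemma pure_tensor_hom_right:
  assumes "right_module A M" "left_module A N" "x \<in> carrier M"
  shows "(\<lambda>y. pure_tensor A M N x y) \<in> hom (add_monoid N) (tensor_group A M N)"
  using assms by (auto simp: hom_def pure_tensor_closed pure_tensor_add_right)

lemma pure_tensor_zero_left:
  assumes "right_module A M" "left_module A N" "y \<in> carrier N"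
  shows "pure_tensor A M N \<zero>\<^bsub>M\<^esub> y = \<one>\<^bsub>tensor_group A M N\<^esub>"
proof -
  interpret M: right_module A M by fact
  interpret T: comm_group "tensor_group A M N" by (rule tensor_group_comm_group) fact+
  interpret group_hom "add_monoid M" "tensor_group A M N" "\<lambda>x. pure_tensor A M N x y"
    using pure_tensor_hom_left[OF assms] by unfold_locales
  show ?thesis using hom_one by simp
qed

lemma pure_tensor_zero_right:
  assumes "right_module A M" "left_module A N" "x \<in> carrier M"
  shows "pure_tensor A M N x \<zero>\<^bsub>N\<^esub> = \<one>\<^bsub>tensor_group A M N\<^esub>"
proof -
  interpret N: left_module A N by fact
  interpret T: comm_group "tensor_group A M N" by (rule tensor_group_comm_group) fact+
  interpret group_hom "add_monoid N" "tensor_group A M N" "\<lambda>y. pure_tensor A M N x y"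
    using pure_tensor_hom_right[OF assms] by unfold_locales
  show ?thesis using hom_one by simp
qed

lemma bimodule_left: "bimodule A M \<Longrightarrow> left_module A M" by (simp add: bimodule_def)
lemma bimodule_right: "bimodule A M \<Longrightarrow> right_module A M" by (simp add: bimodule_def)

lemma right_module_tensor:
  assumes M: "right_module A M" and N: "bimodule A N"
  shows "right_module A (tensor A M N)"
proof -
  interpret M: right_module A M by fact
  interpret N: bimodule A N by fact
  interpret T: comm_group "tensor_group A M N" by (rule tensor_group_comm_group) unfold_locales
  interpret abelian_group "tensor A M N" by (rule abelian_group_tensor) unfold_locales
  note MN = M bimodule_left[OF N]
  note id = right_hom_id[of A M] and r = N.rsmult_left_hom
  note map_hom = tensor_map_hom[OF MN MN id r]
  show ?thesis
  proof unfold_locales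
    fix a t assume "a \<in> carrier A" "t \<in> carrier (tensor A M N)"
    then show "t \<odot>r\<^bsub>tensor A M N\<^esub> a \<in> carrier (tensor A M N)"
      by (simp add: tensor_sel tensor_map_closed[OF MN MN id r])
  next
    fix a b t assume ab: "a \<in> carrier A" "b \<in> carrier A" and t: "t \<in> carrier (tensor A M N)"
    show "t \<odot>r\<^bsub>tensor A M N\<^esub> (a \<oplus>\<^bsub>A\<^esub> b) = t \<odot>r\<^bsub>tensor A M N\<^esub> a \<oplus>\<^bsub>tensor A M N\<^esub> t \<odot>r\<^bsub>tensor A M N\<^esub> b"
      unfolding tensor_sel
    proof (rule tensor_hom_eqI[OF MN T.is_group _ _ _ t[unfolded tensor_sel]])
      show "(\<lambda>t. tensor_map A M N M N (\<lambda>x. x) (\<lambda>y. y \<odot>r\<^bsub>N\<^esub> a) t \<otimes>\<^bsub>tensor_group A M N\<^esub>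
         tensor_map A M N M N (\<lambda>x. x) (\<lambda>y. y \<odot>r\<^bsub>N\<^esub> b) t) \<in> hom (tensor_group A M N) (tensor_group A M N)"
        using ab by (intro hom_pointwise_mult T.comm_group_axioms map_hom)
    qed (use ab in \<open>simp_all add: map_hom tensor_map_pure[OF MN MN id r] N.rsmult_distr_scalar
        N.rsmult_closed pure_tensor_add_right[OF MN]\<close>)
    show "t \<odot>r\<^bsub>tensor A M N\<^esub> (a \<otimes>\<^bsub>A\<^esub> b) = (t \<odot>r\<^bsub>tensor A M N\<^esub> a) \<odot>r\<^bsub>tensor A M N\<^esub> b"
      using ab t unfolding tensor_sel
      by (subst tensor_map_comp[OF MN MN MN id r id r]) (auto simp: N.rsmult_assoc intro!: tensor_map_cong[THEN fun_cong])
  next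
    fix a s t assume "a \<in> carrier A" "s \<in> carrier (tensor A M N)" "t \<in> carrier (tensor A M N)"
    then show "(s \<oplus>\<^bsub>tensor A M N\<^esub> t) \<odot>r\<^bsub>tensor A M N\<^esub> a = s \<odot>r\<^bsub>tensor A M N\<^esub> a \<oplus>\<^bsub>tensor A M N\<^esub> t \<odot>r\<^bsub>tensor A M N\<^esub> a"
      using map_hom by (simp add: tensor_sel hom_def)
  next
    fix t assume t: "t \<in> carrier (tensor A M N)"
    have "tensor_map A M N M N (\<lambda>x. x) (\<lambda>y. y \<odot>r\<^bsub>N\<^esub> \<one>\<^bsub>A\<^esub>) = tensor_map A M N M N (\<lambda>x. x) (\<lambda>y. y)"
      by (rule tensor_map_cong) (simp_all add: N.rsmult_one)
    then show "t \<odot>r\<^bsub>tensor A M N\<^esub> \<one>\<^bsub>A\<^esub> = t"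
      using t tensor_map_id[OF MN] by (simp add: tensor_sel)
  qed
qed

lemma left_module_tensor:
  assumes M: "bimodule A M" and N: "left_module A N"
  shows "left_module A (tensor A M N)"
proof -
  interpret M: bimodule A M by fact
  interpret N: left_module A N by fact
  interpret T: comm_group "tensor_group A M N" by (rule tensor_group_comm_group) unfold_locales
  interpret abelian_group "tensor A M N" by (rule abelian_group_tensor) unfold_locales
  note MN = bimodule_right[OF M] N
  note id = left_hom_id[of A N] and l = M.lsmult_right_hom
  note map_hom = tensor_map_hom[OF MN MN l id]
  show ?thesis
  proof unfold_locales
    fix a t assume "a \<in> carrier A" "t \<in> carrier (tensor A M N)"
    then show "a \<odot>\<^bsub>tensor A M N\<^esub> t \<in> carrier (tensor A M N)"
      by (simp add: tensor_sel tensor_map_closed[OF MN MN l id])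
  next
    fix a b t assume ab: "a \<in> carrier A" "b \<in> carrier A" and t: "t \<in> carrier (tensor A M N)"
    show "(a \<oplus>\<^bsub>A\<^esub> b) \<odot>\<^bsub>tensor A M N\<^esub> t = a \<odot>\<^bsub>tensor A M N\<^esub> t \<oplus>\<^bsub>tensor A M N\<^esub> b \<odot>\<^bsub>tensor A M N\<^esub> t"
      unfolding tensor_sel
    proof (rule tensor_hom_eqI[OF MN T.is_group _ _ _ t[unfolded tensor_sel]])
      show "(\<lambda>t. tensor_map A M N M N (\<lambda>x. a \<odot>\<^bsub>M\<^esub> x) (\<lambda>y. y) t \<otimes>\<^bsub>tensor_group A M N\<^esub>
         tensor_map A M N M N (\<lambda>x. b \<odot>\<^bsub>M\<^esub> x) (\<lambda>y. y) t) \<in> hom (tensor_group A M N) (tensor_group A M N)"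
        using ab by (intro hom_pointwise_mult T.comm_group_axioms map_hom)
    qed (use ab in \<open>simp_all add: map_hom tensor_map_pure[OF MN MN l id] M.lsmult_distr_scalar
        M.lsmult_closed pure_tensor_add_left[OF MN]\<close>)
    show "(a \<otimes>\<^bsub>A\<^esub> b) \<odot>\<^bsub>tensor A M N\<^esub> t = a \<odot>\<^bsub>tensor A M N\<^esub> (b \<odot>\<^bsub>tensor A M N\<^esub> t)"
      using ab t unfolding tensor_sel
      by (subst tensor_map_comp[OF MN MN MN l id l id]) (auto simp: M.lsmult_assoc intro!: tensor_map_cong[THEN fun_cong])
  next
    fix a s t assume "a \<in> carrier A" "s \<in> carrier (tensor A M N)" "t \<in> carrier (tensor A M N)"
    then show "a \<odot>\<^bsub>tensor A M N\<^esub> (s \<oplus>\<^bsub>tensor A M N\<^esub> t) = a \<odot>\<^bsub>tensor A M N\<^esub> s \<oplus>\<^bsub>tensor A M N\<^esub> a \<odot>\<^bsub>tensor A M N\<^esub> t"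
      using map_hom by (simp add: tensor_sel hom_def)
  next
    fix t assume t: "t \<in> carrier (tensor A M N)"
    have "tensor_map A M N M N (\<lambda>x. \<one>\<^bsub>A\<^esub> \<odot>\<^bsub>M\<^esub> x) (\<lambda>y. y) = tensor_map A M N M N (\<lambda>x. x) (\<lambda>y. y)"
      by (rule tensor_map_cong) (simp_all add: M.lsmult_one)
    then show "\<one>\<^bsub>A\<^esub> \<odot>\<^bsub>tensor A M N\<^esub> t = t"
      using t tensor_map_id[OF MN] by (simp add: tensor_sel)
  qed
qed

lemma smult_pure_tensor:
  assumes "bimodule A M" "left_module A N" "a \<in> carrier A" "x \<in> carrier M" "y \<in> carrier N"
  shows "a \<odot>\<^bsub>tensor A M N\<^esub> pure_tensor A M N x y = pure_tensor A M N (a \<odot>\<^bsub>M\<^esub> x) y"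
  using assms
  by (simp add: tensor_sel tensor_map_pure bimodule_right bimodule.lsmult_right_hom left_hom_id)

lemma tensor_map_right_hom:
  assumes "right_module A M" "bimodule A N" "right_module A P" "bimodule A Q"
    and f: "f \<in> right_hom A M P" and g: "g \<in> left_hom A N Q" "g \<in> right_hom A N Q"
  shows "tensor_map A M N P Q f g \<in> right_hom A (tensor A M N) (tensor A P Q)"
proof -
  note MN = assms(1) bimodule_left[OF assms(2)] and PQ = assms(3) bimodule_left[OF assms(4)]
  have "tensor_map A M N P Q f g (t \<odot>r\<^bsub>tensor A M N\<^esub> a) = tensor_map A M N P Q f g t \<odot>r\<^bsub>tensor A P Q\<^esub> a"
    if a: "a \<in> carrier A" and t: "t \<in> carrier (tensor_group A M N)" for a t
  proof -
    note rN = bimodule.rsmult_left_hom[OF assms(2) a] and rQ = bimodule.rsmult_left_hom[OF assms(4) a]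
    have "tensor_map A M N P Q f (\<lambda>y. g (y \<odot>r\<^bsub>N\<^esub> a)) = tensor_map A M N P Q f (\<lambda>y. g y \<odot>r\<^bsub>Q\<^esub> a)"
      by (rule tensor_map_cong) (simp_all add: right_hom_smult[OF g(2) a])
    then show ?thesis
      unfolding tensor_sel
      by (simp add: tensor_map_comp[OF MN MN PQ right_hom_id rN f g(1) t]
          tensor_map_comp[OF MN PQ PQ f g(1) right_hom_id rQ t])
  qed
  then show ?thesis
    using tensor_map_hom[OF MN PQ f g(1)] by (simp add: right_hom_def hom_def tensor_sel(1,3))
qed

text \<open>Balancing holds because \<open>N \<otimes> P\<close> takes its left action from
  \<open>N\<close>: moving \<open>a\<close> across the outer tensor sign lets it act on
  \<open>y\<close>.\<close>

lemma balanced_tensor_assoc_inner: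
  assumes M: "right_module A M" and N: "bimodule A N" and P: "left_module A P" and z: "z \<in> carrier P"
  shows "balanced_map A M N (tensor_group A M (tensor A N P))
    (\<lambda>x y. pure_tensor A M (tensor A N P) x (pure_tensor A N P y z))"
proof -
  note NP = bimodule_right[OF N] P and T = M left_module_tensor[OF N P]
  have "pure_tensor A N P y z \<in> carrier (tensor A N P)" if "y \<in> carrier N" for y
    using pure_tensor_closed[OF NP that z] by (simp add: tensor_sel)
  moreover have "pure_tensor A N P (y \<oplus>\<^bsub>N\<^esub> y') z = pure_tensor A N P y z \<oplus>\<^bsub>tensor A N P\<^esub> pure_tensor A N P y' z"
    if "y \<in> carrier N" "y' \<in> carrier N" for y y'
    using pure_tensor_add_left[OF NP that z] by (simp add: tensor_sel)
  ultimately show ?thesis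
    using z by (auto simp: balanced_map_def pure_tensor_closed[OF T] pure_tensor_add_left[OF T]
        pure_tensor_add_right[OF T] pure_tensor_balanced[OF T] smult_pure_tensor[OF N P])
qed

text \<open>Two universal properties are nested. For fixed \<open>z\<close> the first two factors
  are handled by the inner lift \<open>?l\<close>; the conditions on \<open>?l\<close> that involve
  \<open>z\<close> are then identities of homomorphisms in \<open>t\<close>, hence reduce to pure
  \<open>t\<close>.\<close>

lemma
  assumes M: "right_module A M" and N: "bimodule A N" and P: "left_module A P"
  shows tensor_assoc_hom: "tensor_assoc A M N P \<in>
      hom (tensor_group A (tensor A M N) P) (tensor_group A M (tensor A N P))"
    and tensor_assoc_pure: "\<lbrakk>x \<in> carrier M; y \<in> carrier N; z \<in> carrier P\<rbrakk> \<Longrightarrow>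
      tensor_assoc A M N P (pure_tensor A (tensor A M N) P (pure_tensor A M N x y) z) =
      pure_tensor A M (tensor A N P) x (pure_tensor A N P y z)"
proof -
  let ?G = "tensor_group A M (tensor A N P)"
  let ?p = "\<lambda>z x y. pure_tensor A M (tensor A N P) x (pure_tensor A N P y z)"
  let ?l = "\<lambda>t z. tensor_lift A M N ?G (?p z) t"
  interpret N: bimodule A N by fact
  interpret P: left_module A P by fact
  note MN = M bimodule_left[OF N] and NP = bimodule_right[OF N] P and T = M left_module_tensor[OF N P]
  note TP = right_module_tensor[OF M N] P
  interpret G: comm_group ?G by (rule tensor_group_comm_group[OF T])
  note inner = balanced_tensor_assoc_inner[OF M N P]
  note l_hom = tensor_lift_hom[OF MN G.comm_group_axioms inner]
  note l_pure = tensor_lift_pure[OF MN G.comm_group_axioms inner]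
  have pT: "pure_tensor A N P y z \<in> carrier (tensor A N P)" if "y \<in> carrier N" "z \<in> carrier P" for y z
    using pure_tensor_closed[OF NP that] by (simp add: tensor_sel)
  have outer: "balanced_map A (tensor A M N) P ?G ?l"
    unfolding balanced_map_def
  proof (intro conjI ballI)
    fix t z assume "t \<in> carrier (tensor A M N)" "z \<in> carrier P"
    then show "?l t z \<in> carrier ?G" using l_hom by (auto simp: hom_def tensor_sel)
  next
    fix s t z assume "s \<in> carrier (tensor A M N)" "t \<in> carrier (tensor A M N)" "z \<in> carrier P"
    then show "?l (s \<oplus>\<^bsub>tensor A M N\<^esub> t) z = ?l s z \<otimes>\<^bsub>?G\<^esub> ?l t z"
      using l_hom by (auto simp: hom_def tensor_sel)
  next
    fix t z z' assume t: "t \<in> carrier (tensor A M N)" and z: "z \<in> carrier P" "z' \<in> carrier P"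
    show "?l t (z \<oplus>\<^bsub>P\<^esub> z') = ?l t z \<otimes>\<^bsub>?G\<^esub> ?l t z'"
    proof (rule tensor_hom_eqI[OF MN G.is_group _ _ _ t[unfolded tensor_sel]])
      show "(\<lambda>t. ?l t z \<otimes>\<^bsub>?G\<^esub> ?l t z') \<in> hom (tensor_group A M N) ?G"
        using z by (intro hom_pointwise_mult G.comm_group_axioms l_hom)
      fix x y assume xy: "x \<in> carrier M" "y \<in> carrier N"
      have "pure_tensor A N P y (z \<oplus>\<^bsub>P\<^esub> z') = pure_tensor A N P y z \<oplus>\<^bsub>tensor A N P\<^esub> pure_tensor A N P y z'"
        using pure_tensor_add_right[OF NP xy(2) z] by (simp add: tensor_sel)
      then show "?l (pure_tensor A M N x y) (z \<oplus>\<^bsub>P\<^esub> z') = ?l (pure_tensor A M N x y) z \<otimes>\<^bsub>?G\<^esub> ?l (pure_tensor A M N x y) z'"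
        using xy z by (simp add: l_pure pT pure_tensor_add_right[OF T])
    qed (use z in \<open>simp add: l_hom\<close>)
  next
    fix t a z assume t: "t \<in> carrier (tensor A M N)" and a: "a \<in> carrier A" and z: "z \<in> carrier P"
    note r = N.rsmult_left_hom[OF a]
    show "?l (t \<odot>r\<^bsub>tensor A M N\<^esub> a) z = ?l t (a \<odot>\<^bsub>P\<^esub> z)"
      unfolding tensor_sel
    proof (rule tensor_hom_eqI[OF MN G.is_group _ _ _ t[unfolded tensor_sel]])
      show "(\<lambda>t. ?l (tensor_map A M N M N (\<lambda>x. x) (\<lambda>y. y \<odot>r\<^bsub>N\<^esub> a) t) z) \<in> hom (tensor_group A M N) ?G"
        by (rule hom_comp[OF tensor_map_hom[OF MN MN right_hom_id r] l_hom[OF z]])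
    qed (use a z in \<open>simp_all add: l_hom l_pure tensor_map_pure[OF MN MN right_hom_id r] N.rsmult_closed
        P.lsmult_closed pure_tensor_balanced[OF NP]\<close>)
  qed
  show "tensor_assoc A M N P \<in> hom (tensor_group A (tensor A M N) P) ?G"
    unfolding tensor_assoc_def by (rule tensor_lift_hom[OF TP G.comm_group_axioms outer])
  assume *: "x \<in> carrier M" "y \<in> carrier N" "z \<in> carrier P"
  then show "tensor_assoc A M N P (pure_tensor A (tensor A M N) P (pure_tensor A M N x y) z) = ?p z x y"
    unfolding tensor_assoc_def
    by (subst tensor_lift_pure[OF TP G.comm_group_axioms outer])
      (simp_all add: tensor_sel l_pure pure_tensor_closed[OF MN])
qed

text \<open>For fixed \<open>z\<close> the map s \<mapsto> s \<otimes> z is a homomorphism, so the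
  first argument of a pure tensor may itself be taken pure.\<close>

lemma tensor_hom_eqI3:
  assumes M: "right_module A M" and N: "bimodule A N" and P: "left_module A P" and G: "group G"
    and h: "h \<in> hom (tensor_group A (tensor A M N) P) G"
    and k: "k \<in> hom (tensor_group A (tensor A M N) P) G"
    and eq: "\<And>x y z. \<lbrakk>x \<in> carrier M; y \<in> carrier N; z \<in> carrier P\<rbrakk> \<Longrightarrow>
      h (pure_tensor A (tensor A M N) P (pure_tensor A M N x y) z) =
      k (pure_tensor A (tensor A M N) P (pure_tensor A M N x y) z)"
    and t: "t \<in> carrier (tensor_group A (tensor A M N) P)"
  shows "h t = k t"
proof (rule tensor_hom_eqI[OF right_module_tensor[OF M N] P G h k _ t])
  fix s z assume s: "s \<in> carrier (tensor A M N)" and z: "z \<in> carrier P"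
  have p: "(\<lambda>s. pure_tensor A (tensor A M N) P s z) \<in> hom (tensor_group A M N) (tensor_group A (tensor A M N) P)"
    using pure_tensor_hom_left[OF right_module_tensor[OF M N] P z] by (simp add: hom_tensor)
  show "h (pure_tensor A (tensor A M N) P s z) = k (pure_tensor A (tensor A M N) P s z)"
    by (rule tensor_hom_eqI[OF M bimodule_left[OF N] G hom_comp[OF p h] hom_comp[OF p k] _ s[unfolded tensor_sel]])
      (use s z in \<open>simp_all add: eq tensor_sel\<close>)
qed

text \<open>Naturality in the first factor is what carries coassociativity along a map of
  comodules.\<close>

lemma tensor_assoc_natural:
  assumes M: "right_module A M" and N: "bimodule A N" and P: "left_module A P"
    and M': "right_module A M'" and f: "f \<in> right_hom A M M'"
    and t: "t \<in> carrier (tensor_group A (tensor A M N) P)"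
  shows "tensor_assoc A M' N P
      (tensor_map A (tensor A M N) P (tensor A M' N) P (tensor_map A M N M' N f (\<lambda>y. y)) (\<lambda>z. z) t) =
    tensor_map A M (tensor A N P) M' (tensor A N P) f (\<lambda>s. s) (tensor_assoc A M N P t)"
proof -
  note MN = M bimodule_left[OF N] and M'N = M' bimodule_left[OF N] and NP = bimodule_right[OF N] P
  note TP = right_module_tensor[OF M N] P and T'P = right_module_tensor[OF M' N] P
  note MT = M left_module_tensor[OF N P] and M'T = M' left_module_tensor[OF N P]
  note fN = tensor_map_right_hom[OF M N M' N f left_hom_id right_hom_id]
  interpret G: comm_group "tensor_group A M' (tensor A N P)" by (rule tensor_group_comm_group[OF M'T])
  show ?thesis
  proof (rule tensor_hom_eqI3[OF M N P G.is_group _ _ _ t])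
    show "(\<lambda>t. tensor_assoc A M' N P
      (tensor_map A (tensor A M N) P (tensor A M' N) P (tensor_map A M N M' N f (\<lambda>y. y)) (\<lambda>z. z) t)) \<in>
      hom (tensor_group A (tensor A M N) P) (tensor_group A M' (tensor A N P))"
      by (rule hom_comp[OF tensor_map_hom[OF TP T'P fN left_hom_id] tensor_assoc_hom[OF M' N P]])
    show "(\<lambda>t. tensor_map A M (tensor A N P) M' (tensor A N P) f (\<lambda>s. s) (tensor_assoc A M N P t)) \<in>
      hom (tensor_group A (tensor A M N) P) (tensor_group A M' (tensor A N P))"
      by (rule hom_comp[OF tensor_assoc_hom[OF M N P] tensor_map_hom[OF MT M'T f left_hom_id]])
  qed (simp_all add: tensor_map_pure[OF TP T'P fN left_hom_id] tensor_map_pure[OF MN M'N f left_hom_id]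
      tensor_map_pure[OF MT M'T f left_hom_id] tensor_assoc_pure[OF M N P] tensor_assoc_pure[OF M' N P]
      tensor_sel(1) pure_tensor_closed[OF MN] pure_tensor_closed[OF NP] right_hom_closed[OF f])
qed

section \<open>Finite rank endomorphisms and local projectivity\<close>

lemma regular_bimodule_sel [simp]:
  "carrier (regular_bimodule A) = carrier A"
  "add (regular_bimodule A) = add A"
  "\<zero>\<^bsub>regular_bimodule A\<^esub> = \<zero>\<^bsub>A\<^esub>"
  "a \<odot>\<^bsub>regular_bimodule A\<^esub> b = a \<otimes>\<^bsub>A\<^esub> b"
  "a \<odot>r\<^bsub>regular_bimodule A\<^esub> b = a \<otimes>\<^bsub>A\<^esub> b"
  by (simp_all add: regular_bimodule_def)

lemma bimodule_regular:
  assumes "ring A" shows "bimodule A (regular_bimodule A)"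
proof -
  interpret A: ring A by fact
  interpret abelian_group "regular_bimodule A"
    by (rule abelian_groupI) (auto simp: A.a_ac intro: A.l_neg)
  show ?thesis
    by unfold_locales (simp_all add: A.l_distr A.r_distr A.m_assoc)
qed

section \<open>Contraction of tensors with functionals\<close>

text \<open>This is id \<otimes> \<phi> : M \<otimes> W \<rightarrow> M \<otimes> A followed by the
  isomorphism M \<otimes> A \<rightarrow> M.\<close>

definition tensor_eval ::
  "('a, 'x) ring_scheme \<Rightarrow> ('a, 'm, 'y) bimodule_scheme \<Rightarrow> ('a, 'n, 'z) module_scheme \<Rightarrow> ('n \<Rightarrow> 'a) \<Rightarrow>
   (('m \<times> 'n) \<Rightarrow>\<^sub>0 int) set \<Rightarrow> 'm"
  where "tensor_eval A M W \<phi> = tensor_lift A M W (add_monoid M) (\<lambda>x w. x \<odot>r\<^bsub>M\<^esub> \<phi> w)"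

lemma
  assumes M: "right_module A M" and W: "left_module A W" and \<phi>: "\<phi> \<in> left_hom A W (regular_bimodule A)"
  shows tensor_eval_hom: "tensor_eval A M W \<phi> \<in> hom (tensor_group A M W) (add_monoid M)"
    and tensor_eval_pure: "\<lbrakk>x \<in> carrier M; w \<in> carrier W\<rbrakk> \<Longrightarrow>
      tensor_eval A M W \<phi> (pure_tensor A M W x w) = x \<odot>r\<^bsub>M\<^esub> \<phi> w"
    and tensor_eval_closed: "t \<in> carrier (tensor_group A M W) \<Longrightarrow> tensor_eval A M W \<phi> t \<in> carrier M"
proof -
  interpret M: right_module A M by fact
  have b: "balanced_map A M W (add_monoid M) (\<lambda>x w. x \<odot>r\<^bsub>M\<^esub> \<phi> w)"
    using left_hom_closed[OF \<phi>] left_hom_add[OF \<phi>] left_hom_smult[OF \<phi>]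
    by (simp add: balanced_map_def M.rsmult_closed M.rsmult_distr_vector M.rsmult_distr_scalar M.rsmult_assoc)
  show h: "tensor_eval A M W \<phi> \<in> hom (tensor_group A M W) (add_monoid M)"
    unfolding tensor_eval_def by (rule tensor_lift_hom[OF M W M.a_comm_group b])
  show "\<lbrakk>x \<in> carrier M; w \<in> carrier W\<rbrakk> \<Longrightarrow>
      tensor_eval A M W \<phi> (pure_tensor A M W x w) = x \<odot>r\<^bsub>M\<^esub> \<phi> w"
    unfolding tensor_eval_def by (rule tensor_lift_pure[OF M W M.a_comm_group b])
  show "t \<in> carrier (tensor_group A M W) \<Longrightarrow> tensor_eval A M W \<phi> t \<in> carrier M"
    using h by (auto simp: hom_def)
qed

lemma tensor_eval_natural:
  assumes M: "right_module A M" and M': "right_module A M'" and W: "left_module A W"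
    and \<phi>: "\<phi> \<in> left_hom A W (regular_bimodule A)" and f: "f \<in> right_hom A M M'"
    and t: "t \<in> carrier (tensor_group A M W)"
  shows "tensor_eval A M' W \<phi> (tensor_map A M W M' W f (\<lambda>w. w) t) = f (tensor_eval A M W \<phi> t)"
proof -
  interpret M': right_module A M' by fact
  show ?thesis
  proof (rule tensor_hom_eqI[OF M W _ _ _ _ t, where G = "add_monoid M'"])
    show "group (add_monoid M')" by (rule M'.add.is_group)
    show "(\<lambda>t. tensor_eval A M' W \<phi> (tensor_map A M W M' W f (\<lambda>w. w) t)) \<in> hom (tensor_group A M W) (add_monoid M')"
      by (rule hom_comp[OF tensor_map_hom[OF M W M' W f left_hom_id] tensor_eval_hom[OF M' W \<phi>]])
    show "(\<lambda>t. f (tensor_eval A M W \<phi> t)) \<in> hom (tensor_group A M W) (add_monoid M')"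
      by (rule hom_comp[OF tensor_eval_hom[OF M W \<phi>] right_hom_imp_hom[OF f]])
    fix x w assume "x \<in> carrier M" "w \<in> carrier W"
    then show "tensor_eval A M' W \<phi> (tensor_map A M W M' W f (\<lambda>w. w) (pure_tensor A M W x w)) =
      f (tensor_eval A M W \<phi> (pure_tensor A M W x w))"
      using left_hom_closed[OF \<phi>]
      by (simp add: tensor_map_pure[OF M W M' W f left_hom_id] tensor_eval_pure[OF M W \<phi>]
          tensor_eval_pure[OF M' W \<phi>] right_hom_closed[OF f] right_hom_smult[OF f])
  qed
qed

text \<open>Left linearity is an instance of naturality: left multiplication by \<open>a\<close> is
  a right linear endomorphism of \<open>V\<close>.\<close>

lemma tensor_eval_left_hom:
  assumes V: "bimodule A V" and W: "left_module A W" and \<phi>: "\<phi> \<in> left_hom A W (regular_bimodule A)"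
  shows "tensor_eval A V W \<phi> \<in> left_hom A (tensor A V W) V"
proof -
  note l = bimodule.lsmult_right_hom[OF V]
  have "tensor_eval A V W \<phi> (a \<odot>\<^bsub>tensor A V W\<^esub> t) = a \<odot>\<^bsub>V\<^esub> tensor_eval A V W \<phi> t"
    if "a \<in> carrier A" "t \<in> carrier (tensor_group A V W)" for a t
    unfolding tensor_sel
    using tensor_eval_natural[OF bimodule_right[OF V] bimodule_right[OF V] W \<phi> l[OF that(1)] that(2)] .
  then show ?thesis
    using tensor_eval_hom[OF bimodule_right[OF V] W \<phi>]
    by (simp add: left_hom_def hom_def tensor_sel(1,3))
qed

text \<open>These are the maps w \<mapsto> \<phi>1(w) e1 + ... + \<phi>n(w) en. Adding one summand
  at a time gives an induction on the rank in place of manipulations of finite sums.\<close>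

inductive_set finite_rank ::
  "('a, 'x) ring_scheme \<Rightarrow> ('a, 'w, 'y) module_scheme \<Rightarrow> ('w \<Rightarrow> 'w) set"
  for A :: "('a, 'x) ring_scheme" and W :: "('a, 'w, 'y) module_scheme" where
    zero: "(\<lambda>w. \<zero>\<^bsub>W\<^esub>) \<in> finite_rank A W"
  | step: "\<lbrakk>\<phi> \<in> left_hom A W (regular_bimodule A); e \<in> carrier W; u \<in> finite_rank A W\<rbrakk> \<Longrightarrow>
      (\<lambda>w. \<phi> w \<odot>\<^bsub>W\<^esub> e \<oplus>\<^bsub>W\<^esub> u w) \<in> finite_rank A W"

text \<open>This is a local form of the dual basis property; every later use of local projectivity
  goes through it.\<close>

definition locally_finite_rank ::
  "('a, 'x) ring_scheme \<Rightarrow> ('a, 'w, 'y) module_scheme \<Rightarrow> bool"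
  where "locally_finite_rank A W \<longleftrightarrow>
    (\<forall>F. finite F \<and> F \<subseteq> carrier W \<longrightarrow> (\<exists>u \<in> finite_rank A W. \<forall>w \<in> F. u w = w))"

text \<open>The identity of \<open>W\<close> is lifted, on the submodule generated by
  \<open>F\<close>, along the canonical surjection from the free module on the elements of
  \<open>W\<close>. The coordinates of the lift \<open>g\<close> are the functionals, the basis
  elements the vectors.\<close>

lemma locally_projective_imp_locally_finite_rank:
  assumes lp: "locally_projective A W"
  shows "locally_finite_rank A W"
  unfolding locally_finite_rank_def
proof (intro allI impI)
  fix F assume F: "finite F \<and> F \<subseteq> carrier W"
  interpret W: left_module A W using lp by (simp add: locally_projective_def)
  let ?S = "carrier W"
  let ?L = "free_left_module A ?S"
  let ?p = "free_extension W ?S (\<lambda>w. w)"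
  define F' where "F' = \<Inter>{F'. left_submodule A W F' \<and> F \<subseteq> F'}"
  have F': "fg_left_submodule A W F'" "F \<subseteq> F'"
    using F by (auto simp: fg_left_submodule_def F'_def)
  have L: "left_module A ?L" by (rule left_module_free) unfold_locales
  have p: "?p \<in> left_hom A ?L W" by (rule W.free_extension_hom) simp
  have surj: "?p ` carrier ?L = ?S"
  proof
    show "?p ` carrier ?L \<subseteq> ?S" using left_hom_closed[OF p] by auto
    have "w \<in> ?p ` carrier ?L" if "w \<in> ?S" for w
      using W.free_extension_unit[of "\<lambda>w. w" ?S w] that
      by (intro image_eqI[of _ _ "\<lambda>v\<in>?S. if v = w then \<one>\<^bsub>A\<^esub> else \<zero>\<^bsub>A\<^esub>"]) simp_all
    then show "?S \<subseteq> ?p ` carrier ?L" by auto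
  qed
  obtain g where g: "g \<in> left_hom A W ?L" and pg: "\<And>x. x \<in> F \<Longrightarrow> ?p (g x) = x"
    using locally_projective_lift[OF lp F'(1) L W.left_module_axioms p surj left_hom_id] F'(2) by blast
  have gw: "(\<lambda>x. g x w) \<in> left_hom A W (regular_bimodule A)" if "w \<in> ?S" for w
    using left_hom_closed[OF g] left_hom_add[OF g] left_hom_smult[OF g] that
    by (auto simp: left_hom_def hom_def free_left_module_def)
  \<comment> \<open>These are the coordinates that occur on \<open>F\<close>, finitely many since
    \<open>F\<close> is finite and elements of a free module have finite support. Outside
    \<open>F\<close> the lift may have further coordinates, so the finite sum over \<open>T\<close>
    recovers the identity on \<open>F\<close> only.\<close>
  define T where "T = (\<Union>x \<in> F. {w \<in> ?S. g x w \<noteq> \<zero>\<^bsub>A\<^esub>})"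
  have T: "finite T" "T \<subseteq> ?S"
    using F left_hom_closed[OF g] by (auto simp: T_def free_left_module_def)
  have "\<exists>u \<in> finite_rank A W. \<forall>x \<in> ?S. u x = (\<Oplus>\<^bsub>W\<^esub>w \<in> T. g x w \<odot>\<^bsub>W\<^esub> w)"
    using T
  proof (induction T)
    case empty
    then show ?case by (intro bexI[OF _ finite_rank.zero]) simp
  next
    case (insert w T)
    then obtain u where u: "u \<in> finite_rank A W" "\<And>x. x \<in> ?S \<Longrightarrow> u x = (\<Oplus>\<^bsub>W\<^esub>w \<in> T. g x w \<odot>\<^bsub>W\<^esub> w)"
      by auto
    have "g x w \<odot>\<^bsub>W\<^esub> w \<in> ?S" if "x \<in> ?S" "w \<in> ?S" for x w
      using left_hom_closed[OF gw] that by (simp add: W.lsmult_closed)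
    then have sum: "(\<Oplus>\<^bsub>W\<^esub>w \<in> insert w T. g x w \<odot>\<^bsub>W\<^esub> w) = g x w \<odot>\<^bsub>W\<^esub> w \<oplus>\<^bsub>W\<^esub> (\<Oplus>\<^bsub>W\<^esub>w \<in> T. g x w \<odot>\<^bsub>W\<^esub> w)"
      if "x \<in> ?S" for x
      using insert.hyps insert.prems that by (intro W.M.finsum_insert) auto
    have w: "w \<in> ?S" using insert.prems by simp
    show ?case
      by (rule bexI[OF _ finite_rank.step[OF gw[OF w] w u(1)]]) (simp add: sum u(2))
  qed
  then obtain u where u: "u \<in> finite_rank A W" "\<And>x. x \<in> ?S \<Longrightarrow> u x = (\<Oplus>\<^bsub>W\<^esub>w \<in> T. g x w \<odot>\<^bsub>W\<^esub> w)"
    by auto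
  have "u x = x" if x: "x \<in> F" for x
  proof -
    have "?p (g x) = (\<Oplus>\<^bsub>W\<^esub>w \<in> T. g x w \<odot>\<^bsub>W\<^esub> w)"
      using x F left_hom_closed[OF g] T
      by (intro W.free_extension_eq_finsum) (auto simp: T_def)
    then show ?thesis using pg[OF x] u(2) x F by auto
  qed
  then show "\<exists>u \<in> finite_rank A W. \<forall>w \<in> F. u w = w" using u(1) by auto
qed

lemma finite_rank_left_hom:
  assumes W: "left_module A W" and u: "u \<in> finite_rank A W"
  shows "u \<in> left_hom A W W"
  using u
proof induction
  interpret W: left_module A W by fact
  {
    case zero
    then show ?case by (simp add: left_hom_def hom_def W.lsmult_zero_right)
  next
    case (step \<phi> e u)
    note cl = left_hom_closed[OF step.hyps(1)] left_hom_closed[OF step.IH]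
    have "\<phi> (x \<oplus>\<^bsub>W\<^esub> y) \<odot>\<^bsub>W\<^esub> e \<oplus>\<^bsub>W\<^esub> u (x \<oplus>\<^bsub>W\<^esub> y) = \<phi> x \<odot>\<^bsub>W\<^esub> e \<oplus>\<^bsub>W\<^esub> u x \<oplus>\<^bsub>W\<^esub> (\<phi> y \<odot>\<^bsub>W\<^esub> e \<oplus>\<^bsub>W\<^esub> u y)"
      if "x \<in> carrier W" "y \<in> carrier W" for x y
      using that step.hyps(2) cl
      by (simp add: left_hom_add[OF step.hyps(1)] left_hom_add[OF step.IH] W.lsmult_distr_scalar
          W.lsmult_closed W.M.a_ac)
    moreover have "\<phi> (a \<odot>\<^bsub>W\<^esub> x) \<odot>\<^bsub>W\<^esub> e \<oplus>\<^bsub>W\<^esub> u (a \<odot>\<^bsub>W\<^esub> x) = a \<odot>\<^bsub>W\<^esub> (\<phi> x \<odot>\<^bsub>W\<^esub> e \<oplus>\<^bsub>W\<^esub> u x)"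
      if "a \<in> carrier A" "x \<in> carrier W" for a x
      using that step.hyps(2) cl
      by (simp add: left_hom_smult[OF step.hyps(1)] left_hom_smult[OF step.IH] W.lsmult_distr_vector
          W.lsmult_closed W.lsmult_assoc)
    ultimately show ?case
      using cl step.hyps(2) by (simp add: left_hom_def hom_def W.lsmult_closed)
  }
qed

lemma tensor_map_zero_right:
  assumes M: "right_module A M" and W: "left_module A W" and t: "t \<in> carrier (tensor_group A M W)"
  shows "tensor_map A M W M W (\<lambda>x. x) (\<lambda>w. \<zero>\<^bsub>W\<^esub>) t = \<one>\<^bsub>tensor_group A M W\<^esub>"
proof -
  interpret T: comm_group "tensor_group A M W" by (rule tensor_group_comm_group[OF M W])
  note z = finite_rank_left_hom[OF W finite_rank.zero]
  show ?thesis
  proof (rule tensor_hom_eqI[OF M W T.is_group _ _ _ t])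
    show "tensor_map A M W M W (\<lambda>x. x) (\<lambda>w. \<zero>\<^bsub>W\<^esub>) \<in> hom (tensor_group A M W) (tensor_group A M W)"
      by (rule tensor_map_hom[OF M W M W right_hom_id z])
    show "(\<lambda>t. \<one>\<^bsub>tensor_group A M W\<^esub>) \<in> hom (tensor_group A M W) (tensor_group A M W)"
      by (simp add: hom_def)
  qed (simp add: tensor_map_pure[OF M W M W right_hom_id z] pure_tensor_zero_right[OF M W])
qed

text \<open>The scalar \<phi>(w) crosses the tensor sign: x \<otimes> \<phi>(w) e = x \<phi>(w)
  \<otimes> e. A rank one map thus sends any \<open>t\<close> to a pure tensor whose left factor is
  the contraction of \<open>t\<close>.\<close>

lemma tensor_map_rank_step:
  assumes M: "right_module A M" and W: "left_module A W"
    and \<phi>: "\<phi> \<in> left_hom A W (regular_bimodule A)" and e: "e \<in> carrier W" and fu: "u \<in> finite_rank A W"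
    and t: "t \<in> carrier (tensor_group A M W)"
  shows "tensor_map A M W M W (\<lambda>x. x) (\<lambda>w. \<phi> w \<odot>\<^bsub>W\<^esub> e \<oplus>\<^bsub>W\<^esub> u w) t =
    pure_tensor A M W (tensor_eval A M W \<phi> t) e \<otimes>\<^bsub>tensor_group A M W\<^esub> tensor_map A M W M W (\<lambda>x. x) u t"
proof -
  let ?T = "tensor_group A M W"
  interpret M: right_module A M by fact
  interpret W: left_module A W by fact
  interpret T: comm_group ?T by (rule tensor_group_comm_group[OF M W])
  note u = finite_rank_left_hom[OF W fu]
    and u' = finite_rank_left_hom[OF W finite_rank.step[OF \<phi> e fu]]
  show ?thesis
  proof (rule tensor_hom_eqI[OF M W T.is_group _ _ _ t])
    show "(\<lambda>t. pure_tensor A M W (tensor_eval A M W \<phi> t) e \<otimes>\<^bsub>?T\<^esub> tensor_map A M W M W (\<lambda>x. x) u t) \<in> hom ?T ?T"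
      by (intro hom_pointwise_mult T.comm_group_axioms tensor_map_hom[OF M W M W right_hom_id u]
          hom_comp[OF tensor_eval_hom[OF M W \<phi>] pure_tensor_hom_left[OF M W e]])
    fix x w assume "x \<in> carrier M" "w \<in> carrier W"
    then show "tensor_map A M W M W (\<lambda>x. x) (\<lambda>w. \<phi> w \<odot>\<^bsub>W\<^esub> e \<oplus>\<^bsub>W\<^esub> u w) (pure_tensor A M W x w) =
      pure_tensor A M W (tensor_eval A M W \<phi> (pure_tensor A M W x w)) e \<otimes>\<^bsub>?T\<^esub>
      tensor_map A M W M W (\<lambda>x. x) u (pure_tensor A M W x w)"
      using e left_hom_closed[OF \<phi>] left_hom_closed[OF u]
      by (simp add: tensor_map_pure[OF M W M W right_hom_id u] tensor_map_pure[OF M W M W right_hom_id u']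
          tensor_eval_pure[OF M W \<phi>] pure_tensor_add_right[OF M W]
          pure_tensor_balanced[OF M W] W.lsmult_closed)
  qed (rule tensor_map_hom[OF M W M W right_hom_id u'])
qed

lemma tensor_map_finite_rank_in_subgroup:
  assumes M: "right_module A M" and W: "left_module A W" and u: "u \<in> finite_rank A W"
    and t: "t \<in> carrier (tensor_group A M W)" and H: "subgroup H (tensor_group A M W)"
    and ev: "\<And>\<phi> e. \<lbrakk>\<phi> \<in> left_hom A W (regular_bimodule A); e \<in> carrier W\<rbrakk> \<Longrightarrow>
      pure_tensor A M W (tensor_eval A M W \<phi> t) e \<in> H"
  shows "tensor_map A M W M W (\<lambda>x. x) u t \<in> H"
  using u
proof induction
  case zero
  then show ?case by (simp add: tensor_map_zero_right[OF M W t] subgroup.one_closed[OF H])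
next
  case (step \<phi> e u)
  then show ?case
    using ev[OF step.hyps(1,2)]
    by (simp add: tensor_map_rank_step[OF M W _ _ _ t] subgroup.m_closed[OF H])
qed

text \<open>A tensor involves finitely many elements of \<open>W\<close>. Instead of choosing a
  representation, the set \<open>F\<close> is described by its effect: an endomorphism that fixes
  \<open>F\<close> pointwise fixes \<open>t\<close>. In this form it is built up by
  induction.\<close>

lemma tensor_map_eq_self_if_finite:
  assumes M: "right_module A M" and W: "left_module A W" and t: "t \<in> carrier (tensor_group A M W)"
  shows "\<exists>F. finite F \<and> F \<subseteq> carrier W \<and>
    (\<forall>u \<in> left_hom A W W. (\<forall>w \<in> F. u w = w) \<longrightarrow> tensor_map A M W M W (\<lambda>x. x) u t = t)"
  using M W t
proof (induction rule: tensor_induct)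
  interpret T: comm_group "tensor_group A M W" by (rule tensor_group_comm_group[OF M W])
  {
    case one
    have "tensor_map A M W M W (\<lambda>x. x) u \<one>\<^bsub>tensor_group A M W\<^esub> = \<one>\<^bsub>tensor_group A M W\<^esub>"
      if "u \<in> left_hom A W W" for u
      using hom_one[OF tensor_map_hom[OF M W M W right_hom_id that] T.is_group T.is_group] .
    then show ?case by (intro exI[of _ "{}"]) simp
  next
    case (pure x w)
    then show ?case
      by (intro exI[of _ "{w}"]) (simp add: tensor_map_pure[OF M W M W right_hom_id])
  next
    case (diff s t)
    then obtain F G where F: "finite F" "F \<subseteq> carrier W"
      "\<And>u. \<lbrakk>u \<in> left_hom A W W; \<forall>w \<in> F. u w = w\<rbrakk> \<Longrightarrow> tensor_map A M W M W (\<lambda>x. x) u s = s"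
      and G: "finite G" "G \<subseteq> carrier W"
      "\<And>u. \<lbrakk>u \<in> left_hom A W W; \<forall>w \<in> G. u w = w\<rbrakk> \<Longrightarrow> tensor_map A M W M W (\<lambda>x. x) u t = t"
      by metis
    have "tensor_map A M W M W (\<lambda>x. x) u (s \<otimes>\<^bsub>tensor_group A M W\<^esub> inv\<^bsub>tensor_group A M W\<^esub> t) =
      s \<otimes>\<^bsub>tensor_group A M W\<^esub> inv\<^bsub>tensor_group A M W\<^esub> t"
      if u: "u \<in> left_hom A W W" "\<forall>w \<in> F \<union> G. u w = w" for u
    proof -
      interpret h: group_hom "tensor_group A M W" "tensor_group A M W" "tensor_map A M W M W (\<lambda>x. x) u"
        using tensor_map_hom[OF M W M W right_hom_id u(1)] by unfold_locales
      show ?thesis using diff.hyps F(3) G(3) u by simp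
    qed
    then show ?case using F(1,2) G(1,2) by (intro exI[of _ "F \<union> G"]) auto
  }
qed

text \<open>One map serves all of the finite set \<open>F\<close> at once, which the local finite
  rank property of a tensor product requires.\<close>

lemma tensor_finite_rank:
  assumes M: "right_module A M" and W: "left_module A W" and lW: "locally_finite_rank A W"
    and F: "finite F" "F \<subseteq> carrier (tensor_group A M W)"
  shows "\<exists>u \<in> finite_rank A W. \<forall>t \<in> F. tensor_map A M W M W (\<lambda>x. x) u t = t"
proof -
  have "\<forall>t \<in> F. \<exists>G. finite G \<and> G \<subseteq> carrier W \<and>
    (\<forall>u \<in> left_hom A W W. (\<forall>w \<in> G. u w = w) \<longrightarrow> tensor_map A M W M W (\<lambda>x. x) u t = t)"
    using tensor_map_eq_self_if_finite[OF M W subsetD[OF F(2)]] by (rule ballI)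
  from bchoice[OF this] obtain G where G: "\<forall>t \<in> F. finite (G t) \<and> G t \<subseteq> carrier W \<and>
    (\<forall>u \<in> left_hom A W W. (\<forall>w \<in> G t. u w = w) \<longrightarrow> tensor_map A M W M W (\<lambda>x. x) u t = t)" ..
  then have "finite (\<Union> (G ` F)) \<and> \<Union> (G ` F) \<subseteq> carrier W" using F(1) by auto
  then obtain u where u: "u \<in> finite_rank A W" "\<forall>w \<in> \<Union> (G ` F). u w = w"
    using lW unfolding locally_finite_rank_def by meson
  with G finite_rank_left_hom[OF W u(1)] show ?thesis by blast
qed

text \<open>Some finite rank map fixes \<open>t\<close>, so \<open>t\<close> is a sum of terms (id
  \<otimes> \<phi>)(t) \<otimes> e. With \<open>H\<close> trivial this gives injectivity of induced
  maps; with \<open>H\<close> an image it shows that a coaction restricts to a stable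
  submodule.\<close>

lemma tensor_in_subgroupI:
  assumes M: "right_module A M" and W: "left_module A W" and lW: "locally_finite_rank A W"
    and t: "t \<in> carrier (tensor_group A M W)" and H: "subgroup H (tensor_group A M W)"
    and ev: "\<And>\<phi> e. \<lbrakk>\<phi> \<in> left_hom A W (regular_bimodule A); e \<in> carrier W\<rbrakk> \<Longrightarrow>
      pure_tensor A M W (tensor_eval A M W \<phi> t) e \<in> H"
  shows "t \<in> H"
proof -
  obtain u where u: "u \<in> finite_rank A W" "tensor_map A M W M W (\<lambda>x. x) u t = t"
    using tensor_finite_rank[OF M W lW, of "{t}"] t by auto
  show ?thesis
    using tensor_map_finite_rank_in_subgroup[OF M W u(1) t H ev] u(2) by simp
qed

text \<open>Contraction commutes with \<open>f\<close>. If the image of \<open>t\<close> vanishes,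
  then \<open>f\<close> kills every contraction of \<open>t\<close>, so every contraction is zero,
  and \<open>t\<close> is a sum of terms built from its contractions.\<close>

lemma tensor_map_inj:
  assumes K: "right_module A K" and M: "right_module A M" and W: "left_module A W"
    and lW: "locally_finite_rank A W" and f: "f \<in> right_hom A K M" and inj: "inj_on f (carrier K)"
  shows "inj_on (tensor_map A K W M W f (\<lambda>w. w)) (carrier (tensor_group A K W))"
proof -
  let ?f = "tensor_map A K W M W f (\<lambda>w. w)"
  interpret K: right_module A K by fact
  interpret M: right_module A M by fact
  interpret TK: comm_group "tensor_group A K W" by (rule tensor_group_comm_group[OF K W])
  interpret TM: comm_group "tensor_group A M W" by (rule tensor_group_comm_group[OF M W])
  interpret h: group_hom "tensor_group A K W" "tensor_group A M W" ?f
    using tensor_map_hom[OF K W M W f left_hom_id] by unfold_locales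
  have "t = \<one>\<^bsub>tensor_group A K W\<^esub>" if t: "t \<in> carrier (tensor_group A K W)" "?f t = \<one>\<^bsub>tensor_group A M W\<^esub>" for t
  proof -
    have "pure_tensor A K W (tensor_eval A K W \<phi> t) e \<in> {\<one>\<^bsub>tensor_group A K W\<^esub>}"
      if \<phi>: "\<phi> \<in> left_hom A W (regular_bimodule A)" and e: "e \<in> carrier W" for \<phi> e
    proof -
      have "f (tensor_eval A K W \<phi> t) = \<zero>\<^bsub>M\<^esub>"
        using tensor_eval_natural[OF K M W \<phi> f t(1)] t(2)
          hom_one[OF tensor_eval_hom[OF M W \<phi>] TM.is_group M.add.is_group] by simp
      then have "tensor_eval A K W \<phi> t = \<zero>\<^bsub>K\<^esub>"
        using inj right_hom_zero[OF K M f] tensor_eval_closed[OF K W \<phi> t(1)] K.zero_closed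
        by (metis inj_onD)
      then show ?thesis using pure_tensor_zero_left[OF K W e] by simp
    qed
    then have "t \<in> {\<one>\<^bsub>tensor_group A K W\<^esub>}"
      by (rule tensor_in_subgroupI[OF K W lW t(1) TK.triv_subgroup])
    then show ?thesis by simp
  qed
  then show ?thesis
    unfolding h.inj_iff_trivial_ker by (auto simp: kernel_def)
qed

text \<open>The summands of \<open>u\<close> are put in front of those of \<open>v\<close>. Equality
  is claimed on the carrier only, because zero is neutral just for values of \<open>v\<close> that
  lie in the module.\<close>

lemma finite_rank_add:
  assumes W: "left_module A W" and u: "u \<in> finite_rank A W" and v: "v \<in> finite_rank A W"
  shows "\<exists>s \<in> finite_rank A W. \<forall>w \<in> carrier W. s w = u w \<oplus>\<^bsub>W\<^esub> v w"
  using u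
proof induction
  interpret W: left_module A W by fact
  {
    case zero
    then show ?case
      by (intro bexI[OF _ v]) (simp add: left_hom_closed[OF finite_rank_left_hom[OF W v]])
  next
    case (step \<phi> e u)
    then obtain s where s: "s \<in> finite_rank A W" "\<And>w. w \<in> carrier W \<Longrightarrow> s w = u w \<oplus>\<^bsub>W\<^esub> v w" by auto
    have "\<phi> w \<odot>\<^bsub>W\<^esub> e \<oplus>\<^bsub>W\<^esub> (u w \<oplus>\<^bsub>W\<^esub> v w) = \<phi> w \<odot>\<^bsub>W\<^esub> e \<oplus>\<^bsub>W\<^esub> u w \<oplus>\<^bsub>W\<^esub> v w" if "w \<in> carrier W" for w
    proof -
      have "\<phi> w \<in> carrier A" "u w \<in> carrier W" "v w \<in> carrier W"
        using left_hom_closed[OF step.hyps(1) that] left_hom_closed[OF finite_rank_left_hom[OF W] that]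
          step.hyps(3) v by simp_all
      then show ?thesis using step.hyps(2) by (simp add: W.M.a_assoc W.lsmult_closed)
    qed
    then show ?case
      by (intro bexI[OF _ finite_rank.step[OF step.hyps(1,2) s(1)]]) (simp add: s(2))
  }
qed

text \<open>A finite rank \<open>u\<close> on \<open>W\<close> fixing \<open>F\<close> writes each
  \<open>t\<close> in \<open>F\<close> as a sum of terms (id \<otimes> \<phi>)(t) \<otimes> e. The
  left factors are finitely many elements of \<open>V\<close>, so a finite rank \<open>v\<close> on
  \<open>V\<close> can be inserted there, and composing its functionals with the contraction gives
  functionals on the tensor product.\<close>

lemma locally_finite_rank_tensor:
  assumes V: "bimodule A V" and W: "left_module A W"
    and lV: "locally_finite_rank A V" and lW: "locally_finite_rank A W"
  shows "locally_finite_rank A (tensor A V W)"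
  unfolding locally_finite_rank_def
proof (intro allI impI, elim conjE)
  fix F assume F: "finite F" "F \<subseteq> carrier (tensor A V W)"
  let ?T = "tensor A V W"
  interpret V: bimodule A V by fact
  interpret W: left_module A W by fact
  note VW = bimodule_right[OF V] W
  interpret T: left_module A ?T by (rule left_module_tensor[OF V W])
  note T = T.left_module_axioms
  have pure_closed: "pure_tensor A V W x e \<in> carrier ?T" if "x \<in> carrier V" "e \<in> carrier W" for x e
    using pure_tensor_closed[OF VW that] by (simp add: tensor_sel)
  \<comment> \<open>A summand \<psi>(_) x of \<open>v\<close> contributes the functional \<psi>
    after \<open>h\<close> together with the vector x \<otimes> e.\<close>
  have outer: "\<exists>s \<in> finite_rank A ?T. \<forall>t \<in> carrier ?T. s t = pure_tensor A V W (v (h t)) e"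
    if h: "h \<in> left_hom A ?T V" and e: "e \<in> carrier W" and v: "v \<in> finite_rank A V" for h e v
    using v
  proof induction
    case zero
    show ?case
      by (rule bexI[OF _ finite_rank.zero]) (simp add: pure_tensor_zero_left[OF VW e] tensor_sel)
  next
    case (step \<psi> x v)
    then obtain s where s: "s \<in> finite_rank A ?T"
      "\<And>t. t \<in> carrier ?T \<Longrightarrow> s t = pure_tensor A V W (v (h t)) e" by auto
    have \<psi>h: "(\<lambda>t. \<psi> (h t)) \<in> left_hom A ?T (regular_bimodule A)"
      by (rule left_hom_comp[OF h step.hyps(1)])
    have v_cl: "v y \<in> carrier V" if "y \<in> carrier V" for y
      using left_hom_closed[OF finite_rank_left_hom[OF bimodule_left[OF V] step.hyps(3)] that] .
    have eq: "pure_tensor A V W (\<psi> (h t) \<odot>\<^bsub>V\<^esub> x \<oplus>\<^bsub>V\<^esub> v (h t)) e =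
      \<psi> (h t) \<odot>\<^bsub>?T\<^esub> pure_tensor A V W x e \<oplus>\<^bsub>?T\<^esub> pure_tensor A V W (v (h t)) e" if "t \<in> carrier ?T" for t
    proof -
      have "\<psi> (h t) \<in> carrier A" "v (h t) \<in> carrier V"
        using left_hom_closed[OF \<psi>h that] left_hom_closed[OF h that] v_cl by auto
      then show ?thesis
        using step.hyps(2) e
        by (simp add: smult_pure_tensor[OF V W] pure_tensor_add_left[OF VW] V.lsmult_closed tensor_sel(3))
    qed
    show ?case
      by (rule bexI[OF _ finite_rank.step[OF \<psi>h pure_closed[OF step.hyps(2) e] s(1)]]) (simp add: s(2) eq)
  qed
  have inner: "\<exists>s \<in> finite_rank A ?T. \<forall>t \<in> F. s t = tensor_map A V W V W (\<lambda>x. x) u t"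
    if "u \<in> finite_rank A W" for u
    using that
  proof induction
    case zero
    show ?case
      using F(2) by (intro bexI[OF _ finite_rank.zero]) (auto simp: tensor_map_zero_right[OF VW] tensor_sel)
  next
    case (step \<phi> e u)
    then obtain s where s: "s \<in> finite_rank A ?T" "\<And>t. t \<in> F \<Longrightarrow> s t = tensor_map A V W V W (\<lambda>x. x) u t"
      by auto
    \<comment> \<open>The summand \<open>?ev t\<close> \<otimes> e still ranges over arbitrary left
      factors. Replacing \<open>?ev t\<close> by \<open>v (?ev t)\<close> makes it of finite rank
      and changes nothing on \<open>F\<close>.\<close>
    let ?ev = "tensor_eval A V W \<phi>"
    have ev: "?ev \<in> left_hom A ?T V" by (rule tensor_eval_left_hom[OF V W step.hyps(1)])
    then have "finite (?ev ` F) \<and> ?ev ` F \<subseteq> carrier V"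
      using F left_hom_closed[OF ev] by auto
    then obtain v where v: "v \<in> finite_rank A V" "\<And>t. t \<in> F \<Longrightarrow> v (?ev t) = ?ev t"
      using lV unfolding locally_finite_rank_def by (metis imageI)
    obtain p where p: "p \<in> finite_rank A ?T" "\<And>t. t \<in> carrier ?T \<Longrightarrow> p t = pure_tensor A V W (v (?ev t)) e"
      using outer[OF ev step.hyps(2) v(1)] by auto
    obtain q where q: "q \<in> finite_rank A ?T" "\<And>t. t \<in> carrier ?T \<Longrightarrow> q t = p t \<oplus>\<^bsub>?T\<^esub> s t"
      using finite_rank_add[OF T p(1) s(1)] by auto
    have "q t = tensor_map A V W V W (\<lambda>x. x) (\<lambda>w. \<phi> w \<odot>\<^bsub>W\<^esub> e \<oplus>\<^bsub>W\<^esub> u w) t" if "t \<in> F" for t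
      using subsetD[OF F(2) that] that q(2) p(2) v(2) s(2)
      by (simp add: tensor_map_rank_step[OF VW step.hyps(1-3)] tensor_sel(1,3))
    then show ?case using q(1) by auto
  qed
  obtain u where "u \<in> finite_rank A W" "\<forall>t \<in> F. tensor_map A V W V W (\<lambda>x. x) u t = t"
    using tensor_finite_rank[OF VW lW F(1)] F(2) by (auto simp: tensor_sel)
  with inner show "\<exists>s \<in> finite_rank A ?T. \<forall>t \<in> F. s t = t" by metis
qed

section \<open>Subcomodules as stable submodules\<close>

text \<open>Seen as contraction with the identity functional of A, the unitor inherits naturality
  from \<open>tensor_eval_natural\<close>.\<close>

lemma right_unitor_eq_tensor_eval:
  "right_unitor A M = tensor_eval A M (regular_bimodule A) (\<lambda>a. a)"
  by (simp add: right_unitor_def tensor_eval_def)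

lemma comodule_bimodule: "comodule A C M \<Longrightarrow> bimodule A C"
  by (simp add: comodule_def coring_def)

lemma comodule_right_module: "comodule A C M \<Longrightarrow> right_module A M"
  by (simp add: comodule_def)

lemma coact_closed:
  assumes "comodule A C M" "x \<in> carrier M"
  shows "coact M x \<in> carrier (tensor_group A M C)"
  using right_hom_closed[OF comodule.coact_linear[OF assms(1)] assms(2)] by (simp add: tensor_sel)

text \<open>Each axiom for \<open>K\<close> is an equation that becomes an axiom of \<open>M\<close>
  after applying a map induced by \<open>f\<close>, and these maps are injective. Hence any function
  \<open>coact K\<close> compatible with \<open>f\<close> is automatically linear, coassociative and
  counital.\<close>

lemma comodule_from_injection:
  fixes K :: "('a, 'k, 'c) comodule"
  assumes M: "comodule A C M" and K: "right_module A K" and C: "locally_finite_rank A C"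
    and f: "f \<in> right_hom A K M" and inj: "inj_on f (carrier K)"
    and cl: "\<And>x. x \<in> carrier K \<Longrightarrow> coact K x \<in> carrier (tensor_group A K C)"
    and eq: "\<And>x. x \<in> carrier K \<Longrightarrow> tensor_map A K C M C f (\<lambda>c. c) (coact K x) = coact M (f x)"
  shows "comodule A C K"
proof -
  interpret M: comodule A C M by fact
  interpret K: right_module A K by fact
  have bC: "bimodule A C" by unfold_locales
  note rC = bimodule_right[OF bC] and lC = bimodule_left[OF bC]
  have rM: "right_module A M" by unfold_locales
  note KC = K lC and MC = rM lC
  let ?CC = "tensor A C C"
  note rKC = right_module_tensor[OF K bC] and rMC = right_module_tensor[OF rM bC]
    and lCC = left_module_tensor[OF bC lC] and rCC = right_module_tensor[OF rC bC]
  let ?R = "regular_bimodule A"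
  have bR: "bimodule A ?R" by (rule bimodule_regular) unfold_locales
  note lR = bimodule_left[OF bR]
  let ?f = "tensor_map A K C M C f (\<lambda>c. c)"
  have f1: "?f \<in> right_hom A (tensor A K C) (tensor A M C)"
    by (rule tensor_map_right_hom[OF K bC rM bC f left_hom_id right_hom_id])
  have inj1: "inj_on ?f (carrier (tensor_group A K C))"
    by (rule tensor_map_inj[OF K rM lC C f inj])
  interpret TK: right_module A "tensor A K C" by (rule rKC)
  have coK: "coact K \<in> right_hom A K (tensor A K C)"
    unfolding right_hom_def hom_def
  proof (intro CollectI conjI ballI IntI)
    show "coact K \<in> carrier (add_monoid K) \<rightarrow> carrier (add_monoid (tensor A K C))"
      using cl by (auto simp: tensor_sel)
  next
    fix x y assume "x \<in> carrier (add_monoid K)" "y \<in> carrier (add_monoid K)"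
    then have xy: "x \<in> carrier K" "y \<in> carrier K" by simp_all
    have "?f (coact K (x \<oplus>\<^bsub>K\<^esub> y)) = ?f (coact K x \<oplus>\<^bsub>tensor A K C\<^esub> coact K y)"
      using xy cl
      by (simp add: right_hom_add[OF f1] tensor_sel(1) eq right_hom_add[OF f] right_hom_closed[OF f]
          right_hom_add[OF M.coact_linear])
    moreover have "coact K x \<oplus>\<^bsub>tensor A K C\<^esub> coact K y \<in> carrier (tensor_group A K C)"
      using TK.M.a_closed[of "coact K x" "coact K y"] xy cl by (simp add: tensor_sel(1))
    ultimately show "coact K (x \<otimes>\<^bsub>add_monoid K\<^esub> y) = coact K x \<otimes>\<^bsub>add_monoid (tensor A K C)\<^esub> coact K y"
      using inj_onD[OF inj1] cl xy by simp
  next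
    fix a x assume a: "a \<in> carrier A" and x: "x \<in> carrier K"
    have "?f (coact K (x \<odot>r\<^bsub>K\<^esub> a)) = ?f (coact K x \<odot>r\<^bsub>tensor A K C\<^esub> a)"
      using x a cl
      by (simp add: right_hom_smult[OF f1] tensor_sel(1) eq right_hom_smult[OF f] right_hom_closed[OF f]
          right_hom_smult[OF M.coact_linear] K.rsmult_closed)
    moreover have "coact K x \<odot>r\<^bsub>tensor A K C\<^esub> a \<in> carrier (tensor_group A K C)"
      using TK.rsmult_closed[of a "coact K x"] a x cl by (simp add: tensor_sel(1))
    ultimately show "coact K (x \<odot>r\<^bsub>K\<^esub> a) = coact K x \<odot>r\<^bsub>tensor A K C\<^esub> a"
      using inj_onD[OF inj1] cl x a K.rsmult_closed by simp
  qed
  note comult_left = M.comult_bilinear[THEN IntD1] and counit_left = M.counit_bilinear[THEN IntD1]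
  show ?thesis
  proof unfold_locales
    show "coact K \<in> right_hom A K (tensor A K C)" by fact
  next
    fix x assume x: "x \<in> carrier K"
    note t = cl[OF x]
    let ?t = "coact K x"
    let ?g = "tensor_map A K ?CC M ?CC f (\<lambda>s. s)"
    \<comment> \<open>Naturality of the associator moves \<open>f\<close> inside, the equation
      \<open>eq\<close> turns it into the coaction of \<open>M\<close> at \<open>f x\<close>, and
      after coassociativity of \<open>M\<close> functoriality leads back to
      \<open>K\<close>.\<close>
    have "?g (tensor_assoc A K C C (tensor_map A K C (tensor A K C) C (coact K) (\<lambda>d. d) ?t)) =
      tensor_assoc A M C C (tensor_map A (tensor A K C) C (tensor A M C) C ?f (\<lambda>z. z)
        (tensor_map A K C (tensor A K C) C (coact K) (\<lambda>d. d) ?t))"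
      by (rule tensor_assoc_natural[OF K bC lC rM f, symmetric])
        (rule tensor_map_closed[OF KC rKC lC coK left_hom_id t])
    also have "\<dots> = tensor_assoc A M C C (tensor_map A K C (tensor A M C) C (\<lambda>x. ?f (coact K x)) (\<lambda>d. d) ?t)"
      by (simp add: tensor_map_comp[OF KC rKC lC rMC lC coK left_hom_id f1 left_hom_id t])
    also have "tensor_map A K C (tensor A M C) C (\<lambda>x. ?f (coact K x)) (\<lambda>d. d) =
      tensor_map A K C (tensor A M C) C (\<lambda>x. coact M (f x)) (\<lambda>d. d)"
      by (rule tensor_map_cong) (simp_all add: eq)
    also have "\<dots> ?t = tensor_map A M C (tensor A M C) C (coact M) (\<lambda>d. d) (?f ?t)"
      by (simp add: tensor_map_comp[OF KC MC rMC lC f left_hom_id M.coact_linear left_hom_id t])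
    also have "tensor_assoc A M C C \<dots> = tensor_map A M C M ?CC (\<lambda>y. y) (comult C) (?f ?t)"
      using M.coact_coassoc[OF right_hom_closed[OF f x]] by (simp add: eq[OF x])
    also have "\<dots> = tensor_map A K C M ?CC f (comult C) ?t"
      by (simp add: tensor_map_comp[OF KC MC rM lCC f left_hom_id right_hom_id comult_left t])
    also have "\<dots> = ?g (tensor_map A K C K ?CC (\<lambda>y. y) (comult C) ?t)"
      by (simp add: tensor_map_comp[OF KC K lCC rM lCC right_hom_id comult_left f left_hom_id t])
    finally have "?g (tensor_assoc A K C C (tensor_map A K C (tensor A K C) C (coact K) (\<lambda>d. d) ?t)) =
      ?g (tensor_map A K C K ?CC (\<lambda>y. y) (comult C) ?t)" .
    then show "tensor_assoc A K C C (tensor_map A K C (tensor A K C) C (coact K) (\<lambda>d. d) ?t) =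
      tensor_map A K C K ?CC (\<lambda>y. y) (comult C) ?t"
    \<comment> \<open>The two sides are compared in M \<otimes> (C \<otimes> C), so injectivity is
      required for the module C \<otimes> C.\<close>
    proof (rule inj_onD[OF tensor_map_inj[OF K rM lCC locally_finite_rank_tensor[OF bC lC C C] f inj]])
      show "tensor_assoc A K C C (tensor_map A K C (tensor A K C) C (coact K) (\<lambda>d. d) ?t) \<in> carrier (tensor_group A K ?CC)"
        by (rule hom_in_carrier[OF tensor_assoc_hom[OF K bC lC] tensor_map_closed[OF KC rKC lC coK left_hom_id t]])
      show "tensor_map A K C K ?CC (\<lambda>y. y) (comult C) ?t \<in> carrier (tensor_group A K ?CC)"
        by (rule tensor_map_closed[OF KC K lCC right_hom_id comult_left t])
    qed
  next
    fix x assume x: "x \<in> carrier K"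
    note t = cl[OF x]
    let ?t = "coact K x"
    let ?e = "tensor_map A K C K ?R (\<lambda>y. y) (counit C) ?t"
    have id: "(\<lambda>a. a) \<in> left_hom A ?R ?R" by (rule left_hom_id)
    have e: "?e \<in> carrier (tensor_group A K ?R)"
      by (rule tensor_map_closed[OF KC K lR right_hom_id counit_left t])
    have "f (right_unitor A K ?e) = right_unitor A M (tensor_map A K ?R M ?R f (\<lambda>a. a) ?e)"
      by (simp add: right_unitor_eq_tensor_eval tensor_eval_natural[OF K rM lR id f e])
    also have "tensor_map A K ?R M ?R f (\<lambda>a. a) ?e = tensor_map A K C M ?R f (counit C) ?t"
      by (simp add: tensor_map_comp[OF KC K lR rM lR right_hom_id counit_left f id t])
    also have "\<dots> = tensor_map A M C M ?R (\<lambda>y. y) (counit C) (?f ?t)"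
      by (simp add: tensor_map_comp[OF KC MC rM lR f left_hom_id right_hom_id counit_left t])
    also have "right_unitor A M \<dots> = f x"
      using M.coact_counit[OF right_hom_closed[OF f x]] by (simp add: eq[OF x])
    finally show "right_unitor A K ?e = x"
      using inj_onD[OF inj] x tensor_eval_closed[OF K lR id e]
      by (simp add: right_unitor_eq_tensor_eval)
  qed
qed

section \<open>The action of the dual of the coring\<close>

text \<open>This is the usual action of the left dual Hom(C, A) on a right comodule, written for one
  functional at a time.\<close>

definition dual_act ::
  "('a, 'x) ring_scheme \<Rightarrow> ('a, 'c) coring \<Rightarrow> ('a, 'm, 'c) comodule \<Rightarrow> ('c \<Rightarrow> 'a) \<Rightarrow> 'm \<Rightarrow> 'm"
  where "dual_act A C M \<phi> x = tensor_eval A M C \<phi> (coact M x)"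

definition dual_stable ::
  "('a, 'x) ring_scheme \<Rightarrow> ('a, 'c) coring \<Rightarrow> ('a, 'm, 'c) comodule \<Rightarrow> 'm set \<Rightarrow> bool"
  where "dual_stable A C M H \<longleftrightarrow> subgroup H (add_monoid M) \<and>
    (\<forall>x \<in> H. \<forall>a \<in> carrier A. x \<odot>r\<^bsub>M\<^esub> a \<in> H) \<and>
    (\<forall>x \<in> H. \<forall>\<phi> \<in> left_hom A C (regular_bimodule A). dual_act A C M \<phi> x \<in> H)"

lemma dual_act_hom:
  assumes "comodule A C M" "\<phi> \<in> left_hom A C (regular_bimodule A)"
  shows "dual_act A C M \<phi> \<in> hom (add_monoid M) (add_monoid M)"
  unfolding dual_act_def
  using right_hom_imp_hom[OF comodule.coact_linear[OF assms(1)]] assms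
  by (intro hom_comp[of "coact M", OF _ tensor_eval_hom])
    (auto simp: hom_tensor comodule_right_module intro: bimodule_left comodule_bimodule)

lemma
  assumes "f \<in> comod_hom A C M N"
  shows comod_hom_right_hom: "f \<in> right_hom A M N"
    and comod_hom_colinear: "x \<in> carrier M \<Longrightarrow> tensor_map A M C N C f (\<lambda>c. c) (coact M x) = coact N (f x)"
  using assms by (auto simp: comod_hom_def)

lemma comod_hom_dual_act:
  assumes M: "comodule A C M" and N: "comodule A C N" and f: "f \<in> comod_hom A C M N"
    and \<phi>: "\<phi> \<in> left_hom A C (regular_bimodule A)" and x: "x \<in> carrier M"
  shows "f (dual_act A C M \<phi> x) = dual_act A C N \<phi> (f x)"
  unfolding dual_act_def comod_hom_colinear[OF f x, symmetric]
  by (rule tensor_eval_natural[symmetric])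
    (use M N f \<phi> x in \<open>auto simp: comodule_right_module coact_closed comod_hom_right_hom
      intro: bimodule_left comodule_bimodule\<close>)

lemma sub_structure_sel [simp]:
  "carrier (sub_structure M H \<rho>) = H"
  "add (sub_structure M H \<rho>) = add M"
  "\<zero>\<^bsub>sub_structure M H \<rho>\<^esub> = \<zero>\<^bsub>M\<^esub>"
  "rsmult (sub_structure M H \<rho>) = rsmult M"
  "coact (sub_structure M H \<rho>) = \<rho>"
  by (simp_all add: sub_structure_def)

text \<open>The tensor product reads the carrier, addition and right action of a module. Stating
  this separately breaks a circle: the values of \<rho> lie in a tensor group formed from a record
  that contains \<rho>.\<close>

lemma tensor_group_sub_structure:
  "tensor_group A (sub_structure M H \<rho>) C = tensor_group A (sub_structure M H \<rho>') C"
  "pure_tensor A (sub_structure M H \<rho>) C = pure_tensor A (sub_structure M H \<rho>') C"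
  by (simp_all add: fun_eq_iff tensor_group_def pure_tensor_def tensor_kernel_def tensor_relators_def)

lemma tensor_map_sub_structure:
  "tensor_map A (sub_structure M H \<rho>) C P Q f g = tensor_map A (sub_structure M H \<rho>') C P Q f g"
  by (simp add: tensor_map_def tensor_lift_def tensor_group_sub_structure[of A M H \<rho> C \<rho>'])

lemma subgroup_add_iff:
  assumes "abelian_group M"
  shows "subgroup H (add_monoid M) \<longleftrightarrow> H \<subseteq> carrier M \<and> \<zero>\<^bsub>M\<^esub> \<in> H \<and>
    (\<forall>x \<in> H. \<forall>y \<in> H. x \<oplus>\<^bsub>M\<^esub> y \<in> H) \<and> (\<forall>x \<in> H. \<ominus>\<^bsub>M\<^esub> x \<in> H)"
  by (auto simp: subgroup_def a_inv_def)

lemma right_module_sub_structure: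
  assumes M: "right_module A M" and H: "subgroup H (add_monoid M)"
    and r: "\<And>x a. \<lbrakk>x \<in> H; a \<in> carrier A\<rbrakk> \<Longrightarrow> x \<odot>r\<^bsub>M\<^esub> a \<in> H"
  shows "right_module A (sub_structure M H \<rho>)"
proof -
  interpret M: right_module A M by fact
  let ?K = "sub_structure M H \<rho>"
  note H' = H[unfolded subgroup_add_iff[OF M.M.abelian_group_axioms]]
  then have sub: "x \<in> carrier M" if "x \<in> H" for x using that by auto
  interpret K: abelian_group ?K
  proof (rule abelian_groupI)
    fix x assume "x \<in> carrier ?K"
    then show "\<exists>y\<in>carrier ?K. y \<oplus>\<^bsub>?K\<^esub> x = \<zero>\<^bsub>?K\<^esub>"
      using H' by (intro bexI[of _ "\<ominus>\<^bsub>M\<^esub> x"]) (auto simp: M.M.l_neg sub)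
  qed (use H' in \<open>simp_all add: sub M.M.a_assoc, metis M.M.a_comm sub\<close>)
  show ?thesis
    by unfold_locales (simp_all add: r sub M.rsmult_distr_scalar M.rsmult_distr_vector M.rsmult_assoc M.rsmult_one)
qed

text \<open>The inclusion is colinear and therefore commutes with the dual action, and the action on
  the subcomodule stays inside it by definition.\<close>

lemma subcomodule_with_imp_dual_stable:
  assumes M: "comodule A C M" and H: "subcomodule_with A C M H \<rho>"
  shows "dual_stable A C M H"
proof -
  let ?K = "sub_structure M H \<rho>"
  have sub: "H \<subseteq> carrier M" and K: "comodule A C ?K" and i: "(\<lambda>x\<in>H. x) \<in> comod_hom A C ?K M"
    using H by (auto simp: subcomodule_with_def)
  interpret M: comodule A C M by fact
  interpret K: comodule A C ?K by fact
  have "subgroup H (add_monoid M)"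
    unfolding subgroup_add_iff[OF M.M.abelian_group_axioms]
  proof (intro conjI ballI)
    show "\<zero>\<^bsub>M\<^esub> \<in> H" using K.M.zero_closed by simp
    show "x \<oplus>\<^bsub>M\<^esub> y \<in> H" if "x \<in> H" "y \<in> H" for x y using K.M.a_closed[of x y] that by simp
    \<comment> \<open>The negative of \<open>x\<close> is formed in the subcomodule; uniqueness of
      inverses in \<open>M\<close> identifies it with the negative there.\<close>
    fix x assume x: "x \<in> H"
    then obtain y where "y \<in> H" "y \<oplus>\<^bsub>M\<^esub> x = \<zero>\<^bsub>M\<^esub>"
      using K.M.l_neg[of x] K.M.a_inv_closed[of x] by auto
    then show "\<ominus>\<^bsub>M\<^esub> x \<in> H" using x sub M.M.minus_equality[of y x] by auto
  qed fact
  moreover have "x \<odot>r\<^bsub>M\<^esub> a \<in> H" if "x \<in> H" "a \<in> carrier A" for x a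
    using K.rsmult_closed[of a x] that by simp
  moreover have "dual_act A C M \<phi> x \<in> H" if x: "x \<in> H" and \<phi>: "\<phi> \<in> left_hom A C (regular_bimodule A)" for x \<phi>
  proof -
    have "dual_act A C ?K \<phi> x \<in> H"
      using hom_in_carrier[OF dual_act_hom[OF K \<phi>]] x by simp
    then show ?thesis
      using comod_hom_dual_act[OF K M i \<phi>, of x] x by simp
  qed
  ultimately show ?thesis by (simp add: dual_stable_def)
qed

lemma dual_stable_imp_subcomodule_with:
  assumes M: "comodule A C M" and C: "locally_finite_rank A C" and H: "dual_stable A C M H"
  shows "\<exists>\<rho>. subcomodule_with A C M H \<rho>"
proof -
  interpret M: comodule A C M by fact
  have lC: "left_module A C" by (rule bimodule_left[OF comodule_bimodule[OF M]])
  have rM: "right_module A M" by (rule comodule_right_module[OF M])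
  have H_grp: "subgroup H (add_monoid M)" and H_r: "\<And>x a. \<lbrakk>x \<in> H; a \<in> carrier A\<rbrakk> \<Longrightarrow> x \<odot>r\<^bsub>M\<^esub> a \<in> H"
    and H_act: "\<And>x \<phi>. \<lbrakk>x \<in> H; \<phi> \<in> left_hom A C (regular_bimodule A)\<rbrakk> \<Longrightarrow> dual_act A C M \<phi> x \<in> H"
    using H by (auto simp: dual_stable_def)
  have sub: "H \<subseteq> carrier M" using subgroup.subset[OF H_grp] by simp
  define i where "i = (\<lambda>x\<in>H. x)"
  let ?K = "sub_structure M H"
  have K: "right_module A (?K \<rho>)" for \<rho> by (rule right_module_sub_structure[OF rM H_grp H_r])
  have i: "i \<in> right_hom A (?K \<rho>) M" for \<rho>
    using sub H_r subgroup.m_closed[OF H_grp] by (auto simp: right_hom_def hom_def i_def)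
  \<comment> \<open>All contractions of \<open>coact M x\<close> lie in \<open>H\<close> by
    stability, so the tensor itself lies in the image of H \<otimes> C.\<close>
  have ex: "\<exists>s. s \<in> carrier (tensor_group A (?K (coact M)) C) \<and>
      tensor_map A (?K (coact M)) C M C i (\<lambda>c. c) s = coact M x" if x: "x \<in> H" for x
  proof -
    let ?h = "tensor_map A (?K (coact M)) C M C i (\<lambda>c. c)"
    interpret TK: comm_group "tensor_group A (?K (coact M)) C" by (rule tensor_group_comm_group[OF K lC])
    interpret TM: comm_group "tensor_group A M C" by (rule tensor_group_comm_group[OF rM lC])
    interpret h: group_hom "tensor_group A (?K (coact M)) C" "tensor_group A M C" ?h
      using tensor_map_hom[OF K lC rM lC i left_hom_id] by unfold_locales
    have "coact M x \<in> ?h ` carrier (tensor_group A (?K (coact M)) C)"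
    proof (rule tensor_in_subgroupI[OF rM lC C coact_closed[OF M] h.img_is_subgroup])
      fix \<phi> e assume \<phi>: "\<phi> \<in> left_hom A C (regular_bimodule A)" and e: "e \<in> carrier C"
      have y: "tensor_eval A M C \<phi> (coact M x) \<in> H" using H_act[OF x \<phi>] by (simp add: dual_act_def)
      then have "?h (pure_tensor A (?K (coact M)) C (tensor_eval A M C \<phi> (coact M x)) e) =
        pure_tensor A M C (tensor_eval A M C \<phi> (coact M x)) e"
        using tensor_map_pure[OF K lC rM lC i left_hom_id _ e] by (simp add: i_def)
      then show "pure_tensor A M C (tensor_eval A M C \<phi> (coact M x)) e \<in> ?h ` carrier (tensor_group A (?K (coact M)) C)"
        using pure_tensor_closed[OF K lC _ e] y by (metis image_eqI sub_structure_sel(1))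
    qed (use x sub in auto)
    then show ?thesis by auto
  qed
  \<comment> \<open>A bare choice of preimages is enough, since
    \<open>comodule_from_injection\<close> derives all laws from compatibility with the inclusion.
    The record with \<open>coact M\<close> is a placeholder with the same tensor group as the one
    with \<rho>.\<close>
  define \<rho> where "\<rho> x = (SOME s. s \<in> carrier (tensor_group A (?K (coact M)) C) \<and>
      tensor_map A (?K (coact M)) C M C i (\<lambda>c. c) s = coact M x)" for x
  have \<rho>: "\<rho> x \<in> carrier (tensor_group A (?K \<rho>) C)" "tensor_map A (?K \<rho>) C M C i (\<lambda>c. c) (\<rho> x) = coact M x"
    if "x \<in> H" for x
    using someI_ex[OF ex[OF that]] tensor_group_sub_structure(1)[of A M H \<rho> C "coact M"]
      tensor_map_sub_structure[of A M H \<rho> C M C i "\<lambda>c. c" "coact M"]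
    by (simp_all add: \<rho>_def)
  have "comodule A C (?K \<rho>)"
    by (rule comodule_from_injection[OF M K C i]) (simp_all add: \<rho>, simp_all add: i_def inj_on_def)
  moreover have "i \<in> comod_hom A C (?K \<rho>) M"
    using i \<rho> by (auto simp: comod_hom_def i_def)
  ultimately have "subcomodule_with A C M H \<rho>"
    using sub by (simp add: subcomodule_with_def i_def)
  then show ?thesis by (rule exI[of _ \<rho>])
qed

lemma subcomodule_iff_dual_stable:
  assumes "comodule A C M" "locally_finite_rank A C"
  shows "subcomodule A C M H \<longleftrightarrow> dual_stable A C M H"
  unfolding subcomodule_def
  using subcomodule_with_imp_dual_stable dual_stable_imp_subcomodule_with assms by metis

section \<open>Self-cogenerators with commutative prime endomorphism ring\<close>

lemma (in right_module) rsmult_minus_one: "x \<in> carrier M \<Longrightarrow> x \<odot>r\<^bsub>M\<^esub> (\<ominus> \<one>) = \<ominus>\<^bsub>M\<^esub> x"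
proof -
  assume x: "x \<in> carrier M"
  have z: "x \<odot>r\<^bsub>M\<^esub> \<zero> = \<zero>\<^bsub>M\<^esub>"
    by (metis A.zero_closed A.r_zero M.add.r_cancel_one' rsmult_closed rsmult_distr_scalar x)
  have "x \<odot>r\<^bsub>M\<^esub> (\<ominus> \<one>) \<oplus>\<^bsub>M\<^esub> x = x \<odot>r\<^bsub>M\<^esub> (\<ominus> \<one> \<oplus> \<one>)"
    using x by (simp add: rsmult_distr_scalar rsmult_one)
  then have "x \<odot>r\<^bsub>M\<^esub> (\<ominus> \<one>) \<oplus>\<^bsub>M\<^esub> x = \<zero>\<^bsub>M\<^esub>" by (simp add: A.l_neg z)
  then show ?thesis using x M.minus_equality rsmult_closed by simp
qed

text \<open>Negation is the action of the scalar -1, so closure under inverses disappears from the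
  list of conditions.\<close>

lemma dual_stable_iff:
  assumes "comodule A C M"
  shows "dual_stable A C M H \<longleftrightarrow> H \<subseteq> carrier M \<and> \<zero>\<^bsub>M\<^esub> \<in> H \<and> (\<forall>x \<in> H. \<forall>y \<in> H. x \<oplus>\<^bsub>M\<^esub> y \<in> H) \<and>
    (\<forall>x \<in> H. \<forall>a \<in> carrier A. x \<odot>r\<^bsub>M\<^esub> a \<in> H) \<and>
    (\<forall>x \<in> H. \<forall>\<phi> \<in> left_hom A C (regular_bimodule A). dual_act A C M \<phi> x \<in> H)"
proof -
  interpret M: comodule A C M by fact
  have "\<ominus>\<^bsub>M\<^esub> x \<in> H" if "\<forall>x \<in> H. \<forall>a \<in> carrier A. x \<odot>r\<^bsub>M\<^esub> a \<in> H" "H \<subseteq> carrier M" "x \<in> H" for x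
  proof -
    have "x \<odot>r\<^bsub>M\<^esub> (\<ominus>\<^bsub>A\<^esub> \<one>\<^bsub>A\<^esub>) \<in> H" using that by simp
    then show ?thesis using M.rsmult_minus_one[OF subsetD[OF that(2,3)]] by simp
  qed
  then show ?thesis
    unfolding dual_stable_def subgroup_add_iff[OF M.M.abelian_group_axioms] by blast
qed

lemma dual_stable_zero:
  assumes M: "comodule A C M"
  shows "dual_stable A C M {\<zero>\<^bsub>M\<^esub>}"
proof -
  interpret M: comodule A C M by fact
  have "dual_act A C M \<phi> \<zero>\<^bsub>M\<^esub> = \<zero>\<^bsub>M\<^esub>" if "\<phi> \<in> left_hom A C (regular_bimodule A)" for \<phi>
    using hom_one[OF dual_act_hom[OF M that] M.M.add.is_group M.M.add.is_group] by simp
  moreover have "\<zero>\<^bsub>M\<^esub> \<odot>r\<^bsub>M\<^esub> a = \<zero>\<^bsub>M\<^esub>" if "a \<in> carrier A" for a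
    by (metis M.M.zero_closed M.M.r_zero M.M.add.r_cancel_one' M.rsmult_closed M.rsmult_distr_vector that)
  ultimately show ?thesis by (simp add: dual_stable_iff[OF M])
qed

lemma
  assumes "comodule A C M" "dual_stable A C M H"
  shows dual_stable_subset: "H \<subseteq> carrier M"
    and dual_stable_zero_closed: "\<zero>\<^bsub>M\<^esub> \<in> H"
    and dual_stable_add: "\<lbrakk>x \<in> H; y \<in> H\<rbrakk> \<Longrightarrow> x \<oplus>\<^bsub>M\<^esub> y \<in> H"
    and dual_stable_rsmult: "\<lbrakk>x \<in> H; a \<in> carrier A\<rbrakk> \<Longrightarrow> x \<odot>r\<^bsub>M\<^esub> a \<in> H"
    and dual_stable_dual_act: "\<lbrakk>x \<in> H; \<phi> \<in> left_hom A C (regular_bimodule A)\<rbrakk> \<Longrightarrow> dual_act A C M \<phi> x \<in> H"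
  using assms(2) by (simp_all add: dual_stable_iff[OF assms(1)])

lemma dual_stableI:
  assumes "comodule A C M" "H \<subseteq> carrier M" "\<zero>\<^bsub>M\<^esub> \<in> H"
    "\<And>x y. \<lbrakk>x \<in> H; y \<in> H\<rbrakk> \<Longrightarrow> x \<oplus>\<^bsub>M\<^esub> y \<in> H"
    "\<And>x a. \<lbrakk>x \<in> H; a \<in> carrier A\<rbrakk> \<Longrightarrow> x \<odot>r\<^bsub>M\<^esub> a \<in> H"
    "\<And>x \<phi>. \<lbrakk>x \<in> H; \<phi> \<in> left_hom A C (regular_bimodule A)\<rbrakk> \<Longrightarrow> dual_act A C M \<phi> x \<in> H"
  shows "dual_stable A C M H"
  using assms(2-6) by (simp add: dual_stable_iff[OF assms(1)])

lemma dual_stable_Inter: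
  assumes M: "comodule A C M" and ne: "\<H> \<noteq> {}" and st: "\<And>H. H \<in> \<H> \<Longrightarrow> dual_stable A C M H"
  shows "dual_stable A C M (\<Inter>\<H>)"
proof (rule dual_stableI[OF M])
  show "\<Inter>\<H> \<subseteq> carrier M" using ne dual_stable_subset[OF M st] by (simp add: Inf_less_eq)
qed (simp_all add: dual_stable_zero_closed[OF M st] dual_stable_add[OF M st] dual_stable_rsmult[OF M st]
    dual_stable_dual_act[OF M st])

lemma dual_stable_Union_chain:
  assumes M: "comodule A C M" and ne: "\<H> \<noteq> {}" and st: "\<And>H. H \<in> \<H> \<Longrightarrow> dual_stable A C M H"
    and chain: "\<And>H K. \<lbrakk>H \<in> \<H>; K \<in> \<H>\<rbrakk> \<Longrightarrow> H \<subseteq> K \<or> K \<subseteq> H"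
  shows "dual_stable A C M (\<Union>\<H>)"
proof (rule dual_stableI[OF M])
  show "\<Union>\<H> \<subseteq> carrier M" using dual_stable_subset[OF M st] by (rule Union_least)
  obtain H where "H \<in> \<H>" using ne by auto
  then show "\<zero>\<^bsub>M\<^esub> \<in> \<Union>\<H>" using dual_stable_zero_closed[OF M st] by blast
next
  fix x y assume "x \<in> \<Union>\<H>" "y \<in> \<Union>\<H>"
  then obtain H K where "H \<in> \<H>" "x \<in> H" "K \<in> \<H>" "y \<in> K" by (elim UnionE)
  with chain[of H K] obtain L where L: "L \<in> \<H>" "x \<in> L" "y \<in> L" by blast
  then show "x \<oplus>\<^bsub>M\<^esub> y \<in> \<Union>\<H>" using dual_stable_add[OF M st[OF L(1)] L(2,3)] by blast
next
  fix x a assume "x \<in> \<Union>\<H>" and a: "a \<in> carrier A"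
  then obtain H where H: "H \<in> \<H>" "x \<in> H" by (elim UnionE)
  then show "x \<odot>r\<^bsub>M\<^esub> a \<in> \<Union>\<H>" using dual_stable_rsmult[OF M st[OF H(1)] H(2) a] by blast
next
  fix x \<phi> assume "x \<in> \<Union>\<H>" and \<phi>: "\<phi> \<in> left_hom A C (regular_bimodule A)"
  then obtain H where H: "H \<in> \<H>" "x \<in> H" by (elim UnionE)
  then show "dual_act A C M \<phi> x \<in> \<Union>\<H>"
    using dual_stable_dual_act[OF M st[OF H(1)] H(2) \<phi>] by blast
qed

lemma dual_stable_image:
  assumes M: "comodule A C M" and N: "comodule A C N" and f: "f \<in> comod_hom A C M N"
  shows "dual_stable A C N (f ` carrier M)"
proof -
  interpret M: comodule A C M by fact
  note fr = comod_hom_right_hom[OF f]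
  have "\<zero>\<^bsub>N\<^esub> = f \<zero>\<^bsub>M\<^esub>"
    using right_hom_zero[OF comodule_right_module[OF M] comodule_right_module[OF N] fr] by simp
  moreover have "dual_act A C M \<phi> x \<in> carrier M" if "x \<in> carrier M" "\<phi> \<in> left_hom A C (regular_bimodule A)" for x \<phi>
    using hom_in_carrier[OF dual_act_hom[OF M that(2)]] that(1) by simp
  ultimately show ?thesis
    unfolding dual_stable_iff[OF N]
    by (auto simp: right_hom_closed[OF fr] right_hom_add[OF fr, symmetric] right_hom_smult[OF fr, symmetric]
        comod_hom_dual_act[OF M N f, symmetric] M.rsmult_closed)
qed

lemma dual_stable_vimage:
  assumes M: "comodule A C M" and N: "comodule A C N" and f: "f \<in> comod_hom A C M N"
    and L: "dual_stable A C N L"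
  shows "dual_stable A C M {x \<in> carrier M. f x \<in> L}"
proof -
  interpret M: comodule A C M by fact
  note fr = comod_hom_right_hom[OF f]
  have "dual_act A C M \<phi> x \<in> carrier M" if "x \<in> carrier M" "\<phi> \<in> left_hom A C (regular_bimodule A)" for x \<phi>
    using hom_in_carrier[OF dual_act_hom[OF M that(2)]] that(1) by simp
  then show ?thesis
    using L right_hom_zero[OF comodule_right_module[OF M] comodule_right_module[OF N] fr]
    unfolding dual_stable_iff[OF N] dual_stable_iff[OF M]
    by (auto simp: right_hom_add[OF fr] right_hom_smult[OF fr] comod_hom_dual_act[OF M N f] M.rsmult_closed)
qed

text \<open>The dual action of the subcomodule is the restriction of that of \<open>M\<close>, so
  stability is transitive.\<close>

lemma dual_stable_sub_structure:
  assumes M: "comodule A C M" and S: "subcomodule_with A C M S \<rho>"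
    and H: "dual_stable A C (sub_structure M S \<rho>) H"
  shows "dual_stable A C M H"
proof -
  let ?K = "sub_structure M S \<rho>"
  have sub: "S \<subseteq> carrier M" and K: "comodule A C ?K" and i: "(\<lambda>x\<in>S. x) \<in> comod_hom A C ?K M"
    using S by (auto simp: subcomodule_with_def)
  have "dual_act A C M \<phi> x = dual_act A C ?K \<phi> x"
    if x: "x \<in> S" and \<phi>: "\<phi> \<in> left_hom A C (regular_bimodule A)" for x \<phi>
    using comod_hom_dual_act[OF K M i \<phi>, of x] hom_in_carrier[OF dual_act_hom[OF K \<phi>], of x] x by simp
  then show ?thesis
    using H sub unfolding dual_stable_iff[OF M] dual_stable_iff[OF K] by auto
qed

lemma tensor_map_zero_left:
  assumes M: "right_module A M" and W: "left_module A W" and N: "right_module A N"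
    and f: "f \<in> right_hom A M N" and z: "\<And>x. x \<in> carrier M \<Longrightarrow> f x = \<zero>\<^bsub>N\<^esub>"
    and t: "t \<in> carrier (tensor_group A M W)"
  shows "tensor_map A M W N W f (\<lambda>w. w) t = \<one>\<^bsub>tensor_group A N W\<^esub>"
proof -
  interpret T: comm_group "tensor_group A N W" by (rule tensor_group_comm_group[OF N W])
  show ?thesis
  proof (rule tensor_hom_eqI[OF M W T.is_group _ _ _ t])
    show "tensor_map A M W N W f (\<lambda>w. w) \<in> hom (tensor_group A M W) (tensor_group A N W)"
      by (rule tensor_map_hom[OF M W N W f left_hom_id])
    show "(\<lambda>t. \<one>\<^bsub>tensor_group A N W\<^esub>) \<in> hom (tensor_group A M W) (tensor_group A N W)"
      by (simp add: hom_def)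
  qed (simp add: tensor_map_pure[OF M W N W f left_hom_id] pure_tensor_zero_left[OF N W] z)
qed

section \<open>Factor comodules and separation of points\<close>

lemma quotient_comodule_sel:
  "carrier (quotient_comodule A C M H) = a_rcosets\<^bsub>M\<^esub> H"
  "add (quotient_comodule A C M H) = set_add M"
  "\<zero>\<^bsub>quotient_comodule A C M H\<^esub> = H"
  "rsmult (quotient_comodule A C M H) = (\<lambda>D a. (THE E. \<exists>x \<in> D. E = H +>\<^bsub>M\<^esub> (x \<odot>r\<^bsub>M\<^esub> a)))"
  by (simp_all add: quotient_comodule_def quotient_module_def bimodule.extend_def)

lemma quotient_module_sel:
  "carrier (quotient_module M H) = a_rcosets\<^bsub>M\<^esub> H"
  "add (quotient_module M H) = set_add M"
  "rsmult (quotient_module M H) = (\<lambda>D a. (THE E. \<exists>x \<in> D. E = H +>\<^bsub>M\<^esub> (x \<odot>r\<^bsub>M\<^esub> a)))"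
  by (simp_all add: quotient_module_def)

text \<open>The coaction of the factor comodule is defined by means of the bare factor module. The
  two records agree in all fields that enter a tensor map, so afterwards only one of them has to be
  handled.\<close>

lemma tensor_map_quotient_module:
  "tensor_map A P W (quotient_module M H) V f g = tensor_map A P W (quotient_comodule A C M H) V f g"
  by (simp add: tensor_map_def tensor_lift_def tensor_group_def pure_tensor_def tensor_kernel_def
      tensor_relators_def quotient_comodule_sel quotient_module_sel)

lemma coact_quotient_comodule:
  "coact (quotient_comodule A C M H) D = (THE E. \<exists>x \<in> D.
     E = tensor_map A M C (quotient_comodule A C M H) C (\<lambda>y. H +>\<^bsub>M\<^esub> y) (\<lambda>c. c) (coact M x))"
  unfolding tensor_map_quotient_module[of A M C M H C _ _ C, symmetric]
  by (simp add: quotient_comodule_def bimodule.extend_def)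

lemma dual_stable_abelian_subgroup:
  assumes M: "comodule A C M" and H: "dual_stable A C M H"
  shows "abelian_subgroup H M"
proof -
  interpret M: comodule A C M by fact
  show ?thesis
    by (rule abelian_subgroupI3)
      (use H M.M.abelian_group_axioms in \<open>auto simp: dual_stable_def additive_subgroup_def\<close>)
qed

lemma
  assumes M: "comodule A C M" and H: "dual_stable A C M H"
  shows right_module_quotient: "right_module A (quotient_comodule A C M H)"
    and quotient_proj_right_hom: "(\<lambda>x. H +>\<^bsub>M\<^esub> x) \<in> right_hom A M (quotient_comodule A C M H)"
proof -
  let ?Q = "quotient_comodule A C M H"
  interpret M: comodule A C M by fact
  interpret H: abelian_subgroup H M by (rule dual_stable_abelian_subgroup[OF M H])
  have H_r: "x \<odot>r\<^bsub>M\<^esub> a \<in> H" if "x \<in> H" "a \<in> carrier A" for x a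
    using H that by (simp add: dual_stable_def)
  have rs: "(H +>\<^bsub>M\<^esub> x) \<odot>r\<^bsub>?Q\<^esub> a = H +>\<^bsub>M\<^esub> (x \<odot>r\<^bsub>M\<^esub> a)"
    if x: "x \<in> carrier M" and a: "a \<in> carrier A" for x a
    unfolding quotient_comodule_sel
  proof (rule the_equality)
    show "\<exists>y \<in> H +>\<^bsub>M\<^esub> x. H +>\<^bsub>M\<^esub> (x \<odot>r\<^bsub>M\<^esub> a) = H +>\<^bsub>M\<^esub> (y \<odot>r\<^bsub>M\<^esub> a)"
      using H.a_rcos_self[OF x] by auto
  next
    fix E assume "\<exists>y \<in> H +>\<^bsub>M\<^esub> x. E = H +>\<^bsub>M\<^esub> (y \<odot>r\<^bsub>M\<^esub> a)"
    \<comment> \<open>Two representatives differ by some \<open>k\<close> in \<open>H\<close>, and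
      \<open>k\<close> times \<open>a\<close> stays in \<open>H\<close>; so the description in
      \<open>rsmult\<close> has a unique solution.\<close>
    then obtain k where k: "k \<in> H" and E: "E = H +>\<^bsub>M\<^esub> ((k \<oplus>\<^bsub>M\<^esub> x) \<odot>r\<^bsub>M\<^esub> a)"
      by (auto simp: a_r_coset_def')
    have kM: "k \<in> carrier M" using k by (rule H.a_Hcarr)
    have "k \<odot>r\<^bsub>M\<^esub> a \<oplus>\<^bsub>M\<^esub> x \<odot>r\<^bsub>M\<^esub> a \<in> H +>\<^bsub>M\<^esub> (x \<odot>r\<^bsub>M\<^esub> a)"
      using H_r[OF k a] by (auto simp: a_r_coset_def')
    then show "E = H +>\<^bsub>M\<^esub> (x \<odot>r\<^bsub>M\<^esub> a)"
      using E H.a_repr_independence' x a kM by (simp add: M.rsmult_distr_vector M.rsmult_closed)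
  qed
  have sum: "(H +>\<^bsub>M\<^esub> x) \<oplus>\<^bsub>?Q\<^esub> (H +>\<^bsub>M\<^esub> y) = H +>\<^bsub>M\<^esub> (x \<oplus>\<^bsub>M\<^esub> y)"
    if "x \<in> carrier M" "y \<in> carrier M" for x y
    using H.a_rcos_sum[OF that] by (simp add: quotient_comodule_sel)
  have zero: "\<zero>\<^bsub>?Q\<^esub> = H +>\<^bsub>M\<^esub> \<zero>\<^bsub>M\<^esub>"
    by (simp add: quotient_comodule_sel M.M.a_coset_add_zero H.a_subset)
  have carr: "carrier ?Q = (\<lambda>x. H +>\<^bsub>M\<^esub> x) ` carrier M"
    by (auto simp: quotient_comodule_sel A_RCOSETS_def')
  interpret Q: abelian_group ?Q
  proof (rule abelian_groupI)
    fix D assume "D \<in> carrier ?Q"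
    then obtain x where "x \<in> carrier M" "D = H +>\<^bsub>M\<^esub> x" by (auto simp: carr)
    then show "\<exists>E \<in> carrier ?Q. E \<oplus>\<^bsub>?Q\<^esub> D = \<zero>\<^bsub>?Q\<^esub>"
      by (intro bexI[of _ "H +>\<^bsub>M\<^esub> (\<ominus>\<^bsub>M\<^esub> x)"]) (auto simp: carr sum zero M.M.l_neg)
  qed (auto simp: carr sum zero M.M.a_ac)
  show "right_module A ?Q"
    by unfold_locales (auto simp: carr sum rs M.rsmult_closed M.rsmult_distr_scalar
        M.rsmult_distr_vector M.rsmult_assoc M.rsmult_one)
  show "(\<lambda>x. H +>\<^bsub>M\<^esub> x) \<in> right_hom A M ?Q"
    by (auto simp: right_hom_def hom_def sum rs carr)
qed

text \<open>The coaction on a coset is a description over its representatives. Their coactions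
  differ by that of an element of \<open>H\<close>, which \<open>?h\<close> kills.\<close>

lemma coact_quotient_proj:
  assumes M: "comodule A C M" and C: "locally_finite_rank A C" and H: "dual_stable A C M H"
    and x: "x \<in> carrier M"
  shows "coact (quotient_comodule A C M H) (H +>\<^bsub>M\<^esub> x) =
    tensor_map A M C (quotient_comodule A C M H) C (\<lambda>y. H +>\<^bsub>M\<^esub> y) (\<lambda>c. c) (coact M x)"
proof -
  let ?Q = "quotient_comodule A C M H"
  let ?p = "\<lambda>y. H +>\<^bsub>M\<^esub> y"
  let ?h = "tensor_map A M C ?Q C ?p (\<lambda>c. c)"
  interpret M: comodule A C M by fact
  interpret H: abelian_subgroup H M by (rule dual_stable_abelian_subgroup[OF M H])
  have lC: "left_module A C" by (rule bimodule_left[OF comodule_bimodule[OF M]])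
  have rM: "right_module A M" by (rule comodule_right_module[OF M])
  note rQ = right_module_quotient[OF M H] and p = quotient_proj_right_hom[OF M H]
  note h = tensor_map_hom[OF rM lC rQ lC p left_hom_id]
  interpret TQ: comm_group "tensor_group A ?Q C" by (rule tensor_group_comm_group[OF rQ lC])
  obtain \<rho> where \<rho>: "subcomodule_with A C M H \<rho>"
    using dual_stable_imp_subcomodule_with[OF M C H] ..
  let ?K = "sub_structure M H \<rho>"
  have K: "comodule A C ?K" and i: "(\<lambda>x\<in>H. x) \<in> comod_hom A C ?K M"
    using \<rho> by (auto simp: subcomodule_with_def)
  note ir = comod_hom_right_hom[OF i]
  \<comment> \<open>The coaction of \<open>k\<close> comes from H \<otimes> C, and the projection is
    zero on \<open>H\<close>.\<close>
  have h_zero: "?h (coact M k) = \<one>\<^bsub>tensor_group A ?Q C\<^esub>" if k: "k \<in> H" for k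
  proof -
    have t: "coact ?K k \<in> carrier (tensor_group A ?K C)" using coact_closed[OF K, of k] k by simp
    have "?h (coact M k) = ?h (tensor_map A ?K C M C (\<lambda>x\<in>H. x) (\<lambda>c. c) (coact ?K k))"
      using comod_hom_colinear[OF i, of k] k by simp
    also have "\<dots> = tensor_map A ?K C ?Q C (\<lambda>x. ?p ((\<lambda>x\<in>H. x) x)) (\<lambda>c. c) (coact ?K k)"
      by (rule tensor_map_comp[OF comodule_right_module[OF K] lC rM lC rQ lC ir left_hom_id p left_hom_id t])
    also have "\<dots> = \<one>\<^bsub>tensor_group A ?Q C\<^esub>"
      by (rule tensor_map_zero_left[OF comodule_right_module[OF K] lC rQ right_hom_comp[OF ir p] _ t])
        (simp add: quotient_comodule_sel H.a_rcos_const)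
    finally show ?thesis .
  qed
  show ?thesis
    unfolding coact_quotient_comodule
  proof (rule the_equality)
    show "\<exists>y \<in> ?p x. ?h (coact M x) = ?h (coact M y)" using H.a_rcos_self[OF x] by auto
  next
    fix E assume "\<exists>y \<in> ?p x. E = ?h (coact M y)"
    then obtain k where k: "k \<in> H" and E: "E = ?h (coact M (k \<oplus>\<^bsub>M\<^esub> x))"
      by (auto simp: a_r_coset_def')
    have kM: "k \<in> carrier M" using k by (rule H.a_Hcarr)
    have "coact M (k \<oplus>\<^bsub>M\<^esub> x) = coact M k \<otimes>\<^bsub>tensor_group A M C\<^esub> coact M x"
      using right_hom_add[OF M.coact_linear kM x] by (simp add: tensor_sel)
    then have "E = ?h (coact M k) \<otimes>\<^bsub>tensor_group A ?Q C\<^esub> ?h (coact M x)"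
      using E hom_mult[OF h coact_closed[OF M kM] coact_closed[OF M x]] by simp
    then show "E = ?h (coact M x)"
      using h_zero[OF k] hom_in_carrier[OF h coact_closed[OF M x]] by simp
  qed
qed

text \<open>The restriction to the carrier is there because elements of \<open>comod_hom\<close> are
  extensional.\<close>

lemma comod_hom_compose_quotient_proj:
  assumes M: "comodule A C M" and N: "comodule A C N" and C: "locally_finite_rank A C"
    and H: "dual_stable A C M H" and h: "h \<in> comod_hom A C (quotient_comodule A C M H) N"
  shows "(\<lambda>x\<in>carrier M. h (H +>\<^bsub>M\<^esub> x)) \<in> comod_hom A C M N"
proof -
  let ?Q = "quotient_comodule A C M H"
  let ?p = "\<lambda>y. H +>\<^bsub>M\<^esub> y"
  interpret M: comodule A C M by fact
  have lC: "left_module A C" by (rule bimodule_left[OF comodule_bimodule[OF M]])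
  note rM = comodule_right_module[OF M] and rN = comodule_right_module[OF N]
  note rQ = right_module_quotient[OF M H] and p = quotient_proj_right_hom[OF M H]
  note hr = comod_hom_right_hom[OF h]
  have "(\<lambda>x\<in>carrier M. h (?p x)) \<in> right_hom A M N"
    using right_hom_comp[OF p hr] M.rsmult_closed by (auto simp: right_hom_def hom_def)
  moreover have "tensor_map A M C N C (\<lambda>x\<in>carrier M. h (?p x)) (\<lambda>c. c) (coact M x) = coact N (h (?p x))"
    if x: "x \<in> carrier M" for x
  proof -
    have "tensor_map A M C N C (\<lambda>x\<in>carrier M. h (?p x)) (\<lambda>c. c) (coact M x) =
        tensor_map A M C N C (\<lambda>x. h (?p x)) (\<lambda>c. c) (coact M x)"
      by (rule tensor_map_cong[THEN fun_cong]) simp_all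
    also have "\<dots> = tensor_map A ?Q C N C h (\<lambda>c. c) (coact ?Q (?p x))"
      unfolding coact_quotient_proj[OF M C H x]
      by (rule tensor_map_comp[OF rM lC rQ lC rN lC p left_hom_id hr left_hom_id coact_closed[OF M x], symmetric])
    also have "\<dots> = coact N (h (?p x))"
      by (rule comod_hom_colinear[OF h right_hom_closed[OF p x]])
    finally show ?thesis .
  qed
  ultimately show ?thesis by (simp add: comod_hom_def)
qed

text \<open>The coset of \<open>y\<close> is non-zero, hence outside the kernel of some map M/H
  \<rightarrow> M; \<open>f\<close> is that map after the projection.\<close>

lemma self_cogenerator_separates:
  assumes M: "comodule A C M" and C: "locally_finite_rank A C" and cog: "self_cogenerator A C M"
    and H: "dual_stable A C M H" and y: "y \<in> carrier M" "y \<notin> H"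
  shows "\<exists>f \<in> comod_hom A C M M. (\<forall>x \<in> H. f x = \<zero>\<^bsub>M\<^esub>) \<and> f y \<noteq> \<zero>\<^bsub>M\<^esub>"
proof -
  let ?Q = "quotient_comodule A C M H"
  let ?p = "\<lambda>y. H +>\<^bsub>M\<^esub> y"
  interpret H: abelian_subgroup H M by (rule dual_stable_abelian_subgroup[OF M H])
  note p = quotient_proj_right_hom[OF M H]
  have "?p y \<noteq> H" using H.a_rcos_self[OF y(1)] y(2) by auto
  moreover have "(\<Inter>h \<in> comod_hom A C ?Q M. a_kernel ?Q M h) = {H}"
    using cog subcomodule_iff_dual_stable[OF M C] H
    by (simp add: self_cogenerator_def quotient_comodule_sel)
  ultimately obtain h where h: "h \<in> comod_hom A C ?Q M" and "?p y \<notin> a_kernel ?Q M h" by blast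
  then have hy: "h (?p y) \<noteq> \<zero>\<^bsub>M\<^esub>"
    using right_hom_closed[OF p y(1)] by (simp add: a_kernel_def kernel_def)
  have "h (?p x) = \<zero>\<^bsub>M\<^esub>" if "x \<in> H" for x
    using right_hom_zero[OF right_module_quotient[OF M H] comodule_right_module[OF M] comod_hom_right_hom[OF h]] that
    by (simp add: quotient_comodule_sel H.a_rcos_const)
  then show ?thesis
    using comod_hom_compose_quotient_proj[OF M M C H h] hy y(1) H.a_subset
    by (intro bexI[of _ "\<lambda>x\<in>carrier M. h (?p x)"]) auto
qed

section \<open>The endomorphism ring as a domain\<close>

text \<open>Primeness is applied to the principal ideals of \<open>a\<close> and \<open>b\<close>.
  By commutativity (x a)(y b) = (x y)(a b) = 0, so their product vanishes.\<close>

lemma prime_cring_integral: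
  assumes R: "cring R" and prime: "prime_ring R" and ab: "a \<in> carrier R" "b \<in> carrier R" "a \<otimes>\<^bsub>R\<^esub> b = \<zero>\<^bsub>R\<^esub>"
  shows "a = \<zero>\<^bsub>R\<^esub> \<or> b = \<zero>\<^bsub>R\<^esub>"
proof -
  interpret cring R by fact
  let ?I = "PIdl\<^bsub>R\<^esub> a" and ?J = "PIdl\<^bsub>R\<^esub> b"
  have I: "ideal ?I R" "ideal ?J R" using ab cgenideal_ideal by auto
  have "s = \<zero>\<^bsub>R\<^esub>" if "s \<in> ?I \<cdot>\<^bsub>R\<^esub> ?J" for s
    using that
  proof induction
    case (prod i j)
    then obtain x y where xy: "x \<in> carrier R" "i = x \<otimes>\<^bsub>R\<^esub> a" "y \<in> carrier R" "j = y \<otimes>\<^bsub>R\<^esub> b"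
      by (auto simp: cgenideal_def)
    have "i \<otimes>\<^bsub>R\<^esub> j = (x \<otimes>\<^bsub>R\<^esub> y) \<otimes>\<^bsub>R\<^esub> (a \<otimes>\<^bsub>R\<^esub> b)"
      using xy(1,3) ab(1,2) by (simp add: xy(2,4) m_ac)
    then show ?case using xy(1,3) ab(3) by simp
  qed simp
  \<comment> \<open>Primeness speaks of an ideal product equal to the zero ideal, so zero must also
    be shown to belong to it.\<close>
  moreover have "\<zero>\<^bsub>R\<^esub> \<in> ?I \<cdot>\<^bsub>R\<^esub> ?J"
    using ideal_prod_is_ideal[OF I] by (simp add: additive_subgroup.zero_closed ideal.axioms(1))
  ultimately have "?I = {\<zero>\<^bsub>R\<^esub>} \<or> ?J = {\<zero>\<^bsub>R\<^esub>}"
    using prime I unfolding prime_ring_def by blast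
  then show ?thesis using cgenideal_self ab(1,2) by auto
qed

lemma cring_opposite_ring:
  assumes "cring R" shows "cring (opposite_ring R)"
proof -
  interpret cring R by fact
  show ?thesis
    by (intro cringI abelian_groupI comm_monoidI)
      (auto simp: opposite_ring_def m_ac a_ac r_distr intro: l_neg)
qed

lemma comod_End_integral:
  assumes "cring (comod_End A C M)" "E_prime A C M"
    and f: "f \<in> comod_hom A C M M" and g: "g \<in> comod_hom A C M M"
    and fg: "\<And>x. x \<in> carrier M \<Longrightarrow> f (g x) = \<zero>\<^bsub>M\<^esub>"
  shows "(\<forall>x \<in> carrier M. f x = \<zero>\<^bsub>M\<^esub>) \<or> (\<forall>x \<in> carrier M. g x = \<zero>\<^bsub>M\<^esub>)"
proof -
  have "compose (carrier M) f g = (\<lambda>x\<in>carrier M. \<zero>\<^bsub>M\<^esub>)"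
    unfolding compose_def by (rule restrict_ext) (rule fg)
  \<comment> \<open>In the opposite ring the product of \<open>g\<close> and \<open>f\<close> is
    \<open>f\<close> after \<open>g\<close>, hence the order of the instances.\<close>
  then have "f = (\<lambda>x\<in>carrier M. \<zero>\<^bsub>M\<^esub>) \<or> g = (\<lambda>x\<in>carrier M. \<zero>\<^bsub>M\<^esub>)"
    using prime_cring_integral[OF cring_opposite_ring[OF assms(1)] assms(2)[unfolded E_prime_def], of g f] f g
    by (auto simp: opposite_ring_def comod_End_def)
  then show ?thesis by auto
qed

lemma comod_End_nonzero_surj:
  assumes M: "comodule A C M" and C: "locally_finite_rank A C" and cog: "self_cogenerator A C M"
    and E: "cring (comod_End A C M)" "E_prime A C M"
    and f: "f \<in> comod_hom A C M M" and x: "x \<in> carrier M" "f x \<noteq> \<zero>\<^bsub>M\<^esub>"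
  shows "f ` carrier M = carrier M"
proof (rule ccontr)
  assume "f ` carrier M \<noteq> carrier M"
  then obtain y where y: "y \<in> carrier M" "y \<notin> f ` carrier M"
    using right_hom_closed[OF comod_hom_right_hom[OF f]] by auto
  obtain g where "g \<in> comod_hom A C M M" "\<forall>z \<in> f ` carrier M. g z = \<zero>\<^bsub>M\<^esub>" "g y \<noteq> \<zero>\<^bsub>M\<^esub>"
    using self_cogenerator_separates[OF M C cog dual_stable_image[OF M M f] y] by auto
  then show False
    using comod_End_integral[OF E, of g f] f x y(1) by auto
qed

section \<open>The smallest non-zero subcomodule\<close>

theorem theorem3p30:
  fixes R :: "'r ring" and A :: "('r, 'a) module"
    and C :: "('a, 'c) coring" and M :: "('a, 'm, 'c) comodule"
  assumes "cring R" and "\<one>\<^bsub>R\<^esub> \<noteq> \<zero>\<^bsub>R\<^esub>"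
    and "unital_algebra R A"
    and "coring A C" and "carrier C \<noteq> {\<zero>\<^bsub>C\<^esub>}"
    and "locally_projective A C"
    and "comodule A C M" and "carrier M \<noteq> {\<zero>\<^bsub>M\<^esub>}"
    and "self_injective A C M" and "self_cogenerator A C M"
    and "cring (comod_End A C M)"
    and "E_prime A C M"
  shows "irreducible_comodule A C M"
proof -
  note M = assms(7) and cog = assms(10) and E = assms(11,12)
  note C = locally_projective_imp_locally_finite_rank[OF assms(6)]
  note sub_iff = subcomodule_iff_dual_stable[OF M C]
  interpret M: comodule A C M by (rule M)
  obtain x where x: "x \<in> carrier M" "x \<noteq> \<zero>\<^bsub>M\<^esub>" using assms(8) M.M.zero_closed by blast
  have "\<exists>H \<in> {H. dual_stable A C M H \<and> x \<notin> H}.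
      \<forall>K \<in> {H. dual_stable A C M H \<and> x \<notin> H}. H \<subseteq> K \<longrightarrow> K = H"
  proof (rule subset_Zorn_nonempty)
    show "{H. dual_stable A C M H \<and> x \<notin> H} \<noteq> {}" using dual_stable_zero[OF M] x by auto
    fix \<H> assume "\<H> \<noteq> {}" "subset.chain {H. dual_stable A C M H \<and> x \<notin> H} \<H>"
    then show "\<Union>\<H> \<in> {H. dual_stable A C M H \<and> x \<notin> H}"
      using dual_stable_Union_chain[OF M, of \<H>] unfolding subset_chain_def by blast
  qed
  then obtain H where H: "dual_stable A C M H" "x \<notin> H"
    and max: "\<And>K. \<lbrakk>dual_stable A C M K; x \<notin> K; H \<subseteq> K\<rbrakk> \<Longrightarrow> K = H"
    by blast
  obtain f where f: "f \<in> comod_hom A C M M" and f0: "\<forall>z \<in> H. f z = \<zero>\<^bsub>M\<^esub>" and fx: "f x \<noteq> \<zero>\<^bsub>M\<^esub>"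
    using self_cogenerator_separates[OF M C cog H(1) x(1) H(2)] by auto
  note surj = comod_End_nonzero_surj[OF M C cog E f x(1) fx]
  have H_sub: "H \<subseteq> carrier M" using H(1) by (simp add: dual_stable_iff[OF M])
  have in_all: "f x \<in> L" if L: "dual_stable A C M L" "L \<noteq> {\<zero>\<^bsub>M\<^esub>}" for L
  proof (rule ccontr)
    assume "f x \<notin> L"
    have "L \<subseteq> carrier M" "\<zero>\<^bsub>M\<^esub> \<in> L" using L(1) by (simp_all add: dual_stable_iff[OF M])
    have "H \<subseteq> {z \<in> carrier M. f z \<in> L}" using f0 H_sub \<open>\<zero>\<^bsub>M\<^esub> \<in> L\<close> by auto
    then have "{z \<in> carrier M. f z \<in> L} = H"
      using max[OF dual_stable_vimage[OF M M f L(1)]] \<open>f x \<notin> L\<close> by blast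
    \<comment> \<open>As \<open>f\<close> is onto, every element of \<open>L\<close> is the image of
      an element of the preimage \<open>H\<close>. But \<open>f\<close> kills \<open>H\<close>,
      while \<open>L\<close> has a non-zero element.\<close>
    moreover obtain y where "y \<in> L" "y \<noteq> \<zero>\<^bsub>M\<^esub>" using L(2) \<open>\<zero>\<^bsub>M\<^esub> \<in> L\<close> by blast
    moreover from this obtain z where "z \<in> carrier M" "f z = y"
      using surj \<open>L \<subseteq> carrier M\<close> by (metis imageE subsetD)
    ultimately show False using f0 by auto
  qed
  define S where "S = \<Inter>{L. dual_stable A C M L \<and> L \<noteq> {\<zero>\<^bsub>M\<^esub>}}"
  \<comment> \<open>The family intersected in \<open>S\<close> must have a member, as the empty
    intersection is the whole type. \<open>M\<close> itself is one, being the image of the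
    surjective \<open>f\<close>.\<close>
  have "dual_stable A C M (carrier M)"
    using dual_stable_image[OF M M f] surj by simp
  then have S: "dual_stable A C M S"
    unfolding S_def using assms(8) by (intro dual_stable_Inter[OF M]) auto
  have S_min: "S \<subseteq> L" if "dual_stable A C M L" "L \<noteq> {\<zero>\<^bsub>M\<^esub>}" for L
    using that by (auto simp: S_def)
  \<comment> \<open>The non-zero element \<open>f x\<close> lies in every member of the
    family.\<close>
  have S_ne: "S \<noteq> {\<zero>\<^bsub>M\<^esub>}" using in_all fx unfolding S_def by auto
  obtain \<rho> where \<rho>: "subcomodule_with A C M S \<rho>"
    using dual_stable_imp_subcomodule_with[OF M C S] ..
  then have K: "comodule A C (sub_structure M S \<rho>)" by (simp add: subcomodule_with_def)
  have "L = {\<zero>\<^bsub>M\<^esub>} \<or> L = S" if L: "subcomodule A C (sub_structure M S \<rho>) L" for L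
  proof -
    have L': "dual_stable A C (sub_structure M S \<rho>) L"
      using L subcomodule_iff_dual_stable[OF K C] by simp
    then have "L \<subseteq> S" by (simp add: dual_stable_iff[OF K])
    \<comment> \<open>A subcomodule of \<open>S\<close> is stable in \<open>M\<close> too, so it
      contains \<open>S\<close> unless it is zero.\<close>
    then show ?thesis using S_min[OF dual_stable_sub_structure[OF M \<rho> L']] by auto
  qed
  then have "simple_subcomodule A C M S"
    unfolding simple_subcomodule_def simple_comodule_def using \<rho> K S_ne by auto
  \<comment> \<open>A competitor \<open>T\<close> lies in the non-zero subcomodule \<open>S\<close>
    by its own minimality; it contains \<open>S\<close> because, being simple, it is
    non-zero.\<close>
  moreover have "T = S" if T: "simple_subcomodule A C M T"
    "\<forall>K. subcomodule A C M K \<and> K \<noteq> {\<zero>\<^bsub>M\<^esub>} \<longrightarrow> T \<subseteq> K" for T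
  proof
    show "T \<subseteq> S" using T(2) S S_ne sub_iff by blast
    have "subcomodule A C M T" "T \<noteq> {\<zero>\<^bsub>M\<^esub>}"
      using T(1) by (auto simp: simple_subcomodule_def simple_comodule_def subcomodule_def)
    then show "S \<subseteq> T" using S_min sub_iff by blast
  qed
  ultimately show ?thesis
    unfolding irreducible_comodule_def using S_min sub_iff by (intro ex1I[of _ S]) blast+
qed

end
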